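(* Let $\phi$, $(\rho^0,u^0)$, $A$, $X$, $\Sigma_-$ be as in the context (in particular, $A$ is convex in a neighborhood of every point of $\partial\Sigma_-$). Let $T\in[0,\infty)$, suppose $(m',m'']$ is a $T$-cluster containing a point $m\in\Sigma_-$, and let $(m_-,m_+)$ be the connected component of $\Sigma_-$ containing $m$. If $(m',m'']$ contains points outside of $(m_-,m_+]$, then $(m',m'']$ must also contain all of $(m_-,m_+]$.
   Context: Kernel: $\phi:\mathbb{R}\to\mathbb{R}$ is nonnegative, even, locally integrable, and radially nonincreasing (nonincreasing on $(0,\infty)$; it may be unbounded at $0$). $\Phi(x)=\int_0^x\phi(r)\,dr$. Data: $\rho^0$ is a compactly supported Borel probability measure on $\mathbb{R}$ and $u^0\in L^\infty(d\rho^0)$. Set $M^0(x)=-\frac12+\rho^0((-\infty,x])$, $X^0(m)=\inf\{x: M^0(x)\ge m\}$ for $m\in(-\frac12,\frac12]$, $\psi^0=u^0+\Phi*\rho^0$, and define the flux $A:[-\frac12,\frac12]\to\mathbb{R}$, $A(m)=\int_{-1/2}^m\psi^0(X^0(\widetilde m))\,d\widetilde m$ (a Lipschitz function). Entropy solution: $M=M(x,t)$ denotes the unique entropy solution of $\partial_tM+\partial_x(A(M))=(\Phi*\partial_xM)\,\partial_xM$ with $M(\cdot,0)=M^0$. That is: for each $t$, $M(x,t)=-\frac12+\rho(t)((-\infty,x])$ for a probability measure $\rho(t)$ on $\mathbb{R}$, with supports bounded locally uniformly in $t$; $t\mapsto M(\cdot,t)-M^0$ is continuous into $L^1(\mathbb{R})$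 and vanishes at $t=0$; and for every $\alpha\in[-\frac12,\frac12]$, $\partial_t|M-\alpha|+\partial_x\big(\mathrm{sgn}(M-\alpha)(A(M)-A(\alpha))\big)\le(\Phi*\partial_xM)\,\partial_x|M-\alpha|$ in the sense of distributions on $\mathbb{R}\times(0,\infty)$. Put $X(m,t)=\inf\{x: M(x,t)\ge m\}$ for $m\in(-\frac12,\frac12]$; $X(\cdot,t)$ is nondecreasing and left-continuous. Clusters: for $m\in(-\frac12,\frac12]$ and $t\in[0,\infty)$ there is a $t$-cluster at $m$ if there is $\widetilde m<m$ (in $(-\frac12,\frac12]$) with $X(\widetilde m,t)=X(m,t)$; the $t$-cluster at $m$ is then the largest interval of the form $(m',m'']$ containing $m$ on which $X(\cdot,t)$ is constant. $A^{**}$ is the lower convex envelope of $A$ on $[-\frac12,\frac12]$, and $\Sigma_-=\{m\in(-\frac12,\frac12):A(m)>A^{**}(m)\}$ (an open set). Standing assumption: $A$ is convex in a neighborhood (relative to $[-\frac12,\frac12]$) of every point of the boundary $\partial\Sigma_-$. *)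

theory Defs
  imports "HOL-Probability.Probability"
begin

section \<open>Kernel and initial data\<close>

definition interaction_kernel :: "(real \<Rightarrow> real) \<Rightarrow> bool" where
  "interaction_kernel \<phi> \<longleftrightarrow>
     (\<forall>x. 0 \<le> \<phi> x) \<and> (\<forall>x. \<phi> (- x) = \<phi> x) \<and>
     (\<forall>a b. set_integrable lborel {a..b} \<phi>) \<and>
     antimono_on {0<..} \<phi>"

text \<open>For negative \<open>x\<close> the interval integral carries the usual sign, so \<open>primitive \<phi>\<close> is odd.\<close>

definition primitive :: "(real \<Rightarrow> real) \<Rightarrow> real \<Rightarrow> real" where
  "primitive \<phi> x = (LBINT r=0..x. \<phi> r)"

definition conv_measure :: "(real \<Rightarrow> real) \<Rightarrow> real measure \<Rightarrow> real \<Rightarrow> real" where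
  "conv_measure \<Phi> \<rho> x = (\<integral>y. \<Phi> (x - y) \<partial>\<rho>)"

definition compactly_supported :: "real measure \<Rightarrow> bool" where
  "compactly_supported \<rho> \<longleftrightarrow> (\<exists>K. compact K \<and> emeasure \<rho> (- K) = 0)"

definition L_infinity :: "real measure \<Rightarrow> (real \<Rightarrow> real) \<Rightarrow> bool" where
  "L_infinity \<rho> u \<longleftrightarrow> u \<in> borel_measurable \<rho> \<and> (\<exists>C. AE x in \<rho>. \<bar>u x\<bar> \<le> C)"

definition shifted_cdf :: "real measure \<Rightarrow> real \<Rightarrow> real" where
  "shifted_cdf \<rho> x = - 1 / 2 + measure \<rho> {..x}"

text \<open>Only used for \<open>m \<in> {-1/2<..1/2}\<close>, where the set below is nonempty and bounded below
  if \<open>F\<close> is the shifted distribution function of a compactly supported probability measure.\<close>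

definition gen_inverse :: "(real \<Rightarrow> real) \<Rightarrow> real \<Rightarrow> real" where
  "gen_inverse F m = Inf {x. F x \<ge> m}"

definition initial_psi :: "(real \<Rightarrow> real) \<Rightarrow> real measure \<Rightarrow> (real \<Rightarrow> real) \<Rightarrow> real \<Rightarrow> real" where
  "initial_psi \<phi> \<rho>0 u0 x = u0 x + conv_measure (primitive \<phi>) \<rho>0 x"

text \<open>The flux is meaningful on \<open>{-1/2..1/2}\<close> only.\<close>

definition flux :: "(real \<Rightarrow> real) \<Rightarrow> real measure \<Rightarrow> (real \<Rightarrow> real) \<Rightarrow> real \<Rightarrow> real" where
  "flux \<phi> \<rho>0 u0 m =
     (LBINT n=ereal (-1/2)..m. initial_psi \<phi> \<rho>0 u0 (gen_inverse (shifted_cdf \<rho>0) n))"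

section \<open>Entropy solutions\<close>

fun C_k :: "nat \<Rightarrow> (real \<times> real \<Rightarrow> real) \<Rightarrow> bool" where
  "C_k 0 f \<longleftrightarrow> continuous_on UNIV f"
| "C_k (Suc k) f \<longleftrightarrow> (\<forall>p. f differentiable (at p)) \<and>
     (\<forall>v. C_k k (\<lambda>p. frechet_derivative f (at p) v))"

text \<open>Nonnegative elements of \<open>C_c^\<infinity>(\<real> \<times> (0,\<infinity>))\<close>, extended by zero to the whole plane; points are
  pairs \<open>(x, t)\<close>.\<close>

definition nonneg_test_function :: "(real \<times> real \<Rightarrow> real) \<Rightarrow> bool" where
  "nonneg_test_function \<eta> \<longleftrightarrow>
     (\<forall>k. C_k k \<eta>) \<and> (\<forall>p. 0 \<le> \<eta> p) \<and>
     compact (closure {p. \<eta> p \<noteq> 0}) \<and> closure {p. \<eta> p \<noteq> 0} \<subseteq> UNIV \<times> {0<..}"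

abbreviation partial_x :: "(real \<times> real \<Rightarrow> real) \<Rightarrow> real \<times> real \<Rightarrow> real" where
  "partial_x \<eta> p \<equiv> frechet_derivative \<eta> (at p) (1, 0)"

abbreviation partial_t :: "(real \<times> real \<Rightarrow> real) \<Rightarrow> real \<times> real \<Rightarrow> real" where
  "partial_t \<eta> p \<equiv> frechet_derivative \<eta> (at p) (0, 1)"

text \<open>For nondecreasing right-continuous \<open>F\<close>, the distributional derivative of \<open>\<bar>F - \<alpha>\<bar>\<close> is a signed
  measure. Since \<open>\<bar>z\<bar> = max z 0 - min z 0\<close>, it is the difference of the Stieltjes measures of the
  nondecreasing functions \<open>max (F - \<alpha>) 0\<close> and \<open>min (F - \<alpha>) 0\<close>. The following is the integral of
  \<open>g\<close> against it.\<close>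

definition integral_deriv_abs :: "(real \<Rightarrow> real) \<Rightarrow> real \<Rightarrow> (real \<Rightarrow> real) \<Rightarrow> real" where
  "integral_deriv_abs F \<alpha> g =
     (\<integral>x. g x \<partial>interval_measure (\<lambda>x. max (F x - \<alpha>) 0)) -
     (\<integral>x. g x \<partial>interval_measure (\<lambda>x. min (F x - \<alpha>) 0))"

text \<open>The inequality
  \<open>\<partial>\<^sub>t \<bar>M - \<alpha>\<bar> + \<partial>\<^sub>x (sgn (M - \<alpha>) (A M - A \<alpha>)) \<le> (\<Phi> * \<partial>\<^sub>x M) \<partial>\<^sub>x \<bar>M - \<alpha>\<bar>\<close> in the sense of
  distributions on \<open>\<real> \<times> (0,\<infinity>)\<close>, where \<open>M x t\<close> is the shifted distribution function of \<open>\<rho> t\<close>, so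
  that \<open>\<partial>\<^sub>x M = \<rho>\<close>. The right-hand side is the product of the continuous function \<open>\<Phi> * \<rho> t\<close> with a
  finite signed measure at each time.\<close>

definition entropy_inequality ::
  "(real \<Rightarrow> real) \<Rightarrow> (real \<Rightarrow> real) \<Rightarrow> (real \<Rightarrow> real measure) \<Rightarrow> (real \<Rightarrow> real \<Rightarrow> real) \<Rightarrow> real \<Rightarrow> bool"
where
  "entropy_inequality \<Phi> A \<rho> M \<alpha> \<longleftrightarrow>
     (\<forall>\<eta>. nonneg_test_function \<eta> \<longrightarrow>
        - (LINT (x, t) : UNIV \<times> {0<..} | lborel.
             \<bar>M x t - \<alpha>\<bar> * partial_t \<eta> (x, t)
             + sgn (M x t - \<alpha>) * (A (M x t) - A \<alpha>) * partial_x \<eta> (x, t))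
        \<le> (LINT t : {0<..} | lborel.
             integral_deriv_abs (\<lambda>x. M x t) \<alpha> (\<lambda>x. conv_measure \<Phi> (\<rho> t) x * \<eta> (x, t))))"

text \<open>\<open>M\<close> is only constrained at times \<open>t \<ge> 0\<close>.\<close>

definition entropy_solution ::
  "(real \<Rightarrow> real) \<Rightarrow> (real \<Rightarrow> real) \<Rightarrow> (real \<Rightarrow> real) \<Rightarrow> (real \<Rightarrow> real \<Rightarrow> real) \<Rightarrow> bool"
where
  "entropy_solution \<Phi> A M0 M \<longleftrightarrow>
     (\<exists>\<rho>. (\<forall>t\<ge>0. real_distribution (\<rho> t) \<and> (\<forall>x. M x t = shifted_cdf (\<rho> t) x)) \<and>
          (\<forall>S. \<exists>R. \<forall>t\<in>{0..S}. emeasure (\<rho> t) (- {-R..R}) = 0) \<and>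
          (\<forall>t\<ge>0. integrable lborel (\<lambda>x. M x t - M0 x)) \<and>
          (\<forall>s\<ge>0. ((\<lambda>t. LINT x|lborel. \<bar>(M x t - M0 x) - (M x s - M0 x)\<bar>) \<longlongrightarrow> 0)
                    (at s within {0..})) \<and>
          (\<forall>x. M x 0 = M0 x) \<and>
          (\<forall>\<alpha>\<in>{-1/2..1/2}. entropy_inequality \<Phi> A \<rho> M \<alpha>))"

section \<open>Clusters and the convex envelope of the flux\<close>

definition is_cluster_at :: "(real \<Rightarrow> real) \<Rightarrow> real \<Rightarrow> real \<Rightarrow> real \<Rightarrow> bool" where
  "is_cluster_at X m a b \<longleftrightarrow>
     m \<in> {-1/2<..1/2} \<and> (\<exists>n\<in>{-1/2<..1/2}. n < m \<and> X n = X m) \<and>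
     m \<in> {a<..b} \<and> {a<..b} \<subseteq> {-1/2<..1/2} \<and> X constant_on {a<..b} \<and>
     (\<forall>c d. m \<in> {c<..d} \<and> {c<..d} \<subseteq> {-1/2<..1/2} \<and> X constant_on {c<..d}
        \<longrightarrow> {c<..d} \<subseteq> {a<..b})"

definition is_cluster :: "(real \<Rightarrow> real) \<Rightarrow> real \<Rightarrow> real \<Rightarrow> bool" where
  "is_cluster X a b \<longleftrightarrow> (\<exists>m. is_cluster_at X m a b)"

definition lower_convex_envelope :: "real set \<Rightarrow> (real \<Rightarrow> real) \<Rightarrow> real \<Rightarrow> real" where
  "lower_convex_envelope S f x = Sup {g x | g. convex_on S g \<and> (\<forall>y\<in>S. g y \<le> f y)}"

definition Sigma_minus :: "(real \<Rightarrow> real) \<Rightarrow> real set" where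
  "Sigma_minus A = {m \<in> {-1/2<..<1/2}. A m > lower_convex_envelope {-1/2..1/2} A m}"

definition convex_near_frontier :: "(real \<Rightarrow> real) \<Rightarrow> bool" where
  "convex_near_frontier A \<longleftrightarrow>
     (\<forall>p\<in>frontier (Sigma_minus A). \<exists>\<epsilon>>0. convex_on ({-1/2..1/2} \<inter> ball p \<epsilon>) A)"

end

(*
  A T-cluster (p, q] satisfies the Oleinik condition: the graph of A lies on or above the chord of A
  over [p, q]. The convex function A** lies below A, strictly so inside the component of Sigma_-, and
  equals A at its end points. Hence no end point of the component can be interior to the cluster
  while an end point of the cluster is interior to the component.

  For T = 0, A is affine on clusters. For T > 0 let c be the position of the jump of M(., T) from p to
  q, take p < alpha < q and suppose that A(alpha) is below the chord. The entropy
    E(z) = kappa (z - alpha)^+ + (1 - kappa) (alpha - z)^+,   kappa = (alpha - p) / (q - p),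
  attains the same value at p and q and is at least that value outside [p, q]. Test its inequality with
  a bump around c of width delta on the time interval [T - h delta, T]. By finite speed of propagation,
  for a fixed small h, M is close to p on the left slope and to q on the right slope of the bump as
  delta -> 0. There the entropy flux loses a fixed amount per unit time, whereas the transport term
  vanishes in the limit because Phi * rho is continuous and the weights of E balance. So the entropy
  in the bump decreases by at least a fixed multiple of delta. This is impossible, since the entropy at
  the initial time T - h delta exceeds the one at time T by o(delta) only.
*)
theory Submission
  imports Defs
begin

section \<open>Smooth test functions\<close>

text \<open>Two obstacles shape the argument: the inequality is given for the entropies \<bar>z -
  \<alpha>\<bar> only, and the value of \<Phi> * \<rho> at c is unknown. The choice of \<kappa>
  meets the second through the identity \<kappa> (q - \<alpha>) = (1 - \<kappa>) (\<alpha> - p). It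
  gives E the same value at p and q; and since in the mass variable the jump carries Lebesgue
  measure on (p, q), it also cancels the transport across the jump, whatever the velocity is. The
  entropy flux at q then exceeds the one at p by exactly the gap between the chord and A(\<alpha>).
  No traces of M before time T are at hand; M(., t) is only compared with M(., T) shifted by L (T -
  t). Hence the time window shrinks with the bump: L h \<le> 1/2 keeps the shift below \<delta> / 2,
  while the loss, a multiple of h \<delta>, stays of the order of the width 4 \<delta> of the bump.
  The definition controls M only after integration in time. Continuity in L^1 makes the entropy
  content of a bump continuous in t, which turns the tested inequality into one between two given
  times.\<close>

fun C_k_real :: "nat \<Rightarrow> (real \<Rightarrow> real) \<Rightarrow> bool" where
  "C_k_real 0 f \<longleftrightarrow> continuous_on UNIV f"
| "C_k_real (Suc k) f \<longleftrightarrow> (\<exists>f'. (\<forall>x. (f has_real_derivative f' x) (at x)) \<and> C_k_real k f')"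

lemma C_k_real_cont: "C_k_real k f \<Longrightarrow> continuous_on UNIV f"
  by (cases k) (auto intro!: continuous_at_imp_continuous_on intro: DERIV_isCont)

lemma C_k_real_Suc_imp: "C_k_real (Suc k) f \<Longrightarrow> C_k_real k f"
proof (induction k arbitrary: f)
  case 0
  then show ?case using C_k_real_cont[OF 0] by simp
next
  case (Suc k)
  then show ?case by (metis C_k_real.simps(2))
qed

lemma C_k_real_const: "C_k_real k (\<lambda>x. c)"
proof (induction k arbitrary: c)
  case (Suc k)
  show ?case using Suc[of 0] by (auto intro!: exI[of _ "\<lambda>x. 0"])
qed simp

lemma C_k_real_add: "C_k_real k f \<Longrightarrow> C_k_real k g \<Longrightarrow> C_k_real k (\<lambda>x. f x + g x)"
proof (induction k arbitrary: f g)
  case 0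
  then show ?case by (auto intro: continuous_intros)
next
  case (Suc k)
  then obtain f' g' where "\<forall>x. (f has_real_derivative f' x) (at x)" "C_k_real k f'"
    "\<forall>x. (g has_real_derivative g' x) (at x)" "C_k_real k g'" by auto
  then show ?case using Suc.IH[of f' g']
    by (auto intro!: exI[of _ "\<lambda>x. f' x + g' x"] derivative_eq_intros)
qed

lemma C_k_real_mult: "C_k_real k f \<Longrightarrow> C_k_real k g \<Longrightarrow> C_k_real k (\<lambda>x. f x * g x)"
proof (induction k arbitrary: f g)
  case 0
  then show ?case by (auto intro: continuous_intros)
next
  case (Suc k)
  then obtain f' g' where *: "\<forall>x. (f has_real_derivative f' x) (at x)" "C_k_real k f'"
    "\<forall>x. (g has_real_derivative g' x) (at x)" "C_k_real k g'" by auto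
  have "C_k_real k (\<lambda>x. f' x * g x + g' x * f x)"
    using * Suc C_k_real_Suc_imp by (intro C_k_real_add Suc.IH) blast+
  then show ?case using *
    by (auto intro!: exI[of _ "\<lambda>x. f' x * g x + g' x * f x"] derivative_eq_intros)
qed

lemma C_k_real_affine: "C_k_real k f \<Longrightarrow> C_k_real k (\<lambda>x. f (a * x + b))"
proof (induction k arbitrary: f)
  case 0
  then show ?case by (auto intro!: continuous_on_compose2[of UNIV f] continuous_intros)
next
  case (Suc k)
  then obtain f' where *: "\<forall>x. (f has_real_derivative f' x) (at x)" "C_k_real k f'" by auto
  have "C_k_real k (\<lambda>x. a * f' (a * x + b))"
    by (intro C_k_real_mult C_k_real_const Suc.IH *)
  moreover have "((\<lambda>x. f (a * x + b)) has_real_derivative a * f' (a * x + b)) (at x)" for x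
  proof -
    have "((\<lambda>x. a * x + b) has_real_derivative a) (at x)"
      by (auto intro!: derivative_eq_intros)
    from DERIV_chain2[where f=f, OF *(1)[rule_format] this]
    show ?thesis by (simp add: mult.commute)
  qed
  ultimately show ?case
    by (auto intro!: exI[of _ "\<lambda>x. a * f' (a * x + b)"])
qed

section \<open>A smooth function that vanishes on the negative half line\<close>

text \<open>The exponent \<open>n\<close> makes the linear span of this family closed under differentiation.\<close>

definition flat_exp :: "nat \<Rightarrow> real \<Rightarrow> real" where
  "flat_exp n x = (if x \<le> 0 then 0 else (1 / x) ^ n * exp (- (1 / x)))"

text \<open>With y = 1/x, the derivative of y^n exp(-y) with respect to x is y^(n+2) exp(-y) - n
  y^(n+1) exp(-y). At 0 the difference quotient from the right is y^(n+1) / exp(y), which tends to 0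
  as y grows.\<close>

lemma flat_exp_deriv:
  "(flat_exp n has_real_derivative flat_exp (n + 2) x - real n * flat_exp (n + 1) x) (at x)"
proof -
  consider "x < 0" | "x > 0" | "x = 0" by linarith
  then show ?thesis
  proof cases
    case 1
    have "((\<lambda>_. 0) has_real_derivative 0) (at x)" by simp
    then have "(flat_exp n has_real_derivative 0) (at x)"
      by (rule has_field_derivative_transform_within_open[of _ _ _ "{..<0}"])
         (use 1 in \<open>auto simp: flat_exp_def\<close>)
    then show ?thesis using 1 by (simp add: flat_exp_def)
  next
    case 2
    have "((\<lambda>x. (1 / x) ^ n * exp (- (1 / x))) has_real_derivative
        (1 / x) ^ (n+2) * exp (- (1 / x)) - real n * ((1 / x) ^ (n+1) * exp (- (1 / x)))) (at x)"
    proof -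
      have inv: "((\<lambda>x. 1 / x) has_real_derivative - ((1 / x) ^ 2)) (at x)"
        using 2 by (auto intro!: derivative_eq_intros simp: power2_eq_square)
      \<comment> \<open>For n = 0 the exponent \<open>n - Suc 0\<close> truncates to 0, but the
        factor \<open>real n\<close> vanishes as well.\<close>
      have "real n * (- (y ^ 2) * y ^ (n - Suc 0)) = - (real n * y ^ (n + 1))" for y :: real
        by (cases n) (simp_all add: power2_eq_square)
      from DERIV_power[OF inv, of n, unfolded this]
      have pow: "((\<lambda>x. (1 / x) ^ n) has_real_derivative - (real n * (1 / x) ^ (n + 1))) (at x)" .
      have "((\<lambda>x. exp (- (1 / x))) has_real_derivative exp (- (1 / x)) * (1 / x) ^ 2) (at x)"
        using DERIV_chain2[OF DERIV_exp DERIV_minus[OF inv]] by simp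
      from DERIV_mult[OF pow this] show ?thesis
        by (rule DERIV_cong) (simp add: power2_eq_square algebra_simps)
    qed
    then have "(flat_exp n has_real_derivative (1 / x) ^ (n+2) * exp (- (1 / x)) - real n * ((1 / x) ^ (n+1) * exp (- (1 / x)))) (at x)"
      by (rule has_field_derivative_transform_within_open[of _ _ _ "{0<..}"])
         (use 2 in \<open>auto simp: flat_exp_def\<close>)
    then show ?thesis using 2 by (simp add: flat_exp_def)
  next
    case 3
    have "((\<lambda>y. flat_exp n y / y) \<longlongrightarrow> 0) (at_left 0)"
      by (rule tendsto_eventually) (auto simp: eventually_at_left_field flat_exp_def intro: exI[of _ "-1"])
    moreover have "((\<lambda>y. flat_exp n y / y) \<longlongrightarrow> 0) (at_right 0)"
    proof -
      have "((\<lambda>y. (inverse y) ^ (n+1) / exp (inverse y)) \<longlongrightarrow> (0::real)) (at_right 0)"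
        by (rule filterlim_compose[OF tendsto_power_div_exp_0 filterlim_inverse_at_top_right])
      then show ?thesis
        by (rule Lim_transform_eventually)
          (auto simp: eventually_at_right_field flat_exp_def exp_minus field_simps intro!: exI[of _ 1])
    qed
    ultimately have "((\<lambda>y. flat_exp n y / y) \<longlongrightarrow> 0) (at 0)"
      by (simp add: filterlim_at_split)
    then show ?thesis using 3 by (simp add: has_field_derivative_iff flat_exp_def)
  qed
qed

lemma C_k_real_flat_exp: "C_k_real k (flat_exp n)"
proof (induction k arbitrary: n)
  case 0
  show ?case by (auto intro!: continuous_at_imp_continuous_on DERIV_isCont flat_exp_deriv)
next
  case (Suc k)
  have "C_k_real k (\<lambda>x. flat_exp (n + 2) x + (- real n) * flat_exp (n + 1) x)"
    by (intro C_k_real_add C_k_real_mult C_k_real_const Suc)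
  then show ?case using flat_exp_deriv[of n] by (auto intro!: exI[of _ "\<lambda>x. flat_exp (n + 2) x - real n * flat_exp (n + 1) x"])
qed

lemma flat_exp_pos: "x > 0 \<Longrightarrow> flat_exp n x > 0"
  by (simp add: flat_exp_def)

lemma flat_exp_zero: "x \<le> 0 \<Longrightarrow> flat_exp n x = 0"
  by (simp add: flat_exp_def)

section \<open>The smooth hump of unit mass on [0, 1] and its primitive\<close>

definition hump0 :: "real \<Rightarrow> real" where
  "hump0 x = flat_exp 0 x * flat_exp 0 (1 - x)"

definition hump :: "real \<Rightarrow> real" where
  "hump x = hump0 x / integral {0..1} hump0"

definition smooth_step :: "real \<Rightarrow> real" where
  "smooth_step x = (if x \<le> 0 then 0 else integral {0..x} hump)"

lemma C_k_real_hump0: "C_k_real k hump0"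
proof -
  have "C_k_real k (\<lambda>x. flat_exp 0 x * flat_exp 0 ((-1) * x + 1))"
    by (intro C_k_real_mult C_k_real_affine C_k_real_flat_exp)
  then show ?thesis unfolding hump0_def[abs_def] by simp
qed

lemma continuous_hump0 [continuous_intros]: "continuous_on S hump0"
  using C_k_real_cont[OF C_k_real_hump0[of 0]] continuous_on_subset by blast

lemma hump0_pos: "0 < x \<Longrightarrow> x < 1 \<Longrightarrow> 0 < hump0 x"
  by (simp add: hump0_def flat_exp_pos)

lemma hump0_nonneg: "0 \<le> hump0 x"
  by (simp add: hump0_def flat_exp_def)

lemma hump0_zero: "x \<le> 0 \<or> x \<ge> 1 \<Longrightarrow> hump0 x = 0"
  by (auto simp: hump0_def flat_exp_zero)

lemma integral_hump0_pos: "0 < integral {0..1} hump0"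
proof -
  have "integral {0..1} hump0 \<noteq> 0"
    using integral_eq_0_iff[of 0 1 hump0] hump0_pos[of "1/2"] hump0_nonneg continuous_hump0
    by force
  moreover have "0 \<le> integral {0..1} hump0"
    by (intro integral_nonneg integrable_continuous_interval continuous_hump0) (simp add: hump0_nonneg)
  ultimately show ?thesis by simp
qed

lemma hump_pos: "0 < x \<Longrightarrow> x < 1 \<Longrightarrow> 0 < hump x"
  by (simp add: hump_def hump0_pos integral_hump0_pos)

lemma hump_nonneg [simp]: "0 \<le> hump x"
  using integral_hump0_pos by (simp add: hump_def hump0_nonneg)

lemma hump_zero: "x \<le> 0 \<or> x \<ge> 1 \<Longrightarrow> hump x = 0"
  by (auto simp: hump_def hump0_zero)

lemma C_k_real_hump: "C_k_real k hump"
proof -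
  have "C_k_real k (\<lambda>x. (1 / integral {0..1} hump0) * hump0 x)"
    by (intro C_k_real_mult C_k_real_const C_k_real_hump0)
  then show ?thesis unfolding hump_def[abs_def] by simp
qed

lemma continuous_hump [continuous_intros]: "continuous_on S hump"
  using C_k_real_cont[OF C_k_real_hump[of 0]] continuous_on_subset by blast

lemma hump_borel [measurable]: "hump \<in> borel_measurable borel"
  by (rule borel_measurable_continuous_onI[OF continuous_hump])

lemma integral_hump: "integral {0..1} hump = 1"
  using integral_hump0_pos unfolding hump_def[abs_def] by simp

text \<open>As \<open>hump\<close> vanishes left of 0, the step is near x the integral of
  \<open>hump\<close> from the base point -\<bar>x\<bar> - 1. The case split at 0 disappears and the
  fundamental theorem applies at an interior point.\<close>

lemma smooth_step_deriv: "(smooth_step has_real_derivative hump x) (at x)"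
proof -
  have *: "smooth_step y = integral {-\<bar>x\<bar>-1..y} hump" if "y \<ge> -\<bar>x\<bar>-1" for y
  proof (cases "y \<le> 0")
    case True
    have "integral {-\<bar>x\<bar>-1..y} hump = integral {-\<bar>x\<bar>-1..y} (\<lambda>_. 0)"
      by (rule integral_cong) (use True in \<open>auto simp: hump_zero\<close>)
    then show ?thesis using True by (simp add: smooth_step_def)
  next
    case False
    have "integral {-\<bar>x\<bar>-1..0} hump + integral {0..y} hump = integral {-\<bar>x\<bar>-1..y} hump"
      by (rule Henstock_Kurzweil_Integration.integral_combine)
         (use False that in \<open>auto intro!: integrable_continuous_interval continuous_intros\<close>)
    moreover have "integral {-\<bar>x\<bar>-1..0} hump = integral {-\<bar>x\<bar>-1..0} (\<lambda>_. 0)"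
      by (rule integral_cong) (auto simp: hump_zero)
    ultimately show ?thesis using False by (simp add: smooth_step_def)
  qed
  have "((\<lambda>y. integral {-\<bar>x\<bar>-1..y} hump) has_real_derivative hump x) (at x within {-\<bar>x\<bar>-1..\<bar>x\<bar>+1})"
    by (rule integral_has_real_derivative) (auto intro!: continuous_intros)
  moreover have "x \<in> interior {-\<bar>x\<bar>-1..\<bar>x\<bar>+1}" by (auto simp: interior_atLeastAtMost_real)
  ultimately have "((\<lambda>y. integral {-\<bar>x\<bar>-1..y} hump) has_real_derivative hump x) (at x)"
    by (metis at_within_interior)
  then show ?thesis
    by (rule has_field_derivative_transform_within_open[of _ _ _ "{-\<bar>x\<bar>-1<..}"]) (auto simp: *)
qed

lemma smooth_step_deriv' [derivative_intros]:
  "(f has_real_derivative f') (at x within S) \<Longrightarrow>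
   ((\<lambda>x. smooth_step (f x)) has_real_derivative hump (f x) * f') (at x within S)"
  using DERIV_chain2 smooth_step_deriv by blast

lemma C_k_real_smooth_step: "C_k_real k smooth_step"
proof (rule C_k_real_Suc_imp)
  show "C_k_real (Suc k) smooth_step" using smooth_step_deriv C_k_real_hump by auto
qed

lemma continuous_smooth_step [continuous_intros]:
  "continuous_on S f \<Longrightarrow> continuous_on S (\<lambda>x. smooth_step (f x))"
  using continuous_on_compose2[OF C_k_real_cont[OF C_k_real_smooth_step[of 0]]] by blast

lemma smooth_step_0: "x \<le> 0 \<Longrightarrow> smooth_step x = 0"
  by (simp add: smooth_step_def)

lemma smooth_step_mono: "x \<le> y \<Longrightarrow> smooth_step x \<le> smooth_step y"
  by (rule DERIV_nonneg_imp_nondecreasing) (auto intro: smooth_step_deriv)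

lemma smooth_step_1: assumes "x \<ge> 1" shows "smooth_step x = 1"
proof -
  have "integral {0..1} hump + integral {1..x} hump = integral {0..x} hump"
    by (rule Henstock_Kurzweil_Integration.integral_combine)
       (use assms in \<open>auto intro!: integrable_continuous_interval continuous_intros\<close>)
  moreover have "integral {1..x} hump = integral {1..x} (\<lambda>_. 0)"
    by (rule integral_cong) (auto simp: hump_zero)
  ultimately show ?thesis using assms by (simp add: smooth_step_def integral_hump)
qed

lemma smooth_step_range: "0 \<le> smooth_step x" "smooth_step x \<le> 1"
  using smooth_step_mono[of "min x 0" x] smooth_step_mono[of x "max x 1"]
  by (auto simp: smooth_step_0 smooth_step_1)

text \<open>Strict positivity lets a vanishing integral of a bump times a nonnegative function force
  that function to vanish where the bump rises.\<close>

lemma smooth_step_pos: assumes "x > 0" shows "smooth_step x > 0"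
proof -
  \<comment> \<open>Stopping at 1/2 keeps the interval inside (0, 1), where \<open>hump\<close> is
    positive.\<close>
  have "smooth_step 0 < smooth_step (min x (1/2))"
    by (rule DERIV_pos_imp_increasing_open)
       (use assms in \<open>auto intro!: exI[of _ "hump _"] smooth_step_deriv hump_pos continuous_intros\<close>)
  also have "\<dots> \<le> smooth_step x" by (rule smooth_step_mono) simp
  finally show ?thesis by (simp add: smooth_step_0)
qed

lemma smooth_step_less_1: assumes "x < 1" shows "smooth_step x < 1"
proof -
  have "smooth_step x \<le> smooth_step (max x (1/2))" by (rule smooth_step_mono) simp
  also have "\<dots> < smooth_step 1"
    by (rule DERIV_pos_imp_increasing_open)
       (use assms in \<open>auto intro!: exI[of _ "hump _"] smooth_step_deriv hump_pos continuous_intros\<close>)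
  finally show ?thesis by (simp add: smooth_step_1)
qed

section \<open>Smooth functions of position and time\<close>

lemma C_k_cont: "C_k k f \<Longrightarrow> continuous_on UNIV f"
  by (cases k) (simp_all add: continuous_at_imp_continuous_on differentiable_imp_continuous_within)

lemma C_k_Suc_imp: "C_k (Suc k) f \<Longrightarrow> C_k k f"
proof (induction k arbitrary: f)
  case 0
  then show ?case using C_k_cont[OF 0] by simp
next
  case (Suc k)
  then show ?case by (metis C_k.simps(2))
qed

lemma C_k_add: "C_k k f \<Longrightarrow> C_k k g \<Longrightarrow> C_k k (\<lambda>x. f x + g x)"
proof (induction k arbitrary: f g)
  case 0
  then show ?case by (auto intro: continuous_intros)
next
  case (Suc k)
  have "frechet_derivative (\<lambda>x. f x + g x) (at p) = (\<lambda>v. frechet_derivative f (at p) v + frechet_derivative g (at p) v)" for p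
    by (rule frechet_derivative_at[symmetric])
       (use Suc.prems in \<open>simp del: split_paired_All add: has_derivative_mult has_derivative_add frechet_derivative_works[symmetric]\<close>)
  then show ?case using Suc by (simp del: split_paired_All add: differentiable_add)
qed

lemma C_k_mult: "C_k k f \<Longrightarrow> C_k k g \<Longrightarrow> C_k k (\<lambda>x. f x * g x)"
proof (induction k arbitrary: f g)
  case 0
  then show ?case by (auto intro: continuous_intros)
next
  case (Suc k)
  have fd: "frechet_derivative (\<lambda>x. f x * g x) (at p) = (\<lambda>v. f p * frechet_derivative g (at p) v + frechet_derivative f (at p) v * g p)" for p
    by (rule frechet_derivative_at[symmetric])
       (use Suc.prems in \<open>simp del: split_paired_All add: has_derivative_mult has_derivative_add frechet_derivative_works[symmetric]\<close>)
  have "C_k k (\<lambda>p. f p * frechet_derivative g (at p) v + frechet_derivative f (at p) v * g p)" for v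
    using Suc.prems Suc.prems[THEN C_k_Suc_imp]
    by (intro C_k_add Suc.IH) (simp_all del: split_paired_All)
  moreover have "(\<lambda>x. f x * g x) differentiable (at p)" for p
    using Suc.prems by (intro differentiable_mult) (simp_all del: split_paired_All)
  ultimately show ?case unfolding C_k.simps fd by blast
qed

lemma C_k_const: "C_k k (\<lambda>x. c)"
proof (induction k arbitrary: c)
  case (Suc k)
  have "frechet_derivative (\<lambda>x. c) (at p) = (\<lambda>v. 0)" for p :: "real \<times> real" by simp
  with Suc[of 0] show ?case by simp
qed simp

lemma affine_compose_has_derivative:
  fixes f :: "real \<Rightarrow> real" and p :: "real \<times> real"
  assumes "\<And>x. (f has_real_derivative f' x) (at x)"
  shows "((\<lambda>p. f (a * fst p + b * snd p + c)) has_derivative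
         (\<lambda>v. (a * fst v + b * snd v) * f' (a * fst p + b * snd p + c))) (at p)"
proof -
  have "((\<lambda>p. a * fst p + b * snd p + c) has_derivative (\<lambda>v. a * fst v + b * snd v)) (at p)"
    by (auto intro!: derivative_eq_intros)
  from has_derivative_compose[OF this assms[THEN has_field_derivative_imp_has_derivative]]
  show ?thesis by (simp add: mult.commute)
qed

text \<open>The test functions are products of functions of a single affine form in (x, t). A
  directional derivative of such a composite is a constant times a composite of the same kind, so
  the induction closes.\<close>

lemma C_k_affine_compose: "C_k_real k f \<Longrightarrow> C_k k (\<lambda>p. f (a * fst p + b * snd p + c))"
proof (induction k arbitrary: f)
  case 0
  then show ?case by (auto intro!: continuous_on_compose2[of UNIV f] continuous_intros)
next
  case (Suc k)
  then obtain f' where *: "\<And>x. (f has_real_derivative f' x) (at x)" "C_k_real k f'" by auto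
  have "frechet_derivative (\<lambda>p. f (a * fst p + b * snd p + c)) (at p) =
       (\<lambda>v. (a * fst v + b * snd v) * f' (a * fst p + b * snd p + c))" for p
    by (rule frechet_derivative_at[symmetric]) (rule affine_compose_has_derivative[OF *(1)])
  moreover have "C_k k (\<lambda>p. (a * fst v + b * snd v) * f' (a * fst p + b * snd p + c))" for v
    by (intro C_k_mult C_k_const Suc.IH *)
  moreover have "(\<lambda>p. f (a * fst p + b * snd p + c)) differentiable (at p)" for p
    using affine_compose_has_derivative[OF *(1)] differentiableI by blast
  ultimately show ?case by auto
qed

section \<open>Bumps and product test functions\<close>

definition bump :: "real \<Rightarrow> real \<Rightarrow> real \<Rightarrow> real \<Rightarrow> real" where
  "bump e a b x = smooth_step ((x - a) / e) - smooth_step ((x - b) / e)"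

text \<open>A unit mass on [a, a + e] minus a unit mass on [b, b + e]: integrating against it
  compares an average near a with one near b.\<close>

definition bump_deriv :: "real \<Rightarrow> real \<Rightarrow> real \<Rightarrow> real \<Rightarrow> real" where
  "bump_deriv e a b x = (hump ((x - a) / e) - hump ((x - b) / e)) / e"

lemma bump_has_derivative:
  assumes "e > 0" shows "(bump e a b has_real_derivative bump_deriv e a b x) (at x)"
  unfolding bump_def[abs_def] bump_deriv_def using assms
  by (auto intro!: derivative_eq_intros simp: diff_divide_distrib)

lemma C_k_real_bump: "C_k_real k (bump e a b)"
proof -
  have "C_k_real k (\<lambda>x. smooth_step ((1 / e) * x + (- (a / e))) + (-1) * smooth_step ((1 / e) * x + (- (b / e))))"
    by (intro C_k_real_add C_k_real_mult C_k_real_const C_k_real_affine C_k_real_smooth_step)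
  then show ?thesis unfolding bump_def[abs_def] by (simp add: diff_divide_distrib)
qed

context
  fixes e a b :: real
  assumes e: "e > 0" and ab: "a \<le> b"
begin

lemma bump_nonneg: "0 \<le> bump e a b x"
  using smooth_step_mono[of "(x - b) / e" "(x - a) / e"] e ab
  by (simp add: bump_def divide_right_mono)

lemma bump_le_1: "bump e a b x \<le> 1"
  using smooth_step_range[of "(x - b) / e"] smooth_step_range[of "(x - a) / e"]
  by (simp add: bump_def)

lemma bump_zero: "x \<le> a \<or> b + e \<le> x \<Longrightarrow> bump e a b x = 0"
  using e ab by (auto simp: bump_def smooth_step_0 smooth_step_1 field_simps divide_nonpos_pos)

lemma bump_deriv_zero: "x \<le> a \<or> b + e \<le> x \<or> (a + e \<le> x \<and> x \<le> b) \<Longrightarrow> bump_deriv e a b x = 0"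
  using e ab by (auto simp: bump_deriv_def hump_zero field_simps divide_nonpos_pos)

lemma bump_one: "a + e \<le> x \<Longrightarrow> x \<le> b \<Longrightarrow> bump e a b x = 1"
  using e ab by (auto simp: bump_def smooth_step_0 smooth_step_1 field_simps divide_nonpos_pos)

lemma bump_deriv_nonneg: "x \<le> b \<Longrightarrow> 0 \<le> bump_deriv e a b x"
  using e ab by (auto simp: bump_deriv_def hump_zero field_simps divide_nonpos_pos)

lemma bump_deriv_nonpos: "a + e \<le> x \<Longrightarrow> bump_deriv e a b x \<le> 0"
  using e ab by (auto simp: bump_deriv_def hump_zero field_simps)

end

lemma continuous_bump_deriv: "continuous_on S f \<Longrightarrow> continuous_on S (\<lambda>x. bump_deriv e a b (f x))"
  unfolding bump_deriv_def divide_inverse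
  by (intro continuous_intros continuous_on_compose2[OF continuous_hump[of UNIV]]) auto

lemma continuous_bump: "continuous_on S f \<Longrightarrow> continuous_on S (\<lambda>x. bump e a b (f x))"
  unfolding bump_def divide_inverse by (intro continuous_intros)

lemma bump_borel [measurable]: "bump e a b \<in> borel_measurable borel"
  "bump_deriv e a b \<in> borel_measurable borel"
  by (intro borel_measurable_continuous_onI continuous_bump continuous_bump_deriv continuous_intros)+

lemma has_bochner_integral_hump: "has_bochner_integral lborel hump 1"
proof -
  have "has_bochner_integral lborel (\<lambda>x. hump x * indicator {0..1} x) (smooth_step 1 - smooth_step 0)"
    by (rule has_bochner_integral_FTC_Icc_nonneg)
       (auto intro!: smooth_step_deriv)
  moreover have "(\<lambda>x. hump x * indicator {0..1} x) = hump"
  proof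
    show "hump x * indicator {0..1} x = hump x" for x
      by (cases "0 \<le> x \<and> x \<le> 1") (auto simp: hump_zero)
  qed
  ultimately show ?thesis by (simp add: smooth_step_0 smooth_step_1)
qed

lemma has_bochner_integral_scaled_hump:
  assumes "e > 0" shows "has_bochner_integral lborel (\<lambda>x. hump ((x - a) / e) / e) 1"
proof -
  have eq: "(\<lambda>x. hump ((x - a) / e) / e) = (\<lambda>x. inverse e * hump (- a / e + inverse e * x))"
    by (simp add: fun_eq_iff diff_divide_distrib field_simps)
  have i: "integrable lborel hump" and v: "(LINT x|lborel. hump x) = 1"
    using has_bochner_integral_hump by (auto simp: has_bochner_integral_iff)
  have "integrable lborel (\<lambda>x. hump (- a / e + inverse e * x))"
    using i assms by (intro lborel_integrable_real_affine) auto
  moreover have "(LINT x|lborel. hump x) = \<bar>inverse e\<bar> *\<^sub>R (LINT x|lborel. hump (- a / e + inverse e * x))"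
    using assms by (intro lborel_integral_real_affine) auto
  ultimately show ?thesis unfolding eq using assms v by (simp add: has_bochner_integral_iff)
qed

lemma has_bochner_integral_bump_deriv:
  assumes "e > 0" shows "has_bochner_integral lborel (bump_deriv e a b) 0"
  using has_bochner_integral_diff[OF has_bochner_integral_scaled_hump[OF assms, of a]
      has_bochner_integral_scaled_hump[OF assms, of b]]
  unfolding bump_deriv_def[abs_def] by (simp add: diff_divide_distrib)

text \<open>The spatial bump travels with velocity -v: it stands still for the shock and moves for
  finite speed of propagation. As 0 < s1, the support stays at positive times, and the bound on t
  turns the bound on x + v t into one on x.\<close>

lemma product_test_function:
  fixes e d a b s1 s2 v :: real
  assumes e: "e > 0" "d > 0" and ab: "a \<le> b" "s1 \<le> s2" and s1: "0 < s1"
  defines "\<eta> \<equiv> (\<lambda>p. bump e s1 s2 (snd p) * bump d a b (fst p + v * snd p))"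
  shows "nonneg_test_function \<eta>"
    and "partial_x \<eta> (x, t) = bump e s1 s2 t * bump_deriv d a b (x + v * t)"
    and "partial_t \<eta> (x, t) = bump_deriv e s1 s2 t * bump d a b (x + v * t)
           + v * (bump e s1 s2 t * bump_deriv d a b (x + v * t))"
proof -
  have \<eta>: "\<eta> = (\<lambda>p. bump e s1 s2 (0 * fst p + 1 * snd p + 0) * bump d a b (1 * fst p + v * snd p + 0))"
    by (simp add: \<eta>_def)
  have C: "C_k k \<eta>" for k
    unfolding \<eta> by (intro C_k_mult C_k_affine_compose C_k_real_bump)
  let ?K = "{p. s1 \<le> snd p} \<inter> {p. snd p \<le> s2 + e} \<inter> {p. a \<le> fst p + v * snd p} \<inter> {p. fst p + v * snd p \<le> b + d}"
  have sub: "{p. \<eta> p \<noteq> 0} \<subseteq> ?K"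
  proof
    fix p assume "p \<in> {p. \<eta> p \<noteq> 0}"
    then have "bump e s1 s2 (snd p) \<noteq> 0" "bump d a b (fst p + v * snd p) \<noteq> 0"
      by (auto simp: \<eta>_def)
    then have "\<not> (snd p \<le> s1 \<or> s2 + e \<le> snd p)" "\<not> (fst p + v * snd p \<le> a \<or> b + d \<le> fst p + v * snd p)"
      using bump_zero[OF e(1) ab(2)] bump_zero[OF e(2) ab(1)] by blast+
    then show "p \<in> ?K" by simp
  qed
  have cl: "closed ?K" by (intro closed_Int closed_Collect_le continuous_intros)
  have "\<bar>fst p\<bar> \<le> \<bar>a\<bar> + \<bar>b + d\<bar> + \<bar>v\<bar> * (s2 + e)" if "p \<in> ?K" for p
  proof -
    have "\<bar>v * snd p\<bar> \<le> \<bar>v\<bar> * (s2 + e)"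
      using that s1 by (auto simp: abs_mult intro!: mult_left_mono)
    then show ?thesis using that by auto
  qed
  then have "?K \<subseteq> cbox (- (\<bar>a\<bar> + \<bar>b + d\<bar> + \<bar>v\<bar> * (s2 + e)), s1) (\<bar>a\<bar> + \<bar>b + d\<bar> + \<bar>v\<bar> * (s2 + e), s2 + e)"
    by (fastforce simp: cbox_Pair_eq abs_le_iff)
  then have cp: "compact ?K" using cl bounded_cbox bounded_subset compact_eq_bounded_closed by blast
  have cs: "closure {p. \<eta> p \<noteq> 0} \<subseteq> ?K" using sub cl by (rule closure_minimal)
  show "nonneg_test_function \<eta>"
    unfolding nonneg_test_function_def
  proof (intro conjI allI)
    show "C_k k \<eta>" for k by (rule C)
    show "0 \<le> \<eta> p" for p using bump_nonneg e ab by (simp add: \<eta>_def)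
    show "compact (closure {p. \<eta> p \<noteq> 0})"
      using cs cp by (meson closed_closure compact_Int_closed compact_closure bounded_subset compact_imp_bounded closure_subset order_trans)
    have "?K \<subseteq> UNIV \<times> {0<..}" using s1 by auto
    with cs show "closure {p. \<eta> p \<noteq> 0} \<subseteq> UNIV \<times> {0<..}" by (rule order_trans)
  qed
  have "(\<eta> has_derivative (\<lambda>w. bump e s1 s2 (snd (x, t)) * ((1 * fst w + v * snd w) * bump_deriv d a b (1 * fst (x,t) + v * snd (x, t) + 0)) +
     ((0 * fst w + 1 * snd w) * bump_deriv e s1 s2 (0 * fst (x,t) + 1 * snd (x, t) + 0)) * bump d a b (fst (x, t) + v * snd (x, t)))) (at (x, t))"
    unfolding \<eta>
    by (rule has_derivative_mult[THEN has_derivative_eq_rhs])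
       (rule affine_compose_has_derivative bump_has_derivative e | simp add: fun_eq_iff)+
  note fd = frechet_derivative_at[OF this, symmetric]
  show "partial_x \<eta> (x, t) = bump e s1 s2 t * bump_deriv d a b (x + v * t)"
    "partial_t \<eta> (x, t) = bump_deriv e s1 s2 t * bump d a b (x + v * t)
           + v * (bump e s1 s2 t * bump_deriv d a b (x + v * t))"
    unfolding fd by (simp_all add: algebra_simps)
qed

lemma continuous_on_Icc_bounded:
  fixes f :: "real \<Rightarrow> real"
  assumes "continuous_on {a..b} f"
  obtains B where "B \<ge> 0" "\<And>x. x \<in> {a..b} \<Longrightarrow> \<bar>f x\<bar> \<le> B"
proof -
  have "bounded (f ` {a..b})" by (intro compact_imp_bounded compact_continuous_image assms) auto
  then obtain B where "\<And>z. z \<in> f ` {a..b} \<Longrightarrow> norm z \<le> B" unfolding bounded_iff by blast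
  then show ?thesis by (intro that[of "max B 0"]) force+
qed

text \<open>Controls how much a moving bump changes at a fixed point during a short time.\<close>

lemma bump_lipschitz:
  assumes "e > 0"
  obtains K where "K \<ge> 0" "\<And>x y. \<bar>bump e a b x - bump e a b y\<bar> \<le> K * \<bar>x - y\<bar>"
proof -
  obtain B where B: "\<And>x. x \<in> {0..1} \<Longrightarrow> \<bar>hump x\<bar> \<le> B"
    using continuous_on_Icc_bounded[OF continuous_hump] by metis
  have B': "\<bar>hump x\<bar> \<le> max B 0" for x
    using B[of x] hump_zero[of x] by (cases "x \<in> {0..1}") auto
  have D: "\<bar>bump_deriv e a b x\<bar> \<le> 2 * max B 0 / e" for x
  proof -
    have "\<bar>hump ((x - a) / e) - hump ((x - b) / e)\<bar> \<le> 2 * max B 0"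
      using B'[of "(x - a) / e"] B'[of "(x - b) / e"] by linarith
    then show ?thesis using assms by (simp add: bump_deriv_def abs_divide divide_right_mono)
  qed
  show ?thesis
  proof
    show "0 \<le> 2 * max B 0 / e" using assms by simp
    show "\<bar>bump e a b x - bump e a b y\<bar> \<le> (2 * max B 0 / e) * \<bar>x - y\<bar>" for x y
      using field_differentiable_bound[of UNIV "bump e a b" "bump_deriv e a b" "2 * max B 0 / e" x y]
        D bump_has_derivative[OF assms] by simp
  qed
qed

text \<open>The integrand is the derivative of t times the bump, which vanishes at both ends of its
  support. This disposes of the linear term c t in \<open>weak_derivative_le\<close>.\<close>

lemma has_bochner_integral_bump_by_parts:
  assumes "e > 0" "a \<le> b"
  shows "has_bochner_integral lborel (\<lambda>t. bump_deriv e a b t * t + bump e a b t) 0"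
proof -
  have "has_bochner_integral lborel (\<lambda>t. (bump_deriv e a b t * t + bump e a b t) * indicator {a..b+e} t)
     (bump e a b (b+e) * (b+e) - bump e a b a * a)"
  proof (rule has_bochner_integral_FTC_Icc_real)
    show "a \<le> b + e" using assms by simp
    show "((\<lambda>t. bump e a b t * t) has_real_derivative bump_deriv e a b t * t + bump e a b t) (at t)" for t
      using DERIV_mult[OF bump_has_derivative[OF assms(1)] DERIV_ident] by (simp add: mult.commute)
    have "continuous_on UNIV (\<lambda>t. bump_deriv e a b t * t + bump e a b t)"
      by (intro continuous_intros continuous_bump continuous_bump_deriv)
    then show "isCont (\<lambda>t. bump_deriv e a b t * t + bump e a b t) t" for t
      by (simp add: continuous_on_eq_continuous_at)
  qed
  moreover have "(\<lambda>t. (bump_deriv e a b t * t + bump e a b t) * indicator {a..b+e} t) =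
     (\<lambda>t. bump_deriv e a b t * t + bump e a b t)"
  proof
    show "(bump_deriv e a b t * t + bump e a b t) * indicator {a..b+e} t = bump_deriv e a b t * t + bump e a b t" for t
      using bump_zero[OF assms, of t] bump_deriv_zero[OF assms, of t]
      by (cases "a \<le> t \<and> t \<le> b + e") auto
  qed
  ultimately show ?thesis using assms by (simp add: bump_zero)
qed

lemma bump_deriv_bounded:
  assumes "e > 0" "a \<le> b"
  obtains B where "B \<ge> 0" "\<And>x. \<bar>bump_deriv e a b x\<bar> \<le> B"
proof -
  obtain B where B: "B \<ge> 0" "\<And>x. x \<in> {a..b+e} \<Longrightarrow> \<bar>bump_deriv e a b x\<bar> \<le> B"
    using continuous_on_Icc_bounded[OF continuous_bump_deriv[OF continuous_on_id]] by metis
  show ?thesis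
  proof (rule that[OF B(1)])
    show "\<bar>bump_deriv e a b x\<bar> \<le> B" for x
      using B(1) B(2)[of x] bump_deriv_zero[OF assms, of x] by (cases "x \<in> {a..b+e}") auto
  qed
qed

lemma bump_abs_le: "e > 0 \<Longrightarrow> a \<le> b \<Longrightarrow> \<bar>bump e a b x\<bar> \<le> 1"
  using bump_nonneg[of e a b x] bump_le_1[of e a b x] by simp

text \<open>As an integral over the half line left of z, the bump at a quantile can be exchanged
  with an integral over mass levels.\<close>

lemma bump_eq_integral:
  assumes d: "d > 0" and ab: "a \<le> b"
  shows "bump d a b z = (LINT u|lborel. indicator {..<z} u * bump_deriv d a b u)"
proof -
  \<comment> \<open>Starting at \<open>min a z\<close> also covers z < a, since the bump vanishes up
    to a.\<close>
  have "has_bochner_integral lborel (\<lambda>u. bump_deriv d a b u * indicator {min a z..z} u)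
     (bump d a b z - bump d a b (min a z))"
  proof (rule has_bochner_integral_FTC_Icc_real)
    show "(bump d a b has_real_derivative bump_deriv d a b u) (at u)" for u
      by (rule bump_has_derivative[OF d])
    have "continuous_on UNIV (bump_deriv d a b)"
      by (intro continuous_bump_deriv continuous_intros)
    then show "isCont (bump_deriv d a b) u" for u
      by (simp add: continuous_on_eq_continuous_at)
  qed simp
  then have "(LINT u|lborel. bump_deriv d a b u * indicator {min a z..z} u) = bump d a b z"
    using bump_zero[OF d ab, of "min a z"] by (simp add: has_bochner_integral_integral_eq)
  also have "(LINT u|lborel. bump_deriv d a b u * indicator {min a z..z} u) =
     (LINT u|lborel. indicator {..<z} u * bump_deriv d a b u)"
  proof (rule integral_cong_AE)
    show "AE u in lborel. bump_deriv d a b u * indicator {min a z..z} u = indicator {..<z} u * bump_deriv d a b u"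
      using AE_lborel_singleton[of z]
    proof eventually_elim
      case (elim u)
      then show ?case
        using bump_deriv_zero[OF d ab, of u] by (cases "u \<le> a") (auto simp: indicator_def)
    qed
  qed measurable
  finally show ?thesis by simp
qed

section \<open>Distribution functions and their generalized inverses\<close>

text \<open>Normalizes \<open>min (F - \<alpha>) 0\<close>, whose limit at minus infinity need not
  be 0, to a distribution function that vanishes there.\<close>

lemma interval_measure_shift: "interval_measure (\<lambda>x. F x + c) = interval_measure F"
  unfolding interval_measure_def by simp

context real_distribution
begin

lemma shifted_cdf_eq: "shifted_cdf M x = cdf M x - 1/2"
  by (simp add: shifted_cdf_def cdf_def)

lemma shifted_cdf_range: "-1/2 \<le> shifted_cdf M x" "shifted_cdf M x \<le> 1/2"
  using cdf_nonneg[of x] cdf_bounded_prob[of x] by (auto simp: shifted_cdf_eq)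

lemma shifted_cdf_mono: "x \<le> y \<Longrightarrow> shifted_cdf M x \<le> shifted_cdf M y"
  using cdf_nondecreasing by (auto simp: shifted_cdf_eq)

lemma shifted_cdf_right_cont: "continuous (at_right x) (shifted_cdf M)"
  unfolding shifted_cdf_eq[abs_def] by (intro continuous_intros cdf_is_right_cont)

lemma shifted_cdf_at_bot: "(shifted_cdf M \<longlongrightarrow> -1/2) at_bot"
proof -
  have "((\<lambda>x. cdf M x - 1/2) \<longlongrightarrow> -1/2) at_bot"
    by (rule tendsto_eq_rhs[OF tendsto_diff[OF cdf_lim_at_bot tendsto_const]]) simp
  then show ?thesis by (simp only: shifted_cdf_eq[abs_def])
qed

lemma shifted_cdf_at_top: "(shifted_cdf M \<longlongrightarrow> 1/2) at_top"
proof -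
  have "((\<lambda>x. cdf M x - 1/2) \<longlongrightarrow> 1/2) at_top"
    by (rule tendsto_eq_rhs[OF tendsto_diff[OF cdf_lim_at_top_prob tendsto_const]]) simp
  then show ?thesis by (simp only: shifted_cdf_eq[abs_def])
qed

lemma shifted_cdf_borel [measurable]: "shifted_cdf M \<in> borel_measurable borel"
  by (intro borel_measurable_mono monoI shifted_cdf_mono)

interpretation scdf: right_continuous_mono "shifted_cdf M" "-1/2" "1/2"
  by standard
     (rule shifted_cdf_right_cont monoI shifted_cdf_mono shifted_cdf_at_bot shifted_cdf_at_top | assumption)+

text \<open>The Galois connection between a distribution function and its quantile function. The end
  levels are left out: at -1/2 the set of the infimum is the whole line, and the level 1/2 need not
  be attained.\<close>

lemma gen_inverse_le_iff:
  "-1/2 < m \<Longrightarrow> m < 1/2 \<Longrightarrow> gen_inverse (shifted_cdf M) m \<le> x \<longleftrightarrow> m \<le> shifted_cdf M x"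
  using scdf.pseudoinverse[of m x] by (simp add: gen_inverse_def)

lemma gen_inverse_mono_on: "mono_on {-1/2<..<1/2} (gen_inverse (shifted_cdf M))"
  using scdf.mono_I by (simp add: gen_inverse_def[abs_def])

lemma gen_inverse_measurable:
  assumes "{\<alpha><..<\<beta>} \<subseteq> {-1/2<..<1/2}"
  shows "gen_inverse (shifted_cdf M) \<in> borel_measurable (restrict_space borel {\<alpha><..<\<beta>})"
  by (intro borel_measurable_mono_on_fnc mono_on_subset[OF gen_inverse_mono_on] assms)

text \<open>The quantile transform for the part of the measure between the mass levels \<alpha> and
  \<beta>. By the Galois connection the preimage of a half line up to x consists of the levels up to
  \<open>shifted_cdf M x\<close>, so the two distribution functions agree, and they determine the
  measures.\<close>

lemma distr_gen_inverse:
  assumes \<alpha>: "-1/2 \<le> \<alpha>" "\<alpha> \<le> \<beta>" "\<beta> \<le> 1/2"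
  assumes N: "finite_borel_measure N"
    "\<And>x. cdf N x = max (min (shifted_cdf M x) \<beta> - \<alpha>) 0"
  shows "N = distr (restrict_space lborel {\<alpha><..<\<beta>}) borel (gen_inverse (shifted_cdf M))"
proof (rule cdf_unique')
  let ?\<Omega> = "restrict_space lborel {\<alpha><..<\<beta>}" and ?X = "gen_inverse (shifted_cdf M)"
  have sub: "{\<alpha><..<\<beta>} \<subseteq> {-1/2<..<1/2}" using \<alpha> by auto
  have [measurable]: "?X \<in> measurable ?\<Omega> borel"
    using gen_inverse_measurable[OF sub]
    by (simp add: measurable_cong_sets[OF sets_restrict_space_cong[OF sets_lborel] refl])
  interpret \<Omega>: finite_measure ?\<Omega>
    by standard (use \<alpha> in \<open>simp add: space_restrict_space emeasure_restrict_space\<close>)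
  show "finite_borel_measure (distr ?\<Omega> borel ?X)"
    by (intro finite_borel_measure.intro finite_borel_measure_axioms.intro \<Omega>.finite_measure_distr) auto
  show "finite_borel_measure N" by fact
  show "cdf N = cdf (distr ?\<Omega> borel ?X)"
  proof
    fix x
    have "cdf (distr ?\<Omega> borel ?X) x = measure lborel ({\<alpha><..<\<beta>} \<inter> {..shifted_cdf M x})"
      unfolding cdf_def using sub
      by (subst measure_distr)
         (auto simp: space_restrict_space measure_restrict_space gen_inverse_le_iff subset_iff
            intro!: arg_cong2[where f=measure])
    also have "\<dots> = max (min (shifted_cdf M x) \<beta> - \<alpha>) 0"
    proof -
      consider "shifted_cdf M x \<le> \<alpha>" | "\<alpha> < shifted_cdf M x" "shifted_cdf M x < \<beta>"
        | "\<alpha> < shifted_cdf M x" "\<beta> \<le> shifted_cdf M x" by linarith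
      then show ?thesis
      proof cases
        case 1
        then have "{\<alpha><..<\<beta>} \<inter> {..shifted_cdf M x} = {}" by auto
        then show ?thesis using 1 by simp
      next
        case 2
        then have "{\<alpha><..<\<beta>} \<inter> {..shifted_cdf M x} = {\<alpha><..shifted_cdf M x}" by auto
        then show ?thesis using 2 by simp
      next
        case 3
        then have "{\<alpha><..<\<beta>} \<inter> {..shifted_cdf M x} = {\<alpha><..<\<beta>}" by auto
        then show ?thesis using 3 \<alpha> by simp
      qed
    qed
    finally show "cdf N x = cdf (distr ?\<Omega> borel ?X) x" using N(2) by simp
  qed
qed

lemma integral_gen_inverse:
  fixes g :: "real \<Rightarrow> real"
  assumes "-1/2 \<le> \<alpha>" "\<alpha> \<le> \<beta>" "\<beta> \<le> 1/2"
  assumes "finite_borel_measure N" "\<And>x. cdf N x = max (min (shifted_cdf M x) \<beta> - \<alpha>) 0"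
  assumes [measurable]: "g \<in> borel_measurable borel"
  shows "(\<integral>x. g x \<partial>N) = (LINT m:{\<alpha><..<\<beta>}|lborel. g (gen_inverse (shifted_cdf M) m))"
proof -
  have sub: "{\<alpha><..<\<beta>} \<subseteq> {-1/2<..<1/2}" using assms by auto
  have [measurable]: "gen_inverse (shifted_cdf M) \<in> measurable (restrict_space lborel {\<alpha><..<\<beta>}) borel"
    using gen_inverse_measurable[OF sub]
    by (simp add: measurable_cong_sets[OF sets_restrict_space_cong[OF sets_lborel] refl])
  show ?thesis
    unfolding distr_gen_inverse[OF assms(1-3) assms(4,5)]
    by (simp add: integral_distr integral_restrict_space set_lebesgue_integral_def)
qed

lemma integral_distribution_gen_inverse:
  fixes g :: "real \<Rightarrow> real"
  assumes "g \<in> borel_measurable borel"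
  shows "(\<integral>x. g x \<partial>M) = (LINT m:{-1/2<..<1/2}|lborel. g (gen_inverse (shifted_cdf M) m))"
proof (rule integral_gen_inverse)
  show "cdf M x = max (min (shifted_cdf M x) (1/2) - (-1/2)) 0" for x
    using shifted_cdf_range[of x] shifted_cdf_eq[of x] by linarith
qed (use assms finite_borel_measure_M in auto)

lemma interval_measure_clipped_cdf:
  fixes \<alpha> \<beta> :: real
  assumes \<alpha>: "-1/2 \<le> \<alpha>" "\<alpha> \<le> \<beta>" "\<beta> \<le> 1/2"
  defines "G \<equiv> (\<lambda>x. max (min (shifted_cdf M x) \<beta> - \<alpha>) 0)"
  shows "finite_borel_measure (interval_measure G)" "cdf (interval_measure G) = G"
proof -
  have 1: "x \<le> y \<Longrightarrow> G x \<le> G y" for x y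
    using shifted_cdf_mono[of x y] by (auto simp: G_def)
  have 2: "continuous (at_right a) G" for a
    unfolding G_def by (intro continuous_intros continuous_max continuous_min shifted_cdf_right_cont)
  have "(G \<longlongrightarrow> max (min (-1/2) \<beta> - \<alpha>) 0) at_bot"
    unfolding G_def by (intro tendsto_intros tendsto_max tendsto_min shifted_cdf_at_bot)
  moreover have "max (min (-1/2) \<beta> - \<alpha>) 0 = 0" using \<alpha> by (auto simp: max_def min_def)
  ultimately have 3: "(G \<longlongrightarrow> 0) at_bot" by simp
  have "(G \<longlongrightarrow> max (min (1/2) \<beta> - \<alpha>) 0) at_top"
    unfolding G_def by (intro tendsto_intros tendsto_max tendsto_min shifted_cdf_at_top)
  moreover have "max (min (1/2) \<beta> - \<alpha>) 0 = \<beta> - \<alpha>" using \<alpha> by (auto simp: max_def min_def)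
  ultimately have 4: "(G \<longlongrightarrow> \<beta> - \<alpha>) at_top" by simp
  show "finite_borel_measure (interval_measure G)"
    by (rule finite_borel_measure_interval_measure[OF 1 2 3 4]) (use \<alpha> in auto)
  show "cdf (interval_measure G) = G" by (rule cdf_interval_measure[OF 1 2 3])
qed

text \<open>Both Stieltjes measures come from clipping the distribution function, to [\<alpha>, 1/2]
  and, up to an additive constant, to [-1/2, \<alpha>]. In the mass variable they become Lebesgue
  measure on these intervals, so the time dependence sits in the integrand alone.\<close>

lemma integral_deriv_abs_eq:
  fixes \<alpha> :: real
  assumes \<alpha>: "-1/2 \<le> \<alpha>" "\<alpha> \<le> 1/2" and g: "g \<in> borel_measurable borel"
  shows "integral_deriv_abs (shifted_cdf M) \<alpha> g =
     (LINT m:{\<alpha><..<1/2}|lborel. g (gen_inverse (shifted_cdf M) m)) -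
     (LINT m:{-1/2<..<\<alpha>}|lborel. g (gen_inverse (shifted_cdf M) m))"
proof -
  have 1: "(\<lambda>x. max (shifted_cdf M x - \<alpha>) 0) = (\<lambda>x. max (min (shifted_cdf M x) (1/2) - \<alpha>) 0)"
    using shifted_cdf_range by (auto simp: fun_eq_iff min_def)
  have "(\<lambda>x. min (shifted_cdf M x - \<alpha>) 0) = (\<lambda>x. max (min (shifted_cdf M x) \<alpha> - (-1/2)) 0 + (- 1/2 - \<alpha>))"
  proof
    show "min (shifted_cdf M x - \<alpha>) 0 = max (min (shifted_cdf M x) \<alpha> - (-1/2)) 0 + (- 1/2 - \<alpha>)" for x
      using shifted_cdf_range[of x] \<alpha> by linarith
  qed
  then have 2: "interval_measure (\<lambda>x. min (shifted_cdf M x - \<alpha>) 0) =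
      interval_measure (\<lambda>x. max (min (shifted_cdf M x) \<alpha> - (-1/2)) 0)"
    by (simp only: interval_measure_shift)
  show ?thesis
    unfolding integral_deriv_abs_def 1 2
    by (intro arg_cong2[where f="(-)"] integral_gen_inverse interval_measure_clipped_cdf g fun_cong[OF interval_measure_clipped_cdf(2)])
       (use \<alpha> in auto)
qed

lemma shifted_cdf_support:
  assumes "emeasure M (- {-R..R}) = 0"
  shows "x < -R \<Longrightarrow> shifted_cdf M x = -1/2" "x \<ge> R \<Longrightarrow> shifted_cdf M x = 1/2"
proof -
  have 0: "measure M (- {-R..R}) = 0" using assms by (simp add: measure_def)
  show "shifted_cdf M x = -1/2" if "x < -R"
  proof -
    have "measure M {..x} \<le> measure M (- {-R..R})" by (rule finite_measure_mono) (use that in auto)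
    then show ?thesis using 0 measure_nonneg[of M "{..x}"] by (simp add: shifted_cdf_def)
  qed
  show "shifted_cdf M x = 1/2" if "x \<ge> R"
  proof -
    have "measure M {..x} = 1 - measure M (UNIV - {..x})"
      using prob_compl[of "{..x}"] by simp
    moreover have "measure M (UNIV - {..x}) \<le> measure M (- {-R..R})"
      by (rule finite_measure_mono) (use that in auto)
    ultimately show ?thesis using 0 prob_le_1[of "{..x}"] measure_nonneg[of M "UNIV - {..x}"]
      by (simp add: shifted_cdf_def)
  qed
qed

lemma gen_inverse_support:
  assumes "emeasure M (- {-R..R}) = 0" "-1/2 < m" "m < 1/2"
  shows "gen_inverse (shifted_cdf M) m \<in> {-R..R}"
proof -
  have "gen_inverse (shifted_cdf M) m \<le> R"
    using gen_inverse_le_iff[of m R] shifted_cdf_support(2)[OF assms(1), of R] assms by simp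
  moreover have "gen_inverse (shifted_cdf M) m \<ge> -R"
    using gen_inverse_le_iff[of m "gen_inverse (shifted_cdf M) m"]
      shifted_cdf_support(1)[OF assms(1), of "gen_inverse (shifted_cdf M) m"] assms by fastforce
  ultimately show ?thesis by simp
qed

end

section \<open>Entropy solutions\<close>

lemma AE_interval_witness:
  fixes x y :: real
  assumes "AE z in lborel. P z" "x < y"
  obtains z where "x < z" "z < y" "P z"
proof -
  have "\<not> (AE z in lborel. z \<notin> {x<..<y})"
  proof
    assume "AE z in lborel. z \<notin> {x<..<y}"
    then have "emeasure lborel {z \<in> space lborel. \<not> z \<notin> {x<..<y}} = 0"
      by (subst AE_iff_measurable[symmetric, of _ lborel "\<lambda>z. z \<notin> {x<..<y}", OF _ refl]) auto
    moreover have "{z \<in> space lborel. \<not> z \<notin> {x<..<y}} = {x<..<y}" by auto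
    ultimately show False using assms(2) by simp
  qed
  moreover have "AE z in lborel. z \<notin> {x<..<y}" if "\<And>z. z \<in> {x<..<y} \<Longrightarrow> \<not> P z"
    using assms(1) by eventually_elim (use that in blast)
  ultimately have "\<exists>z. P z \<and> z \<in> {x<..<y}" by blast
  then show ?thesis using that by auto
qed

text \<open>If w - c t increased from p to q, then a time bump, whose derivative is a unit mass just
  after p minus one just after q, would give a negative tested integral. Continuity extends the
  inequality from the open interval to its end points.\<close>

lemma weak_derivative_le:
  fixes w r :: "real \<Rightarrow> real"
  assumes "s \<le> T" and cont: "continuous_on UNIV w"
    and int_w: "\<And>e s1 s2. 0 < e \<Longrightarrow> s < s1 \<Longrightarrow> s1 \<le> s2 \<Longrightarrow> s2 + e < T \<Longrightarrow>
      integrable lborel (\<lambda>t. bump_deriv e s1 s2 t * w t)"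
    and int_r: "\<And>e s1 s2. 0 < e \<Longrightarrow> s < s1 \<Longrightarrow> s1 \<le> s2 \<Longrightarrow> s2 + e < T \<Longrightarrow>
      integrable lborel (\<lambda>t. bump e s1 s2 t * r t)"
    and weak: "\<And>e s1 s2. 0 < e \<Longrightarrow> s < s1 \<Longrightarrow> s1 \<le> s2 \<Longrightarrow> s2 + e < T \<Longrightarrow>
      0 \<le> (LINT t|lborel. bump_deriv e s1 s2 t * w t + bump e s1 s2 t * r t)"
    and r: "\<And>t. s < t \<Longrightarrow> t < T \<Longrightarrow> r t \<le> c"
  shows "w T - w s \<le> c * (T - s)"
proof -
  define W where "W = (\<lambda>t. w t - c * t)"
  have contW: "continuous_on UNIV W" unfolding W_def by (intro continuous_intros cont)
  then have lim: "(W \<longlongrightarrow> W x) (at x within S)" for x S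
    using continuous_on_def by (metis UNIV_I continuous_on_subset subset_UNIV tendsto_within_subset)
  have inner: "W q \<le> W p" if pq: "s < p" "p < q" "q < T" for p q
  proof (rule ccontr)
    assume "\<not> W q \<le> W p"
    \<comment> \<open>Two levels that trisect the gap: by continuity W stays below the lower one
      just after p and above the upper one just after q.\<close>
    define k1 where "k1 = (2 * W p + W q) / 3"
    define k2 where "k2 = (W p + 2 * W q) / 3"
    have k: "W p < k1" "k1 < k2" "k2 < W q" using \<open>\<not> W q \<le> W p\<close> by (auto simp: k1_def k2_def)
    have "eventually (\<lambda>t. W t < k1) (at_right p)" using lim k order_tendstoD by blast
    then obtain p' where p': "p' > p" "\<And>t. p < t \<Longrightarrow> t < p' \<Longrightarrow> W t < k1"
      by (auto simp: eventually_at_right_field)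
    have "eventually (\<lambda>t. W t > k2) (at_right q)" using lim k order_tendstoD by blast
    then obtain q' where q': "q' > q" "\<And>t. q < t \<Longrightarrow> t < q' \<Longrightarrow> W t > k2"
      by (auto simp: eventually_at_right_field)
    \<comment> \<open>The two masses on [p, p + e] and [q, q + e] have to fit into the
      neighbourhoods just found, be disjoint and end before T; halving makes these inequalities
      strict.\<close>
    define e where "e = min (min (p' - p) (q' - q)) (min (T - q) (q - p)) / 2"
    have e: "e > 0" "p + e < p'" "q + e < q'" "q + e < T" "p + e < q"
    proof -
      have "e > 0" "2 * e \<le> p' - p" "2 * e \<le> q' - q" "2 * e \<le> T - q" "2 * e \<le> q - p"
        using p'(1) q'(1) pq by (simp_all add: e_def)
      with p'(1) q'(1) pq show "e > 0" "p + e < p'" "q + e < q'" "q + e < T" "p + e < q"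
        by simp_all
    qed
    let ?h = "\<lambda>a t. hump ((t - a) / e) / e"
    note h = has_bochner_integral_scaled_hump[OF e(1)]
    have "0 \<le> (LINT t|lborel. bump_deriv e p q t * w t + bump e p q t * r t)"
      by (rule weak) (use e pq in auto)
    also have "\<dots> \<le> (LINT t|lborel. k1 * ?h p t - k2 * ?h q t + c * (bump_deriv e p q t * t + bump e p q t))"
    proof (rule integral_mono)
      show "integrable lborel (\<lambda>t. bump_deriv e p q t * w t + bump e p q t * r t)"
        using e pq by (intro Bochner_Integration.integrable_add int_w int_r) auto
      show "integrable lborel (\<lambda>t. k1 * ?h p t - k2 * ?h q t + c * (bump_deriv e p q t * t + bump e p q t))"
        using h[of p] h[of q] has_bochner_integral_bump_by_parts[OF e(1), of p q] pq
        unfolding has_bochner_integral_iff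
        by (intro Bochner_Integration.integrable_add[where f="\<lambda>t. k1 * ?h p t - k2 * ?h q t"]
            Bochner_Integration.integrable_diff integrable_mult_right) simp_all
      fix t
      \<comment> \<open>Nothing is assumed about r outside (s, T), but the bump vanishes
        there.\<close>
      have "bump e p q t * r t \<le> bump e p q t * c"
      proof (cases "s < t \<and> t < T")
        case True
        then show ?thesis using r bump_nonneg[OF e(1), of p q t] pq by (intro mult_left_mono) auto
      next
        case False
        then have "bump e p q t = 0" using bump_zero[OF e(1), of p q t] e pq by force
        then show ?thesis by simp
      qed
      moreover have "?h p t * W t \<le> ?h p t * k1"
      proof (cases "p < t \<and> t < p + e")
        case True
        then show ?thesis using p'(2)[of t] e by (intro mult_left_mono) auto
      next
        case False
        then have "hump ((t - p) / e) = 0" using e by (intro hump_zero) (auto simp: field_simps divide_nonpos_pos)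
        then show ?thesis by simp
      qed
      moreover have "?h q t * W t \<ge> ?h q t * k2"
      proof (cases "q < t \<and> t < q + e")
        case True
        then show ?thesis using q'(2)[of t] e by (intro mult_left_mono) auto
      next
        case False
        then have "hump ((t - q) / e) = 0" using e by (intro hump_zero) (auto simp: field_simps divide_nonpos_pos)
        then show ?thesis by simp
      qed
      moreover have "bump_deriv e p q t * w t = ?h p t * W t - ?h q t * W t + c * (bump_deriv e p q t * t)"
        by (simp add: bump_deriv_def W_def diff_divide_distrib algebra_simps)
      ultimately show "bump_deriv e p q t * w t + bump e p q t * r t \<le>
          k1 * ?h p t - k2 * ?h q t + c * (bump_deriv e p q t * t + bump e p q t)"
        by (simp add: algebra_simps)
    qed
    also have "\<dots> = k1 * 1 - k2 * 1 + c * 0"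
      using h[of p] h[of q] has_bochner_integral_bump_by_parts[OF e(1), of p q] pq
      by (intro has_bochner_integral_integral_eq has_bochner_integral_add has_bochner_integral_diff
          has_bochner_integral_mult_right) auto
    finally show False using k by simp
  qed
  have "W T \<le> W s"
  proof (rule ccontr)
    assume not: "\<not> W T \<le> W s"
    then have "s < T" using \<open>s \<le> T\<close> by (cases "s = T") auto
    let ?k = "(W s + W T) / 2" and ?m = "(s + T) / 2"
    \<comment> \<open>Choosing p before and q after the midpoint of [s, T] ensures p < q.\<close>
    have "eventually (\<lambda>t. W t < ?k \<and> t < ?m) (at_right s)"
      using order_tendstoD(2)[OF lim, of s ?k "{s<..}"] not \<open>s < T\<close>
      by (intro eventually_conj) (auto simp: eventually_at_right_field intro!: exI[of _ ?m])
    then obtain p where p: "W p < ?k" "p < ?m" "s < p"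
      by (metis (mono_tags, lifting) eventually_at_right_field dense)
    have "eventually (\<lambda>t. W t > ?k \<and> t > ?m) (at_left T)"
      using order_tendstoD(1)[OF lim, of ?k T "{..<T}"] not \<open>s < T\<close>
      by (intro eventually_conj) (auto simp: eventually_at_left_field intro!: exI[of _ ?m])
    then obtain q where q: "W q > ?k" "q > ?m" "q < T"
      by (metis (mono_tags, lifting) eventually_at_left_field dense)
    from inner[of p q] p q show False by simp
  qed
  then show ?thesis by (simp add: W_def algebra_simps)
qed

lemma integrable_bounded_support:
  fixes f :: "'a \<Rightarrow> real"
  assumes "f \<in> borel_measurable N" "K \<in> sets N" "emeasure N K < \<infinity>"
    and "\<And>x. x \<in> K \<Longrightarrow> \<bar>f x\<bar> \<le> B" "\<And>x. x \<notin> K \<Longrightarrow> f x = 0"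
  shows "integrable N f"
  by (rule integrableI_bounded_set[where A=K and B=B]) (use assms in auto)

section \<open>Entropy solutions at all times and their joint measurability\<close>

text \<open>Time ranges over all reals here; an entropy solution is extended to negative times by its
  initial state.\<close>

locale entropy_flow =
  fixes \<Phi> A :: "real \<Rightarrow> real" and \<rho> :: "real \<Rightarrow> real measure" and M :: "real \<Rightarrow> real \<Rightarrow> real" and LA :: real
  assumes \<Phi>_cont: "continuous_on UNIV \<Phi>"
    and A_lip: "x \<in> {-1/2..1/2} \<Longrightarrow> y \<in> {-1/2..1/2} \<Longrightarrow> \<bar>A x - A y\<bar> \<le> LA * \<bar>x - y\<bar>"
    and LA_nonneg: "LA \<ge> 0"
    and rho: "real_distribution (\<rho> t)"
    and M_eq: "M x t = shifted_cdf (\<rho> t) x"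
    and supp: "\<exists>R. \<forall>t\<le>S. emeasure (\<rho> t) (- {-R..R}) = 0"
    and L1_int: "integrable lborel (\<lambda>x. M x t - M x s)"
    and L1_cont: "((\<lambda>t. LINT x|lborel. \<bar>M x t - M x s\<bar>) \<longlongrightarrow> 0) (at s)"
    and entropy: "\<alpha> \<in> {-1/2..1/2} \<Longrightarrow> entropy_inequality \<Phi> A \<rho> M \<alpha>"
begin

lemma M_range: "-1/2 \<le> M x t" "M x t \<le> 1/2"
  using real_distribution.shifted_cdf_range[OF rho] by (simp_all add: M_eq)

lemma M_abs_le: "\<bar>M x t\<bar> \<le> 1/2"
  using M_range[of x t] by linarith

lemma M_mono: "x \<le> y \<Longrightarrow> M x t \<le> M y t"
  using real_distribution.shifted_cdf_mono[OF rho] by (simp add: M_eq)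

lemma M_right_cont: "((\<lambda>x. M x t) \<longlongrightarrow> M x t) (at_right x)"
  using real_distribution.shifted_cdf_right_cont[OF rho] by (simp add: M_eq continuous_within)

lemma M_space_measurable [measurable]: "(\<lambda>x. M x t) \<in> borel_measurable borel"
  by (intro borel_measurable_mono monoI M_mono)

text \<open>A jump may move through x, so M at a fixed point need not be continuous in time. Its
  averages over (x, x + 1/(n+1)] are, by continuity in L^1, and they converge to M by right
  continuity.\<close>

lemma M_time_measurable: "M x \<in> borel_measurable borel"
proof (rule borel_measurable_LIMSEQ_real)
  define h where "h = (\<lambda>n t. LINT y:{x<..x + 1 / real (Suc n)}|lborel. M y t)"
  have int: "set_integrable lborel {x<..x + 1 / real (Suc n)} (\<lambda>y. M y t)" for n t
    unfolding set_integrable_def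
    by (rule integrable_bounded_support[where K="{x<..x + 1 / real (Suc n)}" and B="1/2"])
       (use M_abs_le[of _ t] in auto)
  show "(\<lambda>n. real (Suc n) * h n t) \<longlonglongrightarrow> M x t" for t
  proof (rule tendsto_sandwich)
    have c: "(LINT y:{x<..x + 1 / real (Suc n)}|lborel. c) = c / real (Suc n)" for c n
      by (simp add: set_lebesgue_integral_def)
    have ic: "set_integrable lborel {x<..x + 1 / real (Suc n)} (\<lambda>y. c::real)" for c n
      by (simp add: set_integrable_def)
    have "M x t / real (Suc n) \<le> h n t" for n
      unfolding h_def using set_integral_mono[OF ic[of n "M x t"] int[of n t]] by (simp add: h_def c M_mono del: of_nat_Suc)
    then show "eventually (\<lambda>n. M x t \<le> real (Suc n) * h n t) sequentially"
      by (auto simp: field_simps)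
    have "h n t \<le> M (x + 1 / real (Suc n)) t / real (Suc n)" for n
      using set_integral_mono[OF int[of n t] ic[of n "M (x + 1 / real (Suc n)) t"]] by (simp add: h_def c M_mono del: of_nat_Suc)
    then show "eventually (\<lambda>n. real (Suc n) * h n t \<le> M (x + 1 / real (Suc n)) t) sequentially"
      by (auto simp: field_simps)
    have "(\<lambda>n. x + 1 / real (Suc n)) \<longlonglongrightarrow> x"
      using tendsto_add[OF tendsto_const LIMSEQ_inverse_real_of_nat, of x] by (simp add: divide_inverse)
    then have "filterlim (\<lambda>n. x + 1 / real (Suc n)) (at_right x) sequentially"
      by (rule tendsto_imp_filterlim_at_right) auto
    then show "(\<lambda>n. M (x + 1 / real (Suc n)) t) \<longlonglongrightarrow> M x t"
      by (rule filterlim_compose[OF M_right_cont])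
  qed auto
  have "h n \<in> borel_measurable borel" for n
  proof (rule borel_measurable_continuous_onI)
    have "(h n \<longlongrightarrow> h n s) (at s)" for s
    proof (rule LIM_zero_cancel, rule Lim_null_comparison[OF _ L1_cont])
      have "norm (h n t - h n s) \<le> (LINT x|lborel. \<bar>M x t - M x s\<bar>)" for t
      proof -
        have "h n t - h n s = (LINT y:{x<..x + 1 / real (Suc n)}|lborel. M y t - M y s)"
          unfolding h_def by (rule set_integral_diff(2)[symmetric]) (rule int)+
        also have "norm \<dots> \<le> (LINT y|lborel. norm (indicator {x<..x + 1 / real (Suc n)} y *\<^sub>R (M y t - M y s)))"
          unfolding set_lebesgue_integral_def by (rule integral_norm_bound)
        also have "\<dots> \<le> (LINT x|lborel. \<bar>M x t - M x s\<bar>)"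
          by (rule integral_mono_AE')
             (use L1_int[of t s] in \<open>auto simp: indicator_def\<close>)
        finally show ?thesis .
      qed
      then show "eventually (\<lambda>t. norm (h n t - h n s) \<le> (LINT x|lborel. \<bar>M x t - M x s\<bar>)) (at s)"
        by simp
    qed
    then show "continuous_on UNIV (h n)" by (simp add: continuous_on_def)
  qed
  then show "(\<lambda>t. real (Suc n) * h n t) \<in> borel_measurable borel" for n by measurable
qed

text \<open>Replacing x by a grid point to its right leaves, for each mesh, only countably many
  functions of time; right continuity gives the limit.\<close>

lemma M_measurable: "(\<lambda>p. M (fst p) (snd p)) \<in> borel_measurable (borel \<Otimes>\<^sub>M borel)"
proof (rule borel_measurable_LIMSEQ_real)
  \<comment> \<open>Floor plus one puts the grid point strictly to the right of x, as the limit
    \<open>at_right\<close> demands.\<close>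
  define y where "y = (\<lambda>n x. (real_of_int \<lfloor>real (Suc n) * x\<rfloor> + 1) / real (Suc n))"
  show "(\<lambda>n. M (y n (fst p)) (snd p)) \<longlonglongrightarrow> M (fst p) (snd p)" for p
  proof -
    have 1: "fst p < y n (fst p)" "y n (fst p) \<le> fst p + 1 / real (Suc n)" for n
    proof -
      let ?k = "real_of_int \<lfloor>real (Suc n) * fst p\<rfloor>"
      have "?k \<le> real (Suc n) * fst p" "real (Suc n) * fst p < ?k + 1" by linarith+
      then have "fst p < (?k + 1) / real (Suc n)" "?k / real (Suc n) \<le> fst p"
        by (simp_all add: pos_less_divide_eq pos_divide_le_eq mult.commute del: of_nat_Suc)
      then show "fst p < y n (fst p)" "y n (fst p) \<le> fst p + 1 / real (Suc n)"
        unfolding y_def by (simp_all add: add_divide_distrib del: of_nat_Suc)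
    qed
    have up: "(\<lambda>n. fst p + 1 / real (Suc n)) \<longlonglongrightarrow> fst p"
      using tendsto_add[OF tendsto_const LIMSEQ_inverse_real_of_nat, of "fst p"] by (simp add: divide_inverse)
    have "(\<lambda>n. y n (fst p)) \<longlonglongrightarrow> fst p"
      by (rule tendsto_sandwich[OF _ _ tendsto_const up]) (simp_all add: 1 less_imp_le del: of_nat_Suc)
    then have "filterlim (\<lambda>n. y n (fst p)) (at_right (fst p)) sequentially"
      by (rule tendsto_imp_filterlim_at_right) (use 1 in auto)
    then show ?thesis by (rule filterlim_compose[OF M_right_cont])
  qed
  have "(\<lambda>p. M ((real_of_int \<lfloor>real (Suc n) * fst p\<rfloor> + 1) / real (Suc n)) (snd p)) \<in> borel_measurable (borel \<Otimes>\<^sub>M borel)" for n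
    by (rule measurable_compose_countable[where f="\<lambda>i p. M ((real_of_int i + 1) / real (Suc n)) (snd p)"])
       (auto intro!: measurable_compose[OF measurable_snd M_time_measurable])
  then show "(\<lambda>p. M (y n (fst p)) (snd p)) \<in> borel_measurable (borel \<Otimes>\<^sub>M borel)" for n
    by (simp add: y_def)
qed

lemma M_measurable' [measurable (raw)]:
  assumes [measurable]: "f \<in> borel_measurable N" "g \<in> borel_measurable N"
  shows "(\<lambda>p. M (f p) (g p)) \<in> borel_measurable N"
  using measurable_compose[OF measurable_Pair[OF assms] M_measurable] by simp

section \<open>The quantile function and the transport velocity\<close>

definition Y :: "real \<Rightarrow> real \<Rightarrow> real" where
  "Y m t = (if m \<in> {-1/2<..<1/2} then gen_inverse (shifted_cdf (\<rho> t)) m else 0)"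

lemma Y_le_iff: "-1/2 < m \<Longrightarrow> m < 1/2 \<Longrightarrow> Y m t \<le> x \<longleftrightarrow> m \<le> M x t"
  using real_distribution.gen_inverse_le_iff[OF rho] by (simp add: Y_def M_eq)

text \<open>The Galois connection turns a sublevel set of \<open>Y\<close> into a condition on M.
  The default value 0 at other levels makes \<open>Y\<close> Borel on the whole plane.\<close>

lemma Y_measurable' [measurable (raw)]:
  assumes [measurable]: "f \<in> borel_measurable N" "g \<in> borel_measurable N"
  shows "(\<lambda>p. Y (f p) (g p)) \<in> borel_measurable N"
proof (rule borel_measurable_iff_le[THEN iffD2], rule)
  fix x
  have "{p \<in> space N. Y (f p) (g p) \<le> x} =
    {p \<in> space N. (-1/2 < f p \<and> f p < 1/2 \<and> f p \<le> M x (g p)) \<or> (\<not> (-1/2 < f p \<and> f p < 1/2) \<and> 0 \<le> x)}"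
    using Y_le_iff by (auto simp: Y_def)
  then show "{p \<in> space N. Y (f p) (g p) \<le> x} \<in> sets N" by simp
qed

lemma support_bound:
  obtains R where "R > 0" "\<And>t x. t \<le> S \<Longrightarrow> x < -R \<Longrightarrow> M x t = -1/2"
    "\<And>t x. t \<le> S \<Longrightarrow> R \<le> x \<Longrightarrow> M x t = 1/2"
    "\<And>t m. t \<le> S \<Longrightarrow> \<bar>Y m t\<bar> \<le> R"
proof -
  obtain R0 where R0: "\<And>t. t \<le> S \<Longrightarrow> emeasure (\<rho> t) (- {-R0..R0}) = 0" using supp by blast
  \<comment> \<open>A positive R also covers the default value 0 of \<open>Y\<close>, so the last
    bound holds for every m.\<close>
  define R where "R = max R0 1"
  have R: "emeasure (\<rho> t) (- {-R..R}) = 0" if "t \<le> S" for t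
  proof -
    interpret real_distribution "\<rho> t" by (rule rho)
    have "emeasure (\<rho> t) (- {-R..R}) \<le> emeasure (\<rho> t) (- {-R0..R0})"
      by (rule emeasure_mono) (auto simp: R_def)
    then show ?thesis using R0[OF that] by simp
  qed
  show ?thesis
  proof
    show "R > 0" by (simp add: R_def)
    show "M x t = -1/2" if "t \<le> S" "x < -R" for t x
      using real_distribution.shifted_cdf_support(1)[OF rho R] that by (simp add: M_eq)
    show "M x t = 1/2" if "t \<le> S" "R \<le> x" for t x
      using real_distribution.shifted_cdf_support(2)[OF rho R] that by (simp add: M_eq)
    show "\<bar>Y m t\<bar> \<le> R" if "t \<le> S" for t m
      using real_distribution.gen_inverse_support[OF rho R[OF that], of m] \<open>R > 0\<close>
      by (auto simp: Y_def)
  qed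
qed

definition V :: "real \<Rightarrow> real \<Rightarrow> real" where
  "V x t = conv_measure \<Phi> (\<rho> t) x"

lemma \<Phi>_measurable [measurable]: "\<Phi> \<in> borel_measurable borel"
  by (rule borel_measurable_continuous_onI[OF \<Phi>_cont])

text \<open>Over a fixed set of levels the time enters only through the integrand. Joint
  measurability and estimates uniform in time follow from this form.\<close>

lemma V_eq: "V x t = (LINT m:{-1/2<..<1/2}|lborel. \<Phi> (x - Y m t))"
proof -
  have "V x t = (LINT m:{-1/2<..<1/2}|lborel. \<Phi> (x - gen_inverse (shifted_cdf (\<rho> t)) m))"
    unfolding V_def conv_measure_def
    by (rule real_distribution.integral_distribution_gen_inverse[OF rho]) measurable
  also have "\<dots> = (LINT m:{-1/2<..<1/2}|lborel. \<Phi> (x - Y m t))"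
    by (rule set_lebesgue_integral_cong) (auto simp: Y_def)
  finally show ?thesis .
qed

lemma V_measurable' [measurable (raw)]:
  assumes [measurable]: "f \<in> borel_measurable N" "g \<in> borel_measurable N"
  shows "(\<lambda>p. V (f p) (g p)) \<in> borel_measurable N"
  unfolding V_eq set_lebesgue_integral_def by measurable

lemma \<Phi>_shift_integrable:
  "set_integrable lborel {-1/2<..<1/2} (\<lambda>m. \<Phi> (x - Y m t))"
proof -
  obtain R where R: "R > 0" "\<And>m. \<bar>Y m t\<bar> \<le> R" using support_bound[of t] by (metis order_refl)
  obtain B where B: "\<And>y. y \<in> {x-R..x+R} \<Longrightarrow> \<bar>\<Phi> y\<bar> \<le> B"
    using continuous_on_Icc_bounded[OF continuous_on_subset[OF \<Phi>_cont subset_UNIV]] by metis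
  have "\<bar>\<Phi> (x - Y m t)\<bar> \<le> B" for m using R(2)[of m] by (intro B) (auto simp: abs_le_iff)
  then show ?thesis
    unfolding set_integrable_def
    by (intro integrable_bounded_support[where K="{-1/2<..<1/2}" and B=B]) auto
qed

lemma V_bound:
  obtains C where "C \<ge> 0" "\<And>x t. t \<le> S \<Longrightarrow> \<bar>x\<bar> \<le> Z \<Longrightarrow> \<bar>V x t\<bar> \<le> C"
proof -
  obtain R where R: "R > 0" "\<And>t m. t \<le> S \<Longrightarrow> \<bar>Y m t\<bar> \<le> R" using support_bound[of S] by metis
  obtain B where B: "\<And>y. y \<in> {-(Z+R)..Z+R} \<Longrightarrow> \<bar>\<Phi> y\<bar> \<le> B"
    using continuous_on_Icc_bounded[OF continuous_on_subset[OF \<Phi>_cont subset_UNIV]] by metis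
  show ?thesis
  proof
    show "0 \<le> max B 0" by simp
    fix x t assume *: "t \<le> S" "\<bar>x\<bar> \<le> Z"
    have "\<bar>\<Phi> (x - Y m t)\<bar> \<le> max B 0" for m
      using R(2)[OF *(1), of m] * B[of "x - Y m t"] by (simp add: abs_le_iff)
    then have "\<bar>V x t\<bar> \<le> (LINT m|lborel. indicator {-1/2<..<1/2::real} m *\<^sub>R max B 0)"
      unfolding V_eq set_lebesgue_integral_def real_norm_def[symmetric]
      by (intro order_trans[OF integral_norm_bound] integral_mono_AE')
         (auto split: split_indicator)
    then show "\<bar>V x t\<bar> \<le> max B 0" by simp
  qed
qed

text \<open>No continuity of V in time is at hand, so the modulus in x must not depend on t. It is
  that of \<Phi> on a compact interval containing all x - Y m t, because the total mass is
  1.\<close>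

lemma V_equicontinuous:
  assumes "\<epsilon> > 0"
  obtains \<delta> where "\<delta> > 0" "\<And>x y t. t \<le> S \<Longrightarrow> \<bar>x\<bar> \<le> Z \<Longrightarrow> \<bar>y\<bar> \<le> Z \<Longrightarrow> \<bar>x - y\<bar> < \<delta> \<Longrightarrow> \<bar>V x t - V y t\<bar> \<le> \<epsilon>"
proof -
  obtain R where R: "R > 0" "\<And>t m. t \<le> S \<Longrightarrow> \<bar>Y m t\<bar> \<le> R" using support_bound[of S] by metis
  have "uniformly_continuous_on {-(Z+R)..Z+R} \<Phi>"
    by (intro compact_uniformly_continuous continuous_on_subset[OF \<Phi>_cont]) auto
  then obtain \<delta> where \<delta>: "\<delta> > 0" "\<And>x y. x \<in> {-(Z+R)..Z+R} \<Longrightarrow> y \<in> {-(Z+R)..Z+R} \<Longrightarrow> \<bar>y - x\<bar> < \<delta> \<Longrightarrow> \<bar>\<Phi> y - \<Phi> x\<bar> < \<epsilon>"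
    using \<open>\<epsilon> > 0\<close> unfolding uniformly_continuous_on_def dist_real_def by metis
  show ?thesis
  proof
    show "\<delta> > 0" by fact
    fix x y t assume *: "t \<le> S" "\<bar>x\<bar> \<le> Z" "\<bar>y\<bar> \<le> Z" "\<bar>x - y\<bar> < \<delta>"
    have "\<bar>\<Phi> (x - Y m t) - \<Phi> (y - Y m t)\<bar> \<le> \<epsilon>" for m
      using R(2)[OF *(1), of m] * \<delta>(2)[of "y - Y m t" "x - Y m t"] by (force simp: abs_le_iff)
    moreover have "V x t - V y t = (LINT m:{-1/2<..<1/2}|lborel. \<Phi> (x - Y m t) - \<Phi> (y - Y m t))"
      unfolding V_eq by (rule set_integral_diff(2)[symmetric]) (rule \<Phi>_shift_integrable)+
    ultimately have "\<bar>V x t - V y t\<bar> \<le> (LINT m|lborel. indicator {-1/2<..<1/2::real} m *\<^sub>R \<epsilon>)"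
      using \<open>\<epsilon> > 0\<close>
      unfolding set_lebesgue_integral_def
      by (simp only: real_norm_def[symmetric], intro order_trans[OF integral_norm_bound] integral_mono_AE')
         (auto split: split_indicator)
    then show "\<bar>V x t - V y t\<bar> \<le> \<epsilon>" by simp
  qed
qed

section \<open>Weighted entropies and their content in a moving bump\<close>

definition flux_ext :: "real \<Rightarrow> real" where
  "flux_ext z = A (max (-1/2) (min z (1/2)))"

lemma flux_ext_eq: "z \<in> {-1/2..1/2} \<Longrightarrow> flux_ext z = A z"
  by (auto simp: flux_ext_def max_def min_def)

lemma flux_ext_M: "flux_ext (M x t) = A (M x t)"
  using M_range[of x t] by (intro flux_ext_eq) simp

text \<open>A is controlled on [-1/2, 1/2] only; clamping the argument makes the bound global, and
  with it the extension continuous and Borel.\<close>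

lemma flux_ext_lip: "\<bar>flux_ext x - flux_ext y\<bar> \<le> LA * \<bar>x - y\<bar>"
proof -
  have "\<bar>flux_ext x - flux_ext y\<bar> \<le> LA * \<bar>max (-1/2) (min x (1/2)) - max (-1/2) (min y (1/2))\<bar>"
    unfolding flux_ext_def by (rule A_lip) auto
  also have "\<dots> \<le> LA * \<bar>x - y\<bar>"
    by (intro mult_left_mono LA_nonneg) linarith
  finally show ?thesis .
qed

lemma flux_ext_measurable [measurable]: "flux_ext \<in> borel_measurable borel"
proof (rule borel_measurable_continuous_onI)
  have "LA-lipschitz_on UNIV flux_ext"
    using flux_ext_lip LA_nonneg by (auto simp: lipschitz_on_def dist_real_def)
  then show "continuous_on UNIV flux_ext" by (rule lipschitz_on_continuous_on)
qed

text \<open>\<kappa> weights the two one-sided Kruzkov entropies at level \<alpha>. The extreme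
  weights 0 and 1 serve finite speed of propagation, those in between the jump.\<close>

definition ent :: "real \<Rightarrow> real \<Rightarrow> real \<Rightarrow> real" where
  "ent \<kappa> \<alpha> z = \<kappa> * max (z - \<alpha>) 0 + (1 - \<kappa>) * max (\<alpha> - z) 0"

definition ent_flux :: "real \<Rightarrow> real \<Rightarrow> real \<Rightarrow> real" where
  "ent_flux \<kappa> \<alpha> z = (if \<alpha> \<le> z then \<kappa> * (flux_ext z - flux_ext \<alpha>)
     else (1 - \<kappa>) * (flux_ext \<alpha> - flux_ext z))"

lemma ent_measurable [measurable]: "ent \<kappa> \<alpha> \<in> borel_measurable borel"
  unfolding ent_def[abs_def] by measurable

lemma ent_flux_measurable [measurable]: "ent_flux \<kappa> \<alpha> \<in> borel_measurable borel"
  unfolding ent_flux_def[abs_def] by measurable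

lemma flux_ext_diff_le:
  assumes "\<bar>z\<bar> \<le> 1/2" "\<bar>z'\<bar> \<le> 1/2" shows "\<bar>flux_ext z - flux_ext z'\<bar> \<le> LA"
proof -
  have "LA * \<bar>z - z'\<bar> \<le> LA * 1" using assms by (intro mult_left_mono LA_nonneg) linarith
  then show ?thesis using flux_ext_lip[of z z'] by simp
qed

text \<open>In the mass variable, the transport through the bump of the levels between lo and
  hi.\<close>

definition transported :: "real \<Rightarrow> real \<Rightarrow> real \<Rightarrow> real \<Rightarrow> real \<Rightarrow> real \<Rightarrow> real \<Rightarrow> real" where
  "transported d a b v lo hi t =
     (LINT m:{lo<..<hi}|lborel. V (Y m t) t * bump d a b (Y m t + v * t))"

definition ent_mass :: "real \<Rightarrow> real \<Rightarrow> real \<Rightarrow> real \<Rightarrow> (real \<Rightarrow> real) \<Rightarrow> real \<Rightarrow> real" where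
  "ent_mass d a b v F t = (LINT x|lborel. bump d a b (x + v * t) * F (M x t))"

text \<open>Taken for v times an entropy plus its flux, this is the net entropy flow through the two
  flanks of the moving bump.\<close>

definition ent_rate :: "real \<Rightarrow> real \<Rightarrow> real \<Rightarrow> real \<Rightarrow> (real \<Rightarrow> real) \<Rightarrow> real \<Rightarrow> real" where
  "ent_rate d a b v F t = (LINT x|lborel. bump_deriv d a b (x + v * t) * F (M x t))"

lemma transported_measurable: "transported d a b v lo hi \<in> borel_measurable borel"
  unfolding transported_def[abs_def] set_lebesgue_integral_def by measurable

lemma ent_mass_measurable:
  assumes [measurable]: "F \<in> borel_measurable borel"
  shows "ent_mass d a b v F \<in> borel_measurable borel" "ent_rate d a b v F \<in> borel_measurable borel"
  unfolding ent_mass_def[abs_def] ent_rate_def[abs_def] by measurable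

lemma time_factor_integrable:
  assumes e: "e > 0" and s12: "s1 \<le> s2"
    and [measurable]: "f \<in> borel_measurable borel" and B: "\<And>t. t \<le> s2 + e \<Longrightarrow> \<bar>f t\<bar> \<le> B"
  shows "integrable lborel (\<lambda>t. bump e s1 s2 t * f t)"
proof (rule integrable_bounded_support[where K="{s1..s2 + e}" and B="1 * B"])
  show "\<bar>bump e s1 s2 x * f x\<bar> \<le> 1 * B" if "x \<in> {s1..s2 + e}" for x
    unfolding abs_mult using that by (intro mult_mono bump_abs_le e s12 B) auto
  show "bump e s1 s2 x * f x = 0" if "x \<notin> {s1..s2 + e}" for x
    using that bump_zero[OF e s12, of x] by (auto simp: not_le)
qed (auto simp: emeasure_lborel_Icc_eq)

context
  fixes d a b v :: real
  assumes d: "d > 0" and ab: "a \<le> b"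
begin

lemma slice_integrable:
  assumes [measurable]: "F \<in> borel_measurable borel" and B: "\<And>z. \<bar>z\<bar> \<le> 1/2 \<Longrightarrow> \<bar>F z\<bar> \<le> B"
  shows "integrable lborel (\<lambda>x. bump d a b (x + c) * F (M x t))"
    and "integrable lborel (\<lambda>x. bump_deriv d a b (x + c) * F (M x t))"
proof -
  have B0: "\<bar>F (M x t)\<bar> \<le> B" for x using B M_abs_le by blast
  show "integrable lborel (\<lambda>x. bump d a b (x + c) * F (M x t))"
  proof (rule integrable_bounded_support[where K="{a - c..b + d - c}" and B="1 * B"])
    show "\<bar>bump d a b (x + c) * F (M x t)\<bar> \<le> 1 * B" for x
      unfolding abs_mult by (intro mult_mono bump_abs_le d ab B0) auto
    show "bump d a b (x + c) * F (M x t) = 0" if "x \<notin> {a - c..b + d - c}" for x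
      using that bump_zero[OF d ab, of "x + c"] by (auto simp: not_le)
  qed (auto simp: emeasure_lborel_Icc_eq)
  obtain B1 where B1: "B1 \<ge> 0" "\<And>x. \<bar>bump_deriv d a b x\<bar> \<le> B1"
    using bump_deriv_bounded[OF d ab] by metis
  show "integrable lborel (\<lambda>x. bump_deriv d a b (x + c) * F (M x t))"
  proof (rule integrable_bounded_support[where K="{a - c..b + d - c}" and B="B1 * B"])
    show "\<bar>bump_deriv d a b (x + c) * F (M x t)\<bar> \<le> B1 * B" for x
      unfolding abs_mult by (intro mult_mono B1 B0) auto
    show "bump_deriv d a b (x + c) * F (M x t) = 0" if "x \<notin> {a - c..b + d - c}" for x
      using that bump_deriv_zero[OF d ab, of "x + c"] by (auto simp: not_le)
  qed (auto simp: emeasure_lborel_Icc_eq)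
qed

lemma transported_integrand_integrable:
  assumes "{lo<..<hi} \<subseteq> {-1/2<..<1/2}"
  shows "set_integrable lborel {lo<..<hi} (\<lambda>m. V (Y m t) t * bump d a b (Y m t + v * t))"
proof -
  obtain R where R: "\<And>m. \<bar>Y m t\<bar> \<le> R" using support_bound[of t] by (metis order_refl)
  obtain C where C: "C \<ge> 0" "\<And>x. \<bar>x\<bar> \<le> R \<Longrightarrow> \<bar>V x t\<bar> \<le> C" using V_bound[of t R] by (metis order_refl)
  have "\<bar>V (Y m t) t * bump d a b (Y m t + v * t)\<bar> \<le> C * 1" for m
    unfolding abs_mult by (intro mult_mono C R bump_abs_le d ab) auto
  then show ?thesis
    unfolding set_integrable_def
    by (intro integrable_bounded_support[where K="{-1/2<..<1/2}" and B="C"])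
       (use assms C(1) in \<open>auto split: split_indicator\<close>)
qed

lemma transported_split:
  assumes "-1/2 \<le> \<alpha>" "\<alpha> \<le> 1/2"
  shows "transported d a b v (-1/2) (1/2) t = transported d a b v (-1/2) \<alpha> t + transported d a b v \<alpha> (1/2) t"
proof -
  let ?f = "\<lambda>m. V (Y m t) t * bump d a b (Y m t + v * t)"
  have sub: "{-1/2<..<\<alpha>} \<subseteq> {-1/2<..<1/2}" "{\<alpha><..<1/2} \<subseteq> {-1/2<..<1/2}" using assms by auto
  have "transported d a b v (-1/2) \<alpha> t + transported d a b v \<alpha> (1/2) t =
    (LINT m|lborel. indicator {-1/2<..<\<alpha>} m *\<^sub>R ?f m + indicator {\<alpha><..<1/2} m *\<^sub>R ?f m)"
    unfolding transported_def set_lebesgue_integral_def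
    by (rule Bochner_Integration.integral_add[symmetric])
       (use transported_integrand_integrable[OF sub(1)] transported_integrand_integrable[OF sub(2)]
          in \<open>simp_all add: set_integrable_def\<close>)
  also have "\<dots> = transported d a b v (-1/2) (1/2) t"
    unfolding transported_def set_lebesgue_integral_def
  proof (rule integral_cong_AE)
    show "AE m in lborel. indicator {-1/2<..<\<alpha>} m *\<^sub>R ?f m + indicator {\<alpha><..<1/2} m *\<^sub>R ?f m =
        indicator {-1/2<..<1/2} m *\<^sub>R ?f m"
      using AE_lborel_singleton[of \<alpha>]
      by eventually_elim (use assms in \<open>auto simp: indicator_def\<close>)
  qed measurable
  finally show ?thesis by simp
qed

lemma transported_abs_bounded:
  assumes "{lo<..<hi} \<subseteq> {-1/2<..<1/2}"
  obtains B where "\<And>t. t \<le> S \<Longrightarrow> \<bar>transported d a b v lo hi t\<bar> \<le> B"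
proof -
  obtain R where R: "\<And>m t. t \<le> S \<Longrightarrow> \<bar>Y m t\<bar> \<le> R" using support_bound[of S] by metis
  obtain C where C: "C \<ge> 0" "\<And>x t. t \<le> S \<Longrightarrow> \<bar>x\<bar> \<le> R \<Longrightarrow> \<bar>V x t\<bar> \<le> C" using V_bound[of S R] by metis
  have "\<bar>transported d a b v lo hi t\<bar> \<le> C" if "t \<le> S" for t
  proof -
    have *: "\<bar>V (Y m t) t * bump d a b (Y m t + v * t)\<bar> \<le> C * 1" for m
      unfolding abs_mult by (intro mult_mono C R bump_abs_le d ab that) auto
    have **: "norm (indicator {lo<..<hi} m *\<^sub>R (V (Y m t) t * bump d a b (Y m t + v * t))) \<le>
          indicator {-1/2<..<1/2::real} m *\<^sub>R C" for m
      using *[of m] C(1) assms by (cases "m \<in> {lo<..<hi}") (auto simp: subset_iff)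
    have "\<bar>transported d a b v lo hi t\<bar> \<le> (LINT m|lborel. indicator {-1/2<..<1/2::real} m *\<^sub>R C)"
      unfolding transported_def set_lebesgue_integral_def real_norm_def[symmetric]
      by (rule order_trans[OF integral_norm_bound], rule integral_mono_AE')
         (use ** C(1) in auto)
    then show ?thesis by simp
  qed
  then show ?thesis by (rule that)
qed

lemma mass_rate_bounded:
  assumes [measurable]: "F \<in> borel_measurable borel" and B: "\<And>z. \<bar>z\<bar> \<le> 1/2 \<Longrightarrow> \<bar>F z\<bar> \<le> B"
  obtains C where "\<And>t. \<bar>ent_mass d a b v F t\<bar> \<le> C" "\<And>t. \<bar>ent_rate d a b v F t\<bar> \<le> C"
proof -
  obtain B1 where B1: "B1 \<ge> 0" "\<And>x. \<bar>bump_deriv d a b x\<bar> \<le> B1"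
    using bump_deriv_bounded[OF d ab] by metis
  have B0: "\<bar>F (M x t)\<bar> \<le> B" for x t using B M_abs_le by blast
  then have "B \<ge> 0" by (meson abs_ge_zero order_trans)
  have len: "(LINT x|lborel. indicator {a - c..b + d - c} x *\<^sub>R K) = (b + d - a) * K" for c K :: real
    using d ab by simp
  have "\<bar>ent_mass d a b v F t\<bar> \<le> (b + d - a) * (1 * B)" for t
    unfolding ent_mass_def len[of "v * t", symmetric] real_norm_def[symmetric]
  proof (intro order_trans[OF integral_norm_bound] integral_mono_AE' AE_I2)
    fix x
    have "\<bar>bump d a b (x + v * t) * F (M x t)\<bar> \<le> 1 * B"
      unfolding abs_mult by (intro mult_mono bump_abs_le d ab B0) auto
    moreover have "bump d a b (x + v * t) = 0" if "x \<notin> {a - v * t..b + d - v * t}"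
      using that bump_zero[OF d ab, of "x + v * t"] by (auto simp: not_le)
    ultimately show "norm (bump d a b (x + v * t) * F (M x t)) \<le> indicator {a - v * t..b + d - v * t} x *\<^sub>R (1 * B)"
      by (auto split: split_indicator)
  qed (use \<open>B \<ge> 0\<close> B1 in \<open>auto intro!: mult_nonneg_nonneg integrable_real_indicator
      simp: emeasure_lborel_Icc_eq integrable_mult_left\<close>)
  moreover have "\<bar>ent_rate d a b v F t\<bar> \<le> (b + d - a) * (B1 * B)" for t
    unfolding ent_rate_def len[of "v * t", symmetric] real_norm_def[symmetric]
  proof (intro order_trans[OF integral_norm_bound] integral_mono_AE' AE_I2)
    fix x
    have "\<bar>bump_deriv d a b (x + v * t) * F (M x t)\<bar> \<le> B1 * B"
      unfolding abs_mult by (intro mult_mono B1 B0) auto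
    moreover have "bump_deriv d a b (x + v * t) = 0" if "x \<notin> {a - v * t..b + d - v * t}"
      using that bump_deriv_zero[OF d ab, of "x + v * t"] by (auto simp: not_le)
    ultimately show "norm (bump_deriv d a b (x + v * t) * F (M x t)) \<le> indicator {a - v * t..b + d - v * t} x *\<^sub>R (B1 * B)"
      by (auto split: split_indicator)
  qed (use \<open>B \<ge> 0\<close> B1 in \<open>auto intro!: mult_nonneg_nonneg integrable_real_indicator
      simp: emeasure_lborel_Icc_eq integrable_mult_left\<close>)
  ultimately show ?thesis
    by (intro that[of "max ((b + d - a) * (1 * B)) ((b + d - a) * (B1 * B))"]) (simp_all add: max.coboundedI1 max.coboundedI2)
qed

section \<open>The entropy inequality tested with a moving bump\<close>

context
  fixes e s1 s2 :: real
  assumes e: "e > 0" and s1: "0 < s1" and s12: "s1 \<le> s2"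
begin

definition test_x :: "real \<Rightarrow> real \<Rightarrow> real" where
  "test_x x t = bump e s1 s2 t * bump_deriv d a b (x + v * t)"

definition test_t :: "real \<Rightarrow> real \<Rightarrow> real" where
  "test_t x t = bump_deriv e s1 s2 t * bump d a b (x + v * t) + v * test_x x t"

text \<open>Kept general and linear in the pair (F, Q), so that inequalities for several entropies
  can be combined.\<close>

definition weak_integrand :: "(real \<Rightarrow> real) \<Rightarrow> (real \<Rightarrow> real) \<Rightarrow> real \<Rightarrow> real \<Rightarrow> real" where
  "weak_integrand F Q x t = F (M x t) * test_t x t + Q (M x t) * test_x x t"

lemma weak_integrand_integrable:
  assumes [measurable]: "F \<in> borel_measurable borel" "Q \<in> borel_measurable borel"
    and B: "\<And>z. \<bar>z\<bar> \<le> 1/2 \<Longrightarrow> \<bar>F z\<bar> \<le> B" "\<And>z. \<bar>z\<bar> \<le> 1/2 \<Longrightarrow> \<bar>Q z\<bar> \<le> B"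
  shows "integrable (lborel \<Otimes>\<^sub>M lborel) (\<lambda>(x, t). weak_integrand F Q x t)"
proof -
  obtain B1 where B1: "B1 \<ge> 0" "\<And>x. \<bar>bump_deriv d a b x\<bar> \<le> B1"
    using bump_deriv_bounded[OF d ab] by metis
  obtain B2 where B2: "B2 \<ge> 0" "\<And>x. \<bar>bump_deriv e s1 s2 x\<bar> \<le> B2"
    using bump_deriv_bounded[OF e s12] by metis
  \<comment> \<open>On the support, a \<le> x + v t \<le> b + d and 0 < t \<le> s2 + e force
    \<bar>x\<bar> \<le> Z.\<close>
  define Z where "Z = \<bar>a\<bar> + \<bar>b + d\<bar> + \<bar>v\<bar> * (s2 + e)"
  have B0: "\<bar>F (M x t)\<bar> \<le> B" "\<bar>Q (M x t)\<bar> \<le> B" for x t using B M_abs_le by blast+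
  then have "B \<ge> 0" by (meson abs_ge_zero order_trans)
  have tx: "\<bar>test_x x t\<bar> \<le> 1 * B1" for x t
    unfolding test_x_def abs_mult by (intro mult_mono B1 bump_abs_le e s12) auto
  have tt: "\<bar>test_t x t\<bar> \<le> B2 * 1 + \<bar>v\<bar> * B1" for x t
  proof -
    have "\<bar>bump_deriv e s1 s2 t * bump d a b (x + v * t)\<bar> \<le> B2 * 1"
      unfolding abs_mult by (intro mult_mono B2 bump_abs_le d ab) auto
    moreover have "\<bar>v * test_x x t\<bar> \<le> \<bar>v\<bar> * (1 * B1)"
      unfolding abs_mult by (intro mult_left_mono tx) auto
    ultimately show ?thesis unfolding test_t_def by linarith
  qed
  show ?thesis
  proof (rule integrable_bounded_support[where K="{-Z..Z} \<times> {s1..s2+e}" and B="B * (B2 * 1 + \<bar>v\<bar> * B1) + B * (1 * B1)"])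
    show "(\<lambda>(x, t). weak_integrand F Q x t) \<in> borel_measurable (lborel \<Otimes>\<^sub>M lborel)"
      unfolding weak_integrand_def test_t_def test_x_def by measurable
    show "{-Z..Z} \<times> {s1..s2+e} \<in> sets (lborel \<Otimes>\<^sub>M lborel)" by (intro pair_measureI) auto
    show "emeasure (lborel \<Otimes>\<^sub>M lborel) ({-Z..Z} \<times> {s1..s2+e}) < \<infinity>"
      by (subst lborel.emeasure_pair_measure_Times) (auto simp: ennreal_mult_less_top emeasure_lborel_Icc_eq)
    show "\<bar>case p of (x, t) \<Rightarrow> weak_integrand F Q x t\<bar> \<le> B * (B2 * 1 + \<bar>v\<bar> * B1) + B * (1 * B1)" for p
    proof (cases p)
      case (Pair x t)
      have "\<bar>F (M x t) * test_t x t\<bar> \<le> B * (B2 * 1 + \<bar>v\<bar> * B1)"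
        unfolding abs_mult by (intro mult_mono tt B0 \<open>B \<ge> 0\<close>) auto
      moreover have "\<bar>Q (M x t) * test_x x t\<bar> \<le> B * (1 * B1)"
        unfolding abs_mult by (intro mult_mono tx B0 \<open>B \<ge> 0\<close>) auto
      ultimately show ?thesis unfolding Pair weak_integrand_def prod.case by linarith
    qed
    show "(case p of (x, t) \<Rightarrow> weak_integrand F Q x t) = 0" if "p \<notin> {-Z..Z} \<times> {s1..s2+e}" for p
    proof (cases p)
      case (Pair x t)
      show ?thesis
      proof (cases "t \<in> {s1..s2+e}")
        case False
        then have "bump e s1 s2 t = 0" "bump_deriv e s1 s2 t = 0"
          using bump_zero[OF e s12, of t] bump_deriv_zero[OF e s12, of t] by (auto simp: not_le)
        then show ?thesis by (simp add: Pair weak_integrand_def test_t_def test_x_def)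
      next
        case True
        have "\<bar>v * t\<bar> \<le> \<bar>v\<bar> * (s2 + e)" using True s1 by (auto simp: abs_mult intro!: mult_left_mono)
        moreover have "x > Z \<or> x < -Z" using that True Pair by auto
        ultimately have "x + v * t \<le> a \<or> b + d \<le> x + v * t" unfolding Z_def by linarith
        then have "bump d a b (x + v * t) = 0" "bump_deriv d a b (x + v * t) = 0"
          using bump_zero[OF d ab, of "x + v * t"] bump_deriv_zero[OF d ab, of "x + v * t"] by blast+
        then show ?thesis by (simp add: Pair weak_integrand_def test_t_def test_x_def)
      qed
    qed
  qed
qed

text \<open>Integrating over x at each time leaves a weak inequality in time alone. The motion of
  the bump adds v F to the flux Q, as in a moving frame.\<close>

lemma weak_integrand_fubini:
  assumes [measurable]: "F \<in> borel_measurable borel" "Q \<in> borel_measurable borel"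
    and B: "\<And>z. \<bar>z\<bar> \<le> 1/2 \<Longrightarrow> \<bar>F z\<bar> \<le> B" "\<And>z. \<bar>z\<bar> \<le> 1/2 \<Longrightarrow> \<bar>Q z\<bar> \<le> B"
  shows "(LINT p|(lborel \<Otimes>\<^sub>M lborel). (case p of (x, t) \<Rightarrow> weak_integrand F Q x t)) =
    (LINT t|lborel. bump_deriv e s1 s2 t * ent_mass d a b v F t
        + bump e s1 s2 t * ent_rate d a b v (\<lambda>z. v * F z + Q z) t)"
proof -
  have B': "\<bar>v * F z + Q z\<bar> \<le> \<bar>v\<bar> * B + B" if "\<bar>z\<bar> \<le> 1/2" for z
  proof -
    have "\<bar>v * F z\<bar> \<le> \<bar>v\<bar> * B" unfolding abs_mult by (intro mult_left_mono B that) auto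
    then show ?thesis using B(2)[OF that] by linarith
  qed
  have "(LINT p|(lborel \<Otimes>\<^sub>M lborel). (case p of (x, t) \<Rightarrow> weak_integrand F Q x t)) =
     (LINT t|lborel. LINT x|lborel. weak_integrand F Q x t)"
    by (rule lborel_pair.integral_snd[symmetric, OF weak_integrand_integrable[OF assms]]) auto
  also have "\<dots> = (LINT t|lborel. bump_deriv e s1 s2 t * ent_mass d a b v F t
        + bump e s1 s2 t * ent_rate d a b v (\<lambda>z. v * F z + Q z) t)"
  proof (intro Bochner_Integration.integral_cong refl)
    fix t
    have "(LINT x|lborel. weak_integrand F Q x t) =
      (LINT x|lborel. bump_deriv e s1 s2 t * (bump d a b (x + v * t) * F (M x t)) +
         bump e s1 s2 t * (bump_deriv d a b (x + v * t) * (v * F (M x t) + Q (M x t))))"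
      by (intro Bochner_Integration.integral_cong refl)
         (simp add: weak_integrand_def test_t_def test_x_def algebra_simps)
    also have "\<dots> = bump_deriv e s1 s2 t * ent_mass d a b v F t
        + bump e s1 s2 t * ent_rate d a b v (\<lambda>z. v * F z + Q z) t"
      unfolding ent_mass_def ent_rate_def
      using slice_integrable(1)[OF assms(1) B(1)] slice_integrable(2)[of "\<lambda>z. v * F z + Q z", OF _ B']
      by (subst Bochner_Integration.integral_add) auto
    finally show "(LINT x|lborel. weak_integrand F Q x t) = bump_deriv e s1 s2 t * ent_mass d a b v F t
        + bump e s1 s2 t * ent_rate d a b v (\<lambda>z. v * F z + Q z) t" .
  qed
  finally show ?thesis .
qed

text \<open>The partial derivatives of a compactly supported function integrate to 0. Hence an
  entropy and its flux may be changed by additive constants.\<close>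

lemma weak_integrand_const:
  "(LINT p|(lborel \<Otimes>\<^sub>M lborel). (case p of (x, t) \<Rightarrow> weak_integrand (\<lambda>_. k0) (\<lambda>_. k1) x t)) = 0"
proof -
  have shift: "(LINT x|lborel. f (x + c)) = (LINT x|lborel. f x)" if "f \<in> borel_measurable borel" for f :: "real \<Rightarrow> real" and c
    using lborel_integral_real_affine[of 1 f c] by (simp add: add.commute)
  have "ent_mass d a b v (\<lambda>_. k0) t = (LINT x|lborel. bump d a b x) * k0" for t
    by (simp add: ent_mass_def shift)
  moreover have "ent_rate d a b v (\<lambda>_. k) t = 0" for k t
    using has_bochner_integral_bump_deriv[OF d, of a b]
    by (simp add: ent_rate_def shift has_bochner_integral_iff)
  ultimately have "(LINT p|(lborel \<Otimes>\<^sub>M lborel). (case p of (x, t) \<Rightarrow> weak_integrand (\<lambda>_. k0) (\<lambda>_. k1) x t)) =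
     (LINT t|lborel. bump_deriv e s1 s2 t * ((LINT x|lborel. bump d a b x) * k0))"
    by (subst weak_integrand_fubini[where B="max \<bar>k0\<bar> \<bar>k1\<bar>"]) auto
  also have "\<dots> = 0"
    using has_bochner_integral_bump_deriv[OF e, of s1 s2] by (simp add: has_bochner_integral_iff)
  finally show ?thesis .
qed

lemma entropy_tested:
  fixes \<alpha> :: real
  assumes \<alpha>: "\<alpha> \<in> {-1/2..1/2}"
  shows "0 \<le> (LINT p|(lborel \<Otimes>\<^sub>M lborel). (case p of (x, t) \<Rightarrow>
      weak_integrand (\<lambda>z. \<bar>z - \<alpha>\<bar>) (\<lambda>z. sgn (z - \<alpha>) * (flux_ext z - flux_ext \<alpha>)) x t))
    + (LINT t|lborel. bump e s1 s2 t * (transported d a b v \<alpha> (1/2) t - transported d a b v (-1/2) \<alpha> t))"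
proof -
  let ?\<eta> = "\<lambda>p. bump e s1 s2 (snd p) * bump d a b (fst p + v * snd p)"
  note test = product_test_function[OF e d ab s12 s1, of v]
  have zero: "bump e s1 s2 t = 0" "bump_deriv e s1 s2 t = 0" if "t \<le> 0" for t
    using that s1 bump_zero[OF e s12, of t] bump_deriv_zero[OF e s12, of t] by auto
  have L: "(LINT (x, t) : UNIV \<times> {0<..} | lborel.
             \<bar>M x t - \<alpha>\<bar> * partial_t ?\<eta> (x, t)
             + sgn (M x t - \<alpha>) * (A (M x t) - A \<alpha>) * partial_x ?\<eta> (x, t)) =
     (LINT p|(lborel \<Otimes>\<^sub>M lborel). (case p of (x, t) \<Rightarrow>
      weak_integrand (\<lambda>z. \<bar>z - \<alpha>\<bar>) (\<lambda>z. sgn (z - \<alpha>) * (flux_ext z - flux_ext \<alpha>)) x t))"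
    unfolding set_lebesgue_integral_def lborel_prod[symmetric]
  proof (intro Bochner_Integration.integral_cong refl)
    fix p :: "real \<times> real"
    obtain x t where p: "p = (x, t)" by (cases p)
    show "indicator (UNIV \<times> {0<..}) p *\<^sub>R (case p of (x, t) \<Rightarrow> \<bar>M x t - \<alpha>\<bar> * partial_t ?\<eta> (x, t)
             + sgn (M x t - \<alpha>) * (A (M x t) - A \<alpha>) * partial_x ?\<eta> (x, t)) =
      (case p of (x, t) \<Rightarrow>
      weak_integrand (\<lambda>z. \<bar>z - \<alpha>\<bar>) (\<lambda>z. sgn (z - \<alpha>) * (flux_ext z - flux_ext \<alpha>)) x t)"
      unfolding p prod.case test weak_integrand_def test_t_def test_x_def
      using zero[of t] \<alpha> by (cases "0 < t") (simp_all add: flux_ext_M flux_ext_eq)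
  qed
  have R: "(LINT t : {0<..} | lborel.
       integral_deriv_abs (\<lambda>x. M x t) \<alpha> (\<lambda>x. conv_measure \<Phi> (\<rho> t) x * ?\<eta> (x, t))) =
     (LINT t|lborel. bump e s1 s2 t * (transported d a b v \<alpha> (1/2) t - transported d a b v (-1/2) \<alpha> t))"
    unfolding set_lebesgue_integral_def
  proof (intro Bochner_Integration.integral_cong refl)
    fix t
    let ?X = "gen_inverse (shifted_cdf (\<rho> t))"
    have Y': "(LINT m:{lo<..<hi}|lborel. V (?X m) t * ?\<eta> (?X m, t)) =
       bump e s1 s2 t * transported d a b v lo hi t" if "{lo<..<hi} \<subseteq> {-1/2<..<1/2}" for lo hi
    proof -
      have "(LINT m:{lo<..<hi}|lborel. V (?X m) t * ?\<eta> (?X m, t)) =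
        (LINT m:{lo<..<hi}|lborel. bump e s1 s2 t * (V (Y m t) t * bump d a b (Y m t + v * t)))"
      proof (rule set_lebesgue_integral_cong)
        show "\<forall>m. m \<in> {lo<..<hi} \<longrightarrow>
          V (?X m) t * ?\<eta> (?X m, t) =
          bump e s1 s2 t * (V (Y m t) t * bump d a b (Y m t + v * t))"
        proof (intro allI impI)
          fix m assume "m \<in> {lo<..<hi}"
          then have "?X m = Y m t" using that by (auto simp: Y_def)
          then show "V (?X m) t * ?\<eta> (?X m, t) =
          bump e s1 s2 t * (V (Y m t) t * bump d a b (Y m t + v * t))" by simp
        qed
      qed simp
      then show ?thesis by (simp add: transported_def)
    qed
    have M': "(\<lambda>x. M x t) = shifted_cdf (\<rho> t)" by (simp add: M_eq fun_eq_iff)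
    have "integral_deriv_abs (\<lambda>x. M x t) \<alpha> (\<lambda>x. conv_measure \<Phi> (\<rho> t) x * ?\<eta> (x, t)) =
       (LINT m:{\<alpha><..<1/2}|lborel. V (?X m) t * ?\<eta> (?X m, t)) -
       (LINT m:{-1/2<..<\<alpha>}|lborel. V (?X m) t * ?\<eta> (?X m, t))"
      unfolding M' V_def[symmetric] using \<alpha>
      by (intro real_distribution.integral_deriv_abs_eq[OF rho]) simp_all
    also have "\<dots> = bump e s1 s2 t * transported d a b v \<alpha> (1/2) t - bump e s1 s2 t * transported d a b v (-1/2) \<alpha> t"
      using \<alpha> by (intro arg_cong2[where f="(-)"] Y') auto
    also have "\<dots> = bump e s1 s2 t * (transported d a b v \<alpha> (1/2) t - transported d a b v (-1/2) \<alpha> t)"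
      by (rule right_diff_distrib[symmetric])
    finally have "integral_deriv_abs (\<lambda>x. M x t) \<alpha> (\<lambda>x. conv_measure \<Phi> (\<rho> t) x * ?\<eta> (x, t)) = \<dots>" .
    then show "indicator {0<..} t *\<^sub>R integral_deriv_abs (\<lambda>x. M x t) \<alpha> (\<lambda>x. conv_measure \<Phi> (\<rho> t) x * ?\<eta> (x, t)) =
       bump e s1 s2 t * (transported d a b v \<alpha> (1/2) t - transported d a b v (-1/2) \<alpha> t)"
      using zero[of t] by (cases "0 < t") simp_all
  qed
  show ?thesis
    using entropy[OF \<alpha>] test(1) unfolding entropy_inequality_def L[symmetric] R[symmetric] by force
qed

end

end

section \<open>Entropy production\<close>

lemma ent_bound: "0 \<le> \<kappa> \<Longrightarrow> \<kappa> \<le> 1 \<Longrightarrow> \<alpha> \<in> {-1/2..1/2} \<Longrightarrow> \<bar>z\<bar> \<le> 1/2 \<Longrightarrow> \<bar>ent \<kappa> \<alpha> z\<bar> \<le> 1"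
proof -
  assume *: "0 \<le> \<kappa>" "\<kappa> \<le> 1" "\<alpha> \<in> {-1/2..1/2}" "\<bar>z\<bar> \<le> 1/2"
  have "\<kappa> * max (z - \<alpha>) 0 \<le> \<kappa> * 1" "(1 - \<kappa>) * max (\<alpha> - z) 0 \<le> (1 - \<kappa>) * 1"
    using * by (intro mult_left_mono; auto)+
  moreover have "0 \<le> \<kappa> * max (z - \<alpha>) 0" "0 \<le> (1 - \<kappa>) * max (\<alpha> - z) 0" using * by auto
  moreover have "\<kappa> * 1 + (1 - \<kappa>) * 1 = 1" by simp
  ultimately show ?thesis unfolding ent_def abs_le_iff by linarith
qed

lemma ent_lip:
  assumes "0 \<le> \<kappa>" "\<kappa> \<le> 1" shows "\<bar>ent \<kappa> \<alpha> z - ent \<kappa> \<alpha> z'\<bar> \<le> \<bar>z - z'\<bar>"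
proof -
  have "ent \<kappa> \<alpha> z - ent \<kappa> \<alpha> z' = \<kappa> * (max (z - \<alpha>) 0 - max (z' - \<alpha>) 0) + (1 - \<kappa>) * (max (\<alpha> - z) 0 - max (\<alpha> - z') 0)"
    by (simp add: ent_def algebra_simps)
  also have "\<bar>\<dots>\<bar> \<le> \<bar>\<kappa> * (max (z - \<alpha>) 0 - max (z' - \<alpha>) 0)\<bar> + \<bar>(1 - \<kappa>) * (max (\<alpha> - z) 0 - max (\<alpha> - z') 0)\<bar>"
    by (rule abs_triangle_ineq)
  also have "\<dots> \<le> \<kappa> * \<bar>z - z'\<bar> + (1 - \<kappa>) * \<bar>z - z'\<bar>"
    unfolding abs_mult using assms by (intro add_mono mult_mono) auto
  finally show ?thesis by (simp add: algebra_simps)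
qed

lemma ent_flux_bound:
  assumes "0 \<le> \<kappa>" "\<kappa> \<le> 1" "\<alpha> \<in> {-1/2..1/2}" "\<bar>z\<bar> \<le> 1/2"
  shows "\<bar>ent_flux \<kappa> \<alpha> z\<bar> \<le> LA"
proof -
  have 1: "\<bar>flux_ext z - flux_ext \<alpha>\<bar> \<le> LA" "\<bar>flux_ext \<alpha> - flux_ext z\<bar> \<le> LA"
    using assms by (auto intro!: flux_ext_diff_le)
  have "\<bar>\<kappa> * (flux_ext z - flux_ext \<alpha>)\<bar> \<le> 1 * LA" "\<bar>(1 - \<kappa>) * (flux_ext \<alpha> - flux_ext z)\<bar> \<le> 1 * LA"
    unfolding abs_mult using assms 1 by (intro mult_mono; simp)+
  then show ?thesis by (simp add: ent_flux_def)
qed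

text \<open>The upper bound for the time derivative of the entropy content: the flow through the
  flanks plus the transport, weighted by the slopes \<kappa> and -(1 - \<kappa>) of the entropy
  above and below \<alpha>.\<close>

definition production :: "real \<Rightarrow> real \<Rightarrow> real \<Rightarrow> real \<Rightarrow> real \<Rightarrow> real \<Rightarrow> real \<Rightarrow> real" where
  "production \<kappa> \<alpha> d a b v t = ent_rate d a b v (\<lambda>z. v * ent \<kappa> \<alpha> z + ent_flux \<kappa> \<alpha> z) t
     + \<kappa> * transported d a b v \<alpha> (1/2) t - (1 - \<kappa>) * transported d a b v (-1/2) \<alpha> t"

context
  fixes d a b v \<kappa> \<alpha> :: real
  assumes d: "d > 0" and ab: "a \<le> b" and \<kappa>: "0 \<le> \<kappa>" "\<kappa> \<le> 1" and \<alpha>: "\<alpha> \<in> {-1/2..1/2}"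
begin

lemma transported_time_integrable:
  assumes "e > 0" "0 < s1" "s1 \<le> s2" "{lo<..<hi} \<subseteq> {-1/2<..<1/2}"
  shows "integrable lborel (\<lambda>t. bump e s1 s2 t * transported d a b v lo hi t)"
proof -
  obtain B where B: "\<And>t. t \<le> s2 + e \<Longrightarrow> \<bar>transported d a b v lo hi t\<bar> \<le> B"
    using transported_abs_bounded[OF d ab assms(4), of "s2 + e" v] by metis
  show ?thesis
    by (rule time_factor_integrable[OF assms(1,3) transported_measurable B])
qed

lemma ent_mass_time_integrable:
  assumes "e > 0" "s1 \<le> s2"
  shows "integrable lborel (\<lambda>t. bump_deriv e s1 s2 t * ent_mass d a b v (ent \<kappa> \<alpha>) t)"
proof -
  note [measurable] = ent_mass_measurable(1)[OF ent_measurable]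
  obtain C where C: "\<And>t. \<bar>ent_mass d a b v (ent \<kappa> \<alpha>) t\<bar> \<le> C"
    using mass_rate_bounded[OF d ab ent_measurable ent_bound[OF \<kappa> \<alpha>]] by metis
  obtain B where B: "B \<ge> 0" "\<And>t. \<bar>bump_deriv e s1 s2 t\<bar> \<le> B" using bump_deriv_bounded[OF assms] by metis
  show ?thesis
  proof (rule integrable_bounded_support[where K="{s1..s2 + e}" and B="B * C"])
    show "\<bar>bump_deriv e s1 s2 x * ent_mass d a b v (ent \<kappa> \<alpha>) x\<bar> \<le> B * C" for x
      unfolding abs_mult by (intro mult_mono B C) auto
    show "bump_deriv e s1 s2 x * ent_mass d a b v (ent \<kappa> \<alpha>) x = 0" if "x \<notin> {s1..s2 + e}" for x
      using that bump_deriv_zero[OF assms, of x] by (auto simp: not_le)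
  qed (auto simp: emeasure_lborel_Icc_eq)
qed

lemma rate_bound:
  assumes "\<bar>z\<bar> \<le> 1/2" shows "\<bar>v * ent \<kappa> \<alpha> z + ent_flux \<kappa> \<alpha> z\<bar> \<le> \<bar>v\<bar> + LA"
proof -
  have "\<bar>v * ent \<kappa> \<alpha> z\<bar> \<le> \<bar>v\<bar> * 1"
    unfolding abs_mult by (intro mult_left_mono ent_bound \<kappa> \<alpha> assms) auto
  then show ?thesis using ent_flux_bound[OF \<kappa> \<alpha> assms] by linarith
qed

lemma rate_time_integrable:
  assumes "e > 0" "s1 \<le> s2"
  shows "integrable lborel (\<lambda>t. bump e s1 s2 t * ent_rate d a b v (\<lambda>z. v * ent \<kappa> \<alpha> z + ent_flux \<kappa> \<alpha> z) t)"
proof -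
  have m: "(\<lambda>z. v * ent \<kappa> \<alpha> z + ent_flux \<kappa> \<alpha> z) \<in> borel_measurable borel" by measurable
  obtain C where C: "\<And>t. \<bar>ent_rate d a b v (\<lambda>z. v * ent \<kappa> \<alpha> z + ent_flux \<kappa> \<alpha> z) t\<bar> \<le> C"
    using mass_rate_bounded[OF d ab m rate_bound] by metis
  show ?thesis
    by (rule time_factor_integrable[OF assms ent_mass_measurable(2)[OF m] C])
qed

lemma production_time_integrable:
  assumes "e > 0" "0 < s1" "s1 \<le> s2"
  shows "integrable lborel (\<lambda>t. bump e s1 s2 t * production \<kappa> \<alpha> d a b v t)"
proof -
  have sub: "{-1/2<..<\<alpha>} \<subseteq> {-1/2<..<1/2}" "{\<alpha><..<1/2} \<subseteq> {-1/2<..<1/2}" using \<alpha> by auto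
  have "integrable lborel (\<lambda>t. bump e s1 s2 t * ent_rate d a b v (\<lambda>z. v * ent \<kappa> \<alpha> z + ent_flux \<kappa> \<alpha> z) t
     + \<kappa> * (bump e s1 s2 t * transported d a b v \<alpha> (1/2) t) - (1 - \<kappa>) * (bump e s1 s2 t * transported d a b v (-1/2) \<alpha> t))"
    using transported_time_integrable[OF assms] sub rate_time_integrable[OF assms(1,3)]
    by (intro Bochner_Integration.integrable_diff Bochner_Integration.integrable_add integrable_mult_right) auto
  then show ?thesis by (simp add: production_def algebra_simps)
qed

text \<open>Up to additive constants, \<open>2 * ent \<kappa> \<alpha> z\<close> is
  \<open>\<bar>z - \<alpha>\<bar> + \<kappa> * \<bar>z + 1/2\<bar> + (1 - \<kappa>) * \<bar>z - 1/2\<bar>\<close>, and \<open>ent_flux\<close> decomposes alike.\<close>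

lemma production_tested:
  assumes e: "e > 0" and s1: "0 < s1" and s12: "s1 \<le> s2"
  shows "0 \<le> (LINT t|lborel. bump_deriv e s1 s2 t * ent_mass d a b v (ent \<kappa> \<alpha>) t
      + bump e s1 s2 t * production \<kappa> \<alpha> d a b v t)"
proof -
  let ?wi = "weak_integrand d a b v e s1 s2"
  let ?W = "\<lambda>F Q. LINT p|(lborel \<Otimes>\<^sub>M lborel). (case p of (x, t) \<Rightarrow> ?wi F Q x t)"
  let ?F = "\<lambda>\<alpha> z. \<bar>z - \<alpha>\<bar>" and ?Q = "\<lambda>\<alpha> z. sgn (z - \<alpha>) * (flux_ext z - flux_ext \<alpha>)"
  let ?tr = "transported d a b v"
  let ?I = "\<lambda>f. LINT t|lborel. bump e s1 s2 t * f t"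
  \<comment> \<open>Both constants are found by evaluating the decomposition at z = \<alpha>, where
    \<open>ent\<close> and \<open>ent_flux\<close> vanish.\<close>
  define k0 where "k0 = (\<kappa> * (\<alpha> + 1/2) + (1 - \<kappa>) * (1/2 - \<alpha>)) / 2"
  define k1 where "k1 = (\<kappa> * (flux_ext \<alpha> - flux_ext (-1/2)) - (1 - \<kappa>) * (flux_ext \<alpha> - flux_ext (1/2))) / 2"
  have sub: "{-1/2<..<\<alpha>} \<subseteq> {-1/2<..<1/2}" "{\<alpha><..<1/2} \<subseteq> {-1/2<..<1/2}" using \<alpha> by auto
  have bF: "\<bar>?F \<gamma> z\<bar> \<le> max 1 LA" if "\<gamma> \<in> {-1/2..1/2}" "\<bar>z\<bar> \<le> 1/2" for \<gamma> z :: real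
    using that by auto
  have bQ: "\<bar>?Q \<gamma> z\<bar> \<le> max 1 LA" if "\<gamma> \<in> {-1/2..1/2}" "\<bar>z\<bar> \<le> 1/2" for \<gamma> z :: real
  proof -
    have "\<bar>sgn (z - \<gamma>)\<bar> * \<bar>flux_ext z - flux_ext \<gamma>\<bar> \<le> 1 * LA"
      using that by (intro mult_mono flux_ext_diff_le) (auto simp: sgn_if)
    then show ?thesis by (simp add: abs_mult)
  qed
  note wi = weak_integrand_integrable[OF d ab e s1 s12]
  have int: "integrable (lborel \<Otimes>\<^sub>M lborel) (\<lambda>(x, t). ?wi (?F \<gamma>) (?Q \<gamma>) x t)"
    if "\<gamma> \<in> {-1/2..1/2}" for \<gamma>
    by (rule wi[OF _ _ bF[OF that] bQ[OF that]]) measurable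
  have int_ent: "integrable (lborel \<Otimes>\<^sub>M lborel) (\<lambda>(x, t). ?wi (ent \<kappa> \<alpha>) (ent_flux \<kappa> \<alpha>) x t)"
    by (rule wi[where B="max 1 LA"]) (use ent_bound[OF \<kappa> \<alpha>] ent_flux_bound[OF \<kappa> \<alpha>] in \<open>auto intro: max.coboundedI1 max.coboundedI2\<close>)
  have int_k: "integrable (lborel \<Otimes>\<^sub>M lborel) (\<lambda>(x, t). ?wi (\<lambda>_. k0) (\<lambda>_. k1) x t)"
    by (rule wi[where B="max \<bar>k0\<bar> \<bar>k1\<bar>"]) auto
  have half: "(-1/2::real) \<in> {-1/2..1/2}" "(1/2::real) \<in> {-1/2..1/2}" by auto
  have pw: "?wi (ent \<kappa> \<alpha>) (ent_flux \<kappa> \<alpha>) x t + ?wi (\<lambda>_. k0) (\<lambda>_. k1) x t =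
    1/2 * ?wi (?F \<alpha>) (?Q \<alpha>) x t
    + \<kappa>/2 * ?wi (?F (-1/2)) (?Q (-1/2)) x t
    + (1-\<kappa>)/2 * ?wi (?F (1/2)) (?Q (1/2)) x t" for x t
  proof -
    define z where "z = M x t"
    have z: "-1/2 \<le> z" "z \<le> 1/2" using M_range by (auto simp: z_def)
    have F: "ent \<kappa> \<alpha> z + k0 = 1/2 * ?F \<alpha> z + \<kappa>/2 * ?F (-1/2) z + (1-\<kappa>)/2 * ?F (1/2) z"
    proof -
      have "?F (-1/2) z = z + 1/2" "?F (1/2) z = 1/2 - z" using z by auto
      then show ?thesis
        by (cases "\<alpha> \<le> z") (simp_all add: ent_def k0_def field_simps)
    qed
    have Qm: "?Q (-1/2) z = flux_ext z - flux_ext (-1/2)" using z by (cases "z = -1/2") (auto simp: sgn_if)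
    have Qp: "?Q (1/2) z = flux_ext (1/2) - flux_ext z"
    proof -
      consider "z = 1/2" | "z < 1/2" using z by linarith
      then show ?thesis
      proof cases
        case 1
        show ?thesis unfolding 1 by simp
      qed simp
    qed
    have Q: "ent_flux \<kappa> \<alpha> z + k1 = 1/2 * ?Q \<alpha> z + \<kappa>/2 * ?Q (-1/2) z + (1-\<kappa>)/2 * ?Q (1/2) z"
      unfolding Qm Qp using z \<alpha>
      by (cases "\<alpha> < z"; cases "\<alpha> = z") (auto simp: ent_flux_def k1_def sgn_if field_simps)
    have "(ent \<kappa> \<alpha> z * y + ent_flux \<kappa> \<alpha> z * y') + (k0 * y + k1 * y') =
       1/2 * (?F \<alpha> z * y + ?Q \<alpha> z * y') + \<kappa>/2 * (?F (-1/2) z * y + ?Q (-1/2) z * y')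
       + (1-\<kappa>)/2 * (?F (1/2) z * y + ?Q (1/2) z * y')" for y y'
    proof -
      have "(ent \<kappa> \<alpha> z * y + ent_flux \<kappa> \<alpha> z * y') + (k0 * y + k1 * y') =
          (ent \<kappa> \<alpha> z + k0) * y + (ent_flux \<kappa> \<alpha> z + k1) * y'" by (simp only: distrib_right distrib_left ac_simps)
      also have "\<dots> = 1/2 * (?F \<alpha> z * y + ?Q \<alpha> z * y') + \<kappa>/2 * (?F (-1/2) z * y + ?Q (-1/2) z * y')
       + (1-\<kappa>)/2 * (?F (1/2) z * y + ?Q (1/2) z * y')"
        unfolding F Q by (simp only: distrib_left distrib_right ac_simps)
      finally show ?thesis .
    qed
    then show ?thesis
      unfolding weak_integrand_def[OF d ab e s1 s12] z_def[symmetric] .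
  qed
  have "?W (ent \<kappa> \<alpha>) (ent_flux \<kappa> \<alpha>) + ?W (\<lambda>_. k0) (\<lambda>_. k1) =
     (LINT p|(lborel \<Otimes>\<^sub>M lborel). (case p of (x, t) \<Rightarrow> ?wi (ent \<kappa> \<alpha>) (ent_flux \<kappa> \<alpha>) x t)
      + (case p of (x, t) \<Rightarrow> ?wi (\<lambda>_. k0) (\<lambda>_. k1) x t))"
    by (rule Bochner_Integration.integral_add[symmetric, OF int_ent int_k])
  also have "\<dots> = (LINT p|(lborel \<Otimes>\<^sub>M lborel). 1/2 * (case p of (x, t) \<Rightarrow> ?wi (?F \<alpha>) (?Q \<alpha>) x t)
    + \<kappa>/2 * (case p of (x, t) \<Rightarrow> ?wi (?F (-1/2)) (?Q (-1/2)) x t)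
    + (1-\<kappa>)/2 * (case p of (x, t) \<Rightarrow> ?wi (?F (1/2)) (?Q (1/2)) x t))"
    by (intro Bochner_Integration.integral_cong refl) (simp only: split_def pw)
  also have "\<dots> = 1/2 * ?W (?F \<alpha>) (?Q \<alpha>) + \<kappa>/2 * ?W (?F (-1/2)) (?Q (-1/2)) + (1-\<kappa>)/2 * ?W (?F (1/2)) (?Q (1/2))"
    using int[OF \<alpha>] int[OF half(1)] int[OF half(2)]
    by (simp only: Bochner_Integration.integral_add Bochner_Integration.integrable_add integrable_mult_right integral_mult_right_zero)
  finally have W: "?W (ent \<kappa> \<alpha>) (ent_flux \<kappa> \<alpha>) =
      1/2 * ?W (?F \<alpha>) (?Q \<alpha>) + \<kappa>/2 * ?W (?F (-1/2)) (?Q (-1/2)) + (1-\<kappa>)/2 * ?W (?F (1/2)) (?Q (1/2))"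
    using weak_integrand_const[OF d ab e s1 s12, of v k0 k1] by simp
  note tri = transported_time_integrable[OF e s1 s12]
  have tr0: "?tr lo lo t = 0" for lo t by (simp add: transported_def set_lebesgue_integral_def)
  define I1 I2 where "I1 = ?I (?tr \<alpha> (1/2))" and "I2 = ?I (?tr (-1/2) \<alpha>)"
  have I12: "?I (\<lambda>t. ?tr (-1/2) (1/2) t) = I2 + I1"
  proof -
    have "?tr (-1/2) (1/2) t = ?tr (-1/2) \<alpha> t + ?tr \<alpha> (1/2) t" for t
      using \<alpha> by (intro transported_split[OF d ab]) auto
    then show ?thesis
      unfolding I1_def I2_def using tri[OF sub(1)] tri[OF sub(2)]
      by (simp only: distrib_left Bochner_Integration.integral_add)
  qed
  have E1: "0 \<le> ?W (?F \<alpha>) (?Q \<alpha>) + (I1 - I2)"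
    using entropy_tested[OF d ab e s1 s12 \<alpha>, of v] tri[OF sub(1)] tri[OF sub(2)]
    by (simp add: right_diff_distrib I1_def I2_def)
  \<comment> \<open>At the levels -1/2 and 1/2 the entropy is affine on the range of M. The two
    inequalities are the weak equation itself with either sign, which is why the transport term
    appears once as I2 + I1 and once as its negative.\<close>
  have E2: "0 \<le> ?W (?F (-1/2)) (?Q (-1/2)) + (I2 + I1)"
    using entropy_tested[OF d ab e s1 s12 half(1), of v] unfolding tr0 diff_0_right I12 .
  have E3: "0 \<le> ?W (?F (1/2)) (?Q (1/2)) - (I2 + I1)"
    using entropy_tested[OF d ab e s1 s12 half(2), of v] I12 by (simp add: tr0)
  have "0 \<le> 1/2 * (?W (?F \<alpha>) (?Q \<alpha>) + (I1 - I2)) + \<kappa>/2 * (?W (?F (-1/2)) (?Q (-1/2)) + (I2 + I1))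
     + (1-\<kappa>)/2 * (?W (?F (1/2)) (?Q (1/2)) - (I2 + I1))"
    by (rule add_nonneg_nonneg[OF add_nonneg_nonneg])
       (rule mult_nonneg_nonneg[OF _ E1] mult_nonneg_nonneg[OF _ E2] mult_nonneg_nonneg[OF _ E3];
        use \<kappa> in simp)+
  also have "\<dots> = ?W (ent \<kappa> \<alpha>) (ent_flux \<kappa> \<alpha>) + (\<kappa> * I1 - (1 - \<kappa>) * I2)"
    unfolding W by (simp add: field_simps)
  also have "?W (ent \<kappa> \<alpha>) (ent_flux \<kappa> \<alpha>) =
    (LINT t|lborel. bump_deriv e s1 s2 t * ent_mass d a b v (ent \<kappa> \<alpha>) t
        + bump e s1 s2 t * ent_rate d a b v (\<lambda>z. v * ent \<kappa> \<alpha> z + ent_flux \<kappa> \<alpha> z) t)"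
    by (rule weak_integrand_fubini[OF d ab e s1 s12, where B="max 1 LA"])
       (use ent_bound[OF \<kappa> \<alpha>] ent_flux_bound[OF \<kappa> \<alpha>] in \<open>auto intro: max.coboundedI1 max.coboundedI2\<close>)
  also have "\<dots> + (\<kappa> * I1 - (1 - \<kappa>) * I2) =
    (LINT t|lborel. (bump_deriv e s1 s2 t * ent_mass d a b v (ent \<kappa> \<alpha>) t
        + bump e s1 s2 t * ent_rate d a b v (\<lambda>z. v * ent \<kappa> \<alpha> z + ent_flux \<kappa> \<alpha> z) t)
      + (\<kappa> * (bump e s1 s2 t * ?tr \<alpha> (1/2) t) - (1 - \<kappa>) * (bump e s1 s2 t * ?tr (-1/2) \<alpha> t)))"
    unfolding I1_def I2_def
    using ent_mass_time_integrable[OF e s12] rate_time_integrable[OF e s12] tri[OF sub(1)] tri[OF sub(2)]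
    by (simp only: Bochner_Integration.integral_add Bochner_Integration.integral_diff
        Bochner_Integration.integrable_add Bochner_Integration.integrable_diff integrable_mult_right integral_mult_right_zero)
  also have "\<dots> = (LINT t|lborel. bump_deriv e s1 s2 t * ent_mass d a b v (ent \<kappa> \<alpha>) t
      + bump e s1 s2 t * production \<kappa> \<alpha> d a b v t)"
    by (intro Bochner_Integration.integral_cong refl) (simp add: production_def algebra_simps)
  finally show ?thesis .
qed

text \<open>The bump is Lipschitz and the entropy is 1-Lipschitz, so the change in time is at most
  that of the bump on a compact set plus the L^1 distance of the two states.\<close>

lemma ent_mass_continuous: "continuous_on UNIV (ent_mass d a b v (ent \<kappa> \<alpha>))"
proof -
  let ?F = "ent \<kappa> \<alpha>"
  let ?w = "ent_mass d a b v ?F"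
  obtain K where K: "K \<ge> 0" "\<And>x y. \<bar>bump d a b x - bump d a b y\<bar> \<le> K * \<bar>x - y\<bar>"
    using bump_lipschitz[OF d] by metis
  have "(?w \<longlongrightarrow> ?w s) (at s)" for s
  proof (rule LIM_zero_cancel, rule Lim_null_comparison)
    \<comment> \<open>The interval [-Z, Z] contains the support of the bump at all times closer than
      1 to s.\<close>
    define Z where "Z = \<bar>a\<bar> + \<bar>b + d\<bar> + \<bar>v\<bar> * (\<bar>s\<bar> + 1)"
    have Z: "Z \<ge> 0" by (simp add: Z_def)
    let ?g = "\<lambda>t. 2 * Z * (K * (\<bar>v\<bar> * \<bar>t - s\<bar>)) + (LINT x|lborel. \<bar>M x t - M x s\<bar>)"
    have "((\<lambda>t. 2 * Z * (K * (\<bar>v\<bar> * \<bar>t - s\<bar>))) \<longlongrightarrow> 2 * Z * (K * (\<bar>v\<bar> * \<bar>s - s\<bar>))) (at s)"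
      by (intro tendsto_intros)
    then show "(?g \<longlongrightarrow> 0) (at s)" using tendsto_add[OF _ L1_cont[of s]] by fastforce
    have bound: "norm (?w t - ?w s) \<le> ?g t" if t: "\<bar>t - s\<bar> < 1" for t
    proof -
      have i1: "integrable lborel (\<lambda>x. bump d a b (x + c) * ?F (M x t))" for c t
        by (rule slice_integrable(1)[OF d ab ent_measurable ent_bound[OF \<kappa> \<alpha>]])
      have diff: "?w t - ?w s =
        (LINT x|lborel. bump d a b (x + v * t) * ?F (M x t) - bump d a b (x + v * s) * ?F (M x s))"
        unfolding ent_mass_def by (rule Bochner_Integration.integral_diff[symmetric, OF i1 i1])
      have le: "norm (LINT x|lborel. bump d a b (x + v * t) * ?F (M x t) - bump d a b (x + v * s) * ?F (M x s))
          \<le> (LINT x|lborel. indicator {-Z..Z} x *\<^sub>R (K * (\<bar>v\<bar> * \<bar>t - s\<bar>)) + \<bar>M x t - M x s\<bar>)"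
      proof (rule order_trans[OF integral_norm_bound], rule integral_mono_AE')
        show "integrable lborel (\<lambda>x. indicator {-Z..Z} x *\<^sub>R (K * (\<bar>v\<bar> * \<bar>t - s\<bar>)) + \<bar>M x t - M x s\<bar>)"
          using L1_int[of t s] by (intro Bochner_Integration.integrable_add integrable_abs integrable_mult_right integrable_scaleR_left) (auto simp: emeasure_lborel_Icc_eq)
        show "AE x in lborel. norm (bump d a b (x + v * t) * ?F (M x t) - bump d a b (x + v * s) * ?F (M x s))
            \<le> indicator {-Z..Z} x *\<^sub>R (K * (\<bar>v\<bar> * \<bar>t - s\<bar>)) + \<bar>M x t - M x s\<bar>"
        proof (rule AE_I2)
          fix x
          have eq: "bump d a b (x + v * t) * ?F (M x t) - bump d a b (x + v * s) * ?F (M x s) =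
            (bump d a b (x + v * t) - bump d a b (x + v * s)) * ?F (M x t) + bump d a b (x + v * s) * (?F (M x t) - ?F (M x s))"
            by (simp add: algebra_simps)
          have 1: "norm (bump d a b (x + v * t) * ?F (M x t) - bump d a b (x + v * s) * ?F (M x s)) \<le> \<bar>bump d a b (x + v * t) - bump d a b (x + v * s)\<bar> * 1 + 1 * \<bar>M x t - M x s\<bar>"
            unfolding real_norm_def eq
            by (rule order_trans[OF abs_triangle_ineq], unfold abs_mult)
               (intro add_mono mult_mono ent_bound[OF \<kappa> \<alpha>] M_abs_le bump_abs_le d ab ent_lip \<kappa>; simp)
          have 2: "\<bar>bump d a b (x + v * t) - bump d a b (x + v * s)\<bar> * 1 \<le> indicator {-Z..Z} x *\<^sub>R (K * (\<bar>v\<bar> * \<bar>t - s\<bar>))"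
          proof (cases "x \<in> {-Z..Z}")
            case True
            have "\<bar>(x + v * t) - (x + v * s)\<bar> = \<bar>v\<bar> * \<bar>t - s\<bar>"
              by (simp add: abs_mult[symmetric] algebra_simps)
            then show ?thesis using True K(2)[of "x + v * t" "x + v * s"] by simp
          next
            case False
            have "bump d a b (x + v * r) = 0" if "\<bar>r - s\<bar> < 1" for r
            proof -
              have "\<bar>v * r\<bar> \<le> \<bar>v\<bar> * (\<bar>s\<bar> + 1)" using that by (auto simp: abs_mult intro!: mult_left_mono)
              then have "x + v * r \<le> a \<or> b + d \<le> x + v * r" using False unfolding Z_def atLeastAtMost_iff by linarith
              then show ?thesis by (rule bump_zero[OF d ab])
            qed
            from this[of t] this[of s] t show ?thesis using False by simp
          qed
          show "norm (bump d a b (x + v * t) * ?F (M x t) - bump d a b (x + v * s) * ?F (M x s))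
            \<le> indicator {-Z..Z} x *\<^sub>R (K * (\<bar>v\<bar> * \<bar>t - s\<bar>)) + \<bar>M x t - M x s\<bar>"
            using order_trans[OF 1 add_right_mono[OF 2]] by (simp only: mult_1)
        qed
      qed (use K in auto)
      have sum: "(LINT x|lborel. indicator {-Z..Z} x *\<^sub>R (K * (\<bar>v\<bar> * \<bar>t - s\<bar>)) + \<bar>M x t - M x s\<bar>)
          = (LINT x|lborel. indicator {-Z..Z} x *\<^sub>R (K * (\<bar>v\<bar> * \<bar>t - s\<bar>))) + (LINT x|lborel. \<bar>M x t - M x s\<bar>)"
        using L1_int[of t s] by (intro Bochner_Integration.integral_add) (auto intro!: integrable_scaleR_left simp: emeasure_lborel_Icc_eq)
      show ?thesis
        using le unfolding diff sum using Z by simp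
    qed
    show "eventually (\<lambda>t. norm (?w t - ?w s) \<le> ?g t) (at s)"
      unfolding eventually_at using bound by (intro exI[of _ 1]) (auto simp: dist_real_def)
  qed
  then show ?thesis by (simp add: continuous_on_def)
qed

text \<open>The form in which the entropy inequality is used from here on: it compares the contents
  of a bump at two given times.\<close>

lemma ent_mass_le:
  assumes "0 \<le> s" "s \<le> T" "\<And>t. s < t \<Longrightarrow> t < T \<Longrightarrow> production \<kappa> \<alpha> d a b v t \<le> c"
  shows "ent_mass d a b v (ent \<kappa> \<alpha>) T - ent_mass d a b v (ent \<kappa> \<alpha>) s \<le> c * (T - s)"
  by (rule weak_derivative_le[OF assms(2) ent_mass_continuous, where r="production \<kappa> \<alpha> d a b v"])
     (use assms in \<open>auto intro: ent_mass_time_integrable production_time_integrable production_tested\<close>)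

end

section \<open>Finite speed of propagation\<close>

lemma layer_cake:
  assumes d: "d > 0" and ab: "a \<le> b" and lohi: "-1/2 \<le> lo" "lo \<le> hi" "hi \<le> 1/2"
  shows "(LINT m:{lo<..<hi}|lborel. bump d a b (Y m t + c)) =
     (LINT u|lborel. bump_deriv d a b (u + c) * max (hi - max lo (M u t)) 0)"
proof -
  \<comment> \<open>The bump at the quantile is an integral of its derivative over u < Y m t. Since
    u < Y m t means M u t < m, the exchanged inner integral is the length of the levels between
    \<open>max lo (M u t)\<close> and hi.\<close>
  let ?f = "\<lambda>m u. indicator {lo<..<hi} m * (indicator {..<Y m t + c} (u + c) * bump_deriv d a b (u + c))"
  obtain B where B: "B \<ge> 0" "\<And>x. \<bar>bump_deriv d a b x\<bar> \<le> B" using bump_deriv_bounded[OF d ab] by metis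
  have int: "integrable (lborel \<Otimes>\<^sub>M lborel) (\<lambda>(m, u). ?f m u)"
  proof (rule integrable_bounded_support[where K="{lo<..<hi} \<times> {a - c..b + d - c}" and B=B])
    show "{lo<..<hi} \<times> {a - c..b + d - c} \<in> sets (lborel \<Otimes>\<^sub>M lborel)" by (intro pair_measureI) auto
    show "emeasure (lborel \<Otimes>\<^sub>M lborel) ({lo<..<hi} \<times> {a - c..b + d - c}) < \<infinity>"
      using lohi by (subst lborel.emeasure_pair_measure_Times) (auto simp: ennreal_mult_less_top emeasure_lborel_Icc_eq)
    show "\<bar>case p of (m, u) \<Rightarrow> ?f m u\<bar> \<le> B" for p
      using B by (cases p) (auto simp: indicator_def)
    show "(case p of (m, u) \<Rightarrow> ?f m u) = 0" if "p \<notin> {lo<..<hi} \<times> {a - c..b + d - c}" for p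
    proof (cases p)
      case (Pair m u)
      then show ?thesis using that bump_deriv_zero[OF d ab, of "u + c"] by (auto simp: indicator_def)
    qed
    have "(\<lambda>p. indicator {lo<..<hi} (fst p) * ((if snd p < Y (fst p) t then 1 else 0) * bump_deriv d a b (snd p + c)))
        \<in> borel_measurable (lborel \<Otimes>\<^sub>M lborel)" by measurable
    then show "(\<lambda>(m, u). ?f m u) \<in> borel_measurable (lborel \<Otimes>\<^sub>M lborel)"
      by (rule measurable_cong[THEN iffD1, rotated]) (auto simp: indicator_def)
  qed
  have "(LINT m:{lo<..<hi}|lborel. bump d a b (Y m t + c)) = (LINT m|lborel. LINT u|lborel. ?f m u)"
    unfolding set_lebesgue_integral_def
  proof (intro Bochner_Integration.integral_cong refl)
    fix m
    have "bump d a b (Y m t + c) = (LINT u|lborel. indicator {..<Y m t + c} u * bump_deriv d a b u)"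
      by (rule bump_eq_integral[OF d ab])
    also have "\<dots> = (LINT u|lborel. indicator {..<Y m t + c} (u + c) * bump_deriv d a b (u + c))"
      using lborel_integral_real_affine[of 1 "\<lambda>u. indicator {..<Y m t + c} u * bump_deriv d a b u" c]
      by (simp add: add.commute)
    finally show "indicator {lo<..<hi} m *\<^sub>R bump d a b (Y m t + c) = (LINT u|lborel. ?f m u)" by simp
  qed
  also have "\<dots> = (LINT u|lborel. LINT m|lborel. ?f m u)"
    by (rule lborel_pair.Fubini_integral[symmetric, OF int])
  also have "\<dots> = (LINT u|lborel. bump_deriv d a b (u + c) * max (hi - max lo (M u t)) 0)"
  proof (intro Bochner_Integration.integral_cong refl)
    fix u
    have "(LINT m|lborel. ?f m u) = (LINT m|lborel. bump_deriv d a b (u + c) * indicator {max lo (M u t)<..<hi} m)"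
    proof (intro Bochner_Integration.integral_cong refl)
      fix m
      show "?f m u = bump_deriv d a b (u + c) * indicator {max lo (M u t)<..<hi} m"
      proof (cases "m \<in> {lo<..<hi}")
        case True
        then have "u < Y m t \<longleftrightarrow> M u t < m" using Y_le_iff[of m t u] lohi by (simp add: not_le[symmetric])
        then show ?thesis using True by (auto simp: indicator_def)
      qed (auto simp: indicator_def)
    qed
    also have "\<dots> = bump_deriv d a b (u + c) * max (hi - max lo (M u t)) 0"
      by (cases "max lo (M u t) \<le> hi") (auto simp: max_def)
    finally show "(LINT m|lborel. ?f m u) = bump_deriv d a b (u + c) * max (hi - max lo (M u t)) 0" .
  qed
  finally show ?thesis .
qed

lemma transported_bounds:
  assumes d: "d > 0" and ab: "a \<le> b" and lohi: "{lo<..<hi} \<subseteq> {-1/2<..<1/2}"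
    and C: "\<And>m. \<bar>V (Y m t) t\<bar> \<le> C"
  shows "\<bar>transported d a b v lo hi t\<bar> \<le> C * (LINT m:{lo<..<hi}|lborel. bump d a b (Y m t + v * t))"
proof -
  have "set_integrable lborel {lo<..<hi} (\<lambda>m. bump d a b (Y m t + v * t))"
    unfolding set_integrable_def
    by (intro integrable_bounded_support[where K="{-1/2<..<1/2}" and B="1"])
       (use lohi bump_abs_le[OF d ab] in \<open>auto split: split_indicator\<close>)
  then have int: "integrable lborel (\<lambda>m. C * (indicator {lo<..<hi} m *\<^sub>R bump d a b (Y m t + v * t)))"
    by (simp add: set_integrable_def)
  have "C \<ge> 0" using C[of 0] by linarith
  have "\<bar>transported d a b v lo hi t\<bar> \<le> (LINT m|lborel. C * (indicator {lo<..<hi} m *\<^sub>R bump d a b (Y m t + v * t)))"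
    unfolding transported_def set_lebesgue_integral_def real_norm_def[symmetric]
  proof (rule order_trans[OF integral_norm_bound], rule integral_mono_AE'[OF int])
    show "AE m in lborel. norm (indicator {lo<..<hi} m *\<^sub>R (V (Y m t) t * bump d a b (Y m t + v * t)))
        \<le> C * (indicator {lo<..<hi} m *\<^sub>R bump d a b (Y m t + v * t))"
      using C bump_nonneg[OF d ab] by (auto simp: indicator_def abs_mult intro!: mult_right_mono)
    show "AE m in lborel. 0 \<le> C * (indicator {lo<..<hi} m *\<^sub>R bump d a b (Y m t + v * t))"
      using \<open>C \<ge> 0\<close> bump_nonneg[OF d ab] by (auto simp: indicator_def)
  qed
  then show ?thesis by (simp add: set_lebesgue_integral_def)
qed

text \<open>Since \<open>L\<close> bounds the sum of \<open>\<bar>A'\<bar>\<close> and \<open>\<bar>\<Phi> * \<rho>\<bar>\<close>, a one-sided entropy tested with a bump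
  moving at speed \<open>L\<close> away from the support of that entropy has nonpositive production.\<close>

lemma finite_speed:
  obtains L where "L \<ge> 0"
    "\<And>s t x. 0 \<le> s \<Longrightarrow> s \<le> t \<Longrightarrow> t \<le> S \<Longrightarrow> M x s \<le> M (x + L * (t - s)) t"
    "\<And>s t x y. 0 \<le> s \<Longrightarrow> s \<le> t \<Longrightarrow> t \<le> S \<Longrightarrow> y < x - L * (t - s) \<Longrightarrow> M y t \<le> M x s"
proof -
  obtain R where R: "R > 0" "\<And>t x. t \<le> S \<Longrightarrow> x < -R \<Longrightarrow> M x t = -1/2"
    "\<And>t x. t \<le> S \<Longrightarrow> R \<le> x \<Longrightarrow> M x t = 1/2" "\<And>t m. t \<le> S \<Longrightarrow> \<bar>Y m t\<bar> \<le> R"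
    using support_bound[of S] by metis
  obtain C where C: "C \<ge> 0" "\<And>x t. t \<le> S \<Longrightarrow> \<bar>x\<bar> \<le> R \<Longrightarrow> \<bar>V x t\<bar> \<le> C" using V_bound[of S R] by metis
  define L where "L = LA + C"
  have L: "L \<ge> 0" using LA_nonneg C(1) by (simp add: L_def)
  have C': "\<bar>V (Y m t) t\<bar> \<le> C" if "t \<le> S" for m t using C(2)[OF that R(4)[OF that]] .
  have right: "M x s \<le> M (x + L * (t - s)) t" if st: "0 \<le> s" "s \<le> t" "t \<le> S" for s t x
  proof (rule ccontr)
    define \<beta> where "\<beta> = M x s"
    assume "\<not> M x s \<le> M (x + L * (t - s)) t"
    then have less: "M (x + L * (t - s)) t < \<beta>" by (simp add: \<beta>_def)
    have \<beta>: "\<beta> \<in> {-1/2..1/2}" using M_range[of x s] by (simp add: \<beta>_def)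
    \<comment> \<open>The left edge of the bump is at x at time s and at x + L (t - s) at time t.
      The falling flank stays right of R, where M = 1/2 and the entropy (\<beta> - z)^+ vanishes, so
      only the rising flank counts.\<close>
    define a where "a = x - L * s"
    define b where "b = max (a + 1) R"
    have ab: "a \<le> b" by (simp add: b_def)
    have d: "(0::real) < 1" by simp
    have z01: "(0::real) \<le> 0" "(0::real) \<le> 1" by auto
    let ?F = "ent 0 \<beta>" and ?mass = "ent_mass 1 a b (-L) (ent 0 \<beta>)"
    have F: "?F z = max (\<beta> - z) 0" for z by (simp add: ent_def)
    have prod: "production 0 \<beta> 1 a b (-L) \<tau> \<le> 0" if \<tau>: "s < \<tau>" "\<tau> < t" for \<tau>
    proof -
      have \<tau>S: "\<tau> \<le> S" and \<tau>0: "0 \<le> \<tau>" using \<tau> st by auto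
      have sub: "{-1/2<..<\<beta>} \<subseteq> {-1/2<..<1/2}" using \<beta> by auto
      \<comment> \<open>This turns the bound C times the bump integral over levels into an integral
        over the flank, of the same shape as the flux term. The part LA of the speed absorbs the
        flux and the part C the transport.\<close>
      have lc: "(LINT m:{-1/2<..<\<beta>}|lborel. bump 1 a b (Y m \<tau> + (-L) * \<tau>)) =
        (LINT u|lborel. bump_deriv 1 a b (u + (-L) * \<tau>) * ?F (M u \<tau>))"
      proof (subst layer_cake[OF d ab])
        have "max (-1/2) (M u \<tau>) = M u \<tau>" for u using M_range[of u \<tau>] by simp
        then show "(LINT u|lborel. bump_deriv 1 a b (u + (-L) * \<tau>) * max (\<beta> - max (-1/2) (M u \<tau>)) 0) =
          (LINT u|lborel. bump_deriv 1 a b (u + (-L) * \<tau>) * ?F (M u \<tau>))" by (simp only: F)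
      qed (use \<beta> in auto)
      have i1: "integrable lborel (\<lambda>u. bump_deriv 1 a b (u + c) * ?F (M u \<tau>))" for c
        by (rule slice_integrable(2)[OF d ab ent_measurable ent_bound[OF z01 \<beta>]])
      have "ent_rate 1 a b (-L) (\<lambda>z. (-L) * ?F z + ent_flux 0 \<beta> z) \<tau> \<le>
         (LINT u|lborel. (-C) * (bump_deriv 1 a b (u + (-L) * \<tau>) * ?F (M u \<tau>)))"
        unfolding ent_rate_def
      proof (rule integral_mono)
        show "integrable lborel (\<lambda>u. bump_deriv 1 a b (u + (-L) * \<tau>) * ((-L) * ?F (M u \<tau>) + ent_flux 0 \<beta> (M u \<tau>)))"
          by (rule slice_integrable(2)[OF d ab _ rate_bound[OF d ab z01 \<beta>, of _ "-L"]]) measurable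
        show "integrable lborel (\<lambda>u. (-C) * (bump_deriv 1 a b (u + (-L) * \<tau>) * ?F (M u \<tau>)))"
          by (intro integrable_mult_right i1)
        fix u
        show "bump_deriv 1 a b (u + (-L) * \<tau>) * ((-L) * ?F (M u \<tau>) + ent_flux 0 \<beta> (M u \<tau>))
            \<le> (-C) * (bump_deriv 1 a b (u + (-L) * \<tau>) * ?F (M u \<tau>))"
        proof (cases "\<beta> \<le> M u \<tau>")
          case True
          then show ?thesis by (simp add: F ent_flux_def)
        next
          case False
          then have "u < R" using R(3)[OF \<tau>S, of u] \<beta> by (cases "R \<le> u") auto
          then have "u + (-L) * \<tau> \<le> b" using mult_nonneg_nonneg[OF L \<tau>0] by (simp add: b_def)
          then have nn: "0 \<le> bump_deriv 1 a b (u + (-L) * \<tau>)" by (rule bump_deriv_nonneg[OF d ab])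
          have "flux_ext \<beta> - flux_ext (M u \<tau>) \<le> LA * (\<beta> - M u \<tau>)"
            using flux_ext_lip[of \<beta> "M u \<tau>"] False by simp
          then have "(-L) * ?F (M u \<tau>) + ent_flux 0 \<beta> (M u \<tau>) \<le> (-C) * ?F (M u \<tau>)"
            using False by (simp add: F ent_flux_def L_def algebra_simps)
          from mult_left_mono[OF this nn] show ?thesis by (simp only: mult.left_commute)
        qed
      qed
      also have "\<dots> = -C * (LINT m:{-1/2<..<\<beta>}|lborel. bump 1 a b (Y m \<tau> + (-L) * \<tau>))"
        unfolding lc by (rule integral_mult_right_zero)
      also have "\<dots> \<le> transported 1 a b (-L) (-1/2) \<beta> \<tau>"
        using transported_bounds[OF d ab sub C'[OF \<tau>S], where v="-L"] by (simp add: abs_le_iff)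
      finally show ?thesis by (simp add: production_def)
    qed
    have "?mass t - ?mass s \<le> 0 * (t - s)"
      by (rule ent_mass_le[OF d ab z01 \<beta> st(1,2) prod])
    \<comment> \<open>At time s the bump lives on u > x, where M is at least \<beta> by
      monotonicity.\<close>
    moreover have "?mass s = (LINT (x::real)|lborel. 0)"
      unfolding ent_mass_def
    proof (intro Bochner_Integration.integral_cong refl)
      fix u
      show "bump 1 a b (u + (-L) * s) * ?F (M u s) = 0"
      proof (cases "x \<le> u")
        case True
        then have "\<beta> \<le> M u s" using M_mono[OF True, of s] by (simp add: \<beta>_def)
        then show ?thesis by (simp add: F)
      next
        case False
        then show ?thesis using bump_zero[OF d ab, of "u + (-L) * s"] by (simp add: a_def)
      qed
    qed
    ultimately have le0: "?mass t \<le> 0" by simp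
    have nn: "0 \<le> bump 1 a b (u + (-L) * t) * ?F (M u t)" for u
      by (simp add: bump_nonneg[OF d ab] F)
    have i: "integrable lborel (\<lambda>u. bump 1 a b (u + (-L) * t) * ?F (M u t))"
      by (rule slice_integrable(1)[OF d ab ent_measurable ent_bound[OF z01 \<beta>]])
    have "?mass t = 0" using le0 nn unfolding ent_mass_def by (intro antisym integral_nonneg) auto
    then have AE: "AE u in lborel. bump 1 a b (u + (-L) * t) * ?F (M u t) = 0"
      unfolding ent_mass_def using integral_nonneg_eq_0_iff_AE[OF i] nn by simp
    \<comment> \<open>At the point x + L (t - s) itself the bump vanishes; right continuity carries
      the strict inequality into its interior.\<close>
    have "eventually (\<lambda>u. M u t < \<beta>) (at_right (x + L * (t - s)))"
      using order_tendstoD(2)[OF M_right_cont less] .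
    then obtain y where y: "x + L * (t - s) < y" "\<And>u. x + L * (t - s) < u \<Longrightarrow> u < y \<Longrightarrow> M u t < \<beta>"
      by (auto simp: eventually_at_right_field)
    obtain u where u: "x + L * (t - s) < u" "u < min y (x + L * (t - s) + 1)"
       "bump 1 a b (u + (-L) * t) * ?F (M u t) = 0"
      using AE_interval_witness[OF AE, of "x + L * (t - s)" "min y (x + L * (t - s) + 1)"] y(1) by auto
    have "M u t < \<beta>" using u y by auto
    moreover have "bump 1 a b (u + (-L) * t) > 0"
    proof -
      have "a < u + (-L) * t" "u + (-L) * t \<le> b" using u by (auto simp: a_def b_def algebra_simps)
      then show ?thesis by (simp add: bump_def smooth_step_0 smooth_step_pos)
    qed
    ultimately show False using u(3) by (simp add: F)
  qed
  have left: "M y t \<le> M x s" if st: "0 \<le> s" "s \<le> t" "t \<le> S" and y: "y < x - L * (t - s)" for s t x y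
  proof -
    define \<beta> where "\<beta> = M x s"
    have \<beta>: "\<beta> \<in> {-1/2..1/2}" using M_range[of x s] by (simp add: \<beta>_def)
    \<comment> \<open>The mirror image. The falling flank has width 1, hence the - 1: the right edge
      is at x at time s and at x - L (t - s) at time t. The rising flank lies left of -R, where M =
      -1/2 and (z - \<beta>)^+ vanishes.\<close>
    define b where "b = x + L * s - 1"
    define a where "a = min (b - 1) (-R - 1)"
    have ab: "a \<le> b" by (simp add: a_def)
    have d: "(0::real) < 1" by simp
    have z01: "(0::real) \<le> 1" "(1::real) \<le> 1" by auto
    let ?F = "ent 1 \<beta>" and ?mass = "ent_mass 1 a b L (ent 1 \<beta>)"
    have F: "?F z = max (z - \<beta>) 0" for z by (simp add: ent_def)
    have prod: "production 1 \<beta> 1 a b L \<tau> \<le> 0" if \<tau>: "s < \<tau>" "\<tau> < t" for \<tau>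
    proof -
      have \<tau>S: "\<tau> \<le> S" and \<tau>0: "0 \<le> \<tau>" using \<tau> st by auto
      have sub: "{\<beta><..<1/2} \<subseteq> {-1/2<..<1/2}" using \<beta> by auto
      have i1: "integrable lborel (\<lambda>u. bump_deriv 1 a b (u + c) * ?F (M u \<tau>))" for c
        by (rule slice_integrable(2)[OF d ab ent_measurable ent_bound[OF z01 \<beta>]])
      have i2: "integrable lborel (\<lambda>u. bump_deriv 1 a b (u + c) * (1/2 - \<beta>))"
        and v2: "(LINT u|lborel. bump_deriv 1 a b (u + c) * (1/2 - \<beta>)) = 0" for c
      proof -
        have *: "integrable lborel (bump_deriv 1 a b)" "(LINT u|lborel. bump_deriv 1 a b u) = 0"
          using has_bochner_integral_bump_deriv[OF d, of a b] by (auto simp: has_bochner_integral_iff)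
        then have "integrable lborel (\<lambda>u. bump_deriv 1 a b (c + 1 * u))"
          by (intro lborel_integrable_real_affine) auto
        then show "integrable lborel (\<lambda>u. bump_deriv 1 a b (u + c) * (1/2 - \<beta>))" by (simp add: add.commute)
        show "(LINT u|lborel. bump_deriv 1 a b (u + c) * (1/2 - \<beta>)) = 0"
          using lborel_integral_real_affine[of 1 "bump_deriv 1 a b" c] * by (simp add: add.commute)
      qed
      have lc: "(LINT m:{\<beta><..<1/2}|lborel. bump 1 a b (Y m \<tau> + L * \<tau>)) =
        - (LINT u|lborel. bump_deriv 1 a b (u + L * \<tau>) * ?F (M u \<tau>))"
      proof -
        \<comment> \<open>The layer cake formula yields the entropy only up to sign and the constant
          1/2 - \<beta>, which integrates to 0 against the bump derivative.\<close>
        have "max (1/2 - max \<beta> (M u \<tau>)) 0 = (1/2 - \<beta>) - ?F (M u \<tau>)" for u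
          using M_range[of u \<tau>] \<beta> by (auto simp: F max_def)
        then have "(LINT m:{\<beta><..<1/2}|lborel. bump 1 a b (Y m \<tau> + L * \<tau>)) =
           (LINT u|lborel. bump_deriv 1 a b (u + L * \<tau>) * (1/2 - \<beta>) - bump_deriv 1 a b (u + L * \<tau>) * ?F (M u \<tau>))"
          using \<beta> by (subst layer_cake[OF d ab]) (auto simp: right_diff_distrib)
        then show ?thesis using i1 i2 v2 by (simp add: Bochner_Integration.integral_diff)
      qed
      have "ent_rate 1 a b L (\<lambda>z. L * ?F z + ent_flux 1 \<beta> z) \<tau> \<le>
         (LINT u|lborel. C * (bump_deriv 1 a b (u + L * \<tau>) * ?F (M u \<tau>)))"
        unfolding ent_rate_def
      proof (rule integral_mono)
        show "integrable lborel (\<lambda>u. bump_deriv 1 a b (u + L * \<tau>) * (L * ?F (M u \<tau>) + ent_flux 1 \<beta> (M u \<tau>)))"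
          by (rule slice_integrable(2)[OF d ab _ rate_bound[OF d ab z01 \<beta>, of _ L]]) measurable
        show "integrable lborel (\<lambda>u. C * (bump_deriv 1 a b (u + L * \<tau>) * ?F (M u \<tau>)))"
          by (intro integrable_mult_right i1)
        fix u
        show "bump_deriv 1 a b (u + L * \<tau>) * (L * ?F (M u \<tau>) + ent_flux 1 \<beta> (M u \<tau>))
            \<le> C * (bump_deriv 1 a b (u + L * \<tau>) * ?F (M u \<tau>))"
        proof (cases "M u \<tau> \<le> \<beta>")
          case True
          then show ?thesis by (cases "M u \<tau> = \<beta>") (simp_all add: F ent_flux_def)
        next
          case False
          then have "-R \<le> u" using R(2)[OF \<tau>S, of u] \<beta> by (cases "u < -R") auto
          then have "a + 1 \<le> u + L * \<tau>" using mult_nonneg_nonneg[OF L \<tau>0] by (simp add: a_def)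
          then have nn: "bump_deriv 1 a b (u + L * \<tau>) \<le> 0" by (rule bump_deriv_nonpos[OF d ab])
          have "flux_ext (M u \<tau>) - flux_ext \<beta> \<ge> - LA * (M u \<tau> - \<beta>)"
            using flux_ext_lip[of \<beta> "M u \<tau>"] False by simp
          then have "C * ?F (M u \<tau>) \<le> L * ?F (M u \<tau>) + ent_flux 1 \<beta> (M u \<tau>)"
            using False by (simp add: F ent_flux_def L_def algebra_simps)
          from mult_left_mono_neg[OF this nn] show ?thesis by (simp only: mult.left_commute)
        qed
      qed
      also have "\<dots> = -C * (LINT m:{\<beta><..<1/2}|lborel. bump 1 a b (Y m \<tau> + L * \<tau>))"
        unfolding lc by simp
      also have "\<dots> \<le> - transported 1 a b L \<beta> (1/2) \<tau>"
        using transported_bounds[OF d ab sub C'[OF \<tau>S], where v="L"] by (simp add: abs_le_iff)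
      finally show ?thesis by (simp add: production_def)
    qed
    have "?mass t - ?mass s \<le> 0 * (t - s)"
      by (rule ent_mass_le[OF d ab z01 \<beta> st(1,2) prod])
    moreover have "?mass s = (LINT (x::real)|lborel. 0)"
      unfolding ent_mass_def
    proof (intro Bochner_Integration.integral_cong refl)
      fix u
      show "bump 1 a b (u + L * s) * ?F (M u s) = 0"
      proof (cases "u \<le> x")
        case True
        then have "M u s \<le> \<beta>" using M_mono[OF True, of s] by (simp add: \<beta>_def)
        then show ?thesis by (simp add: F)
      next
        case False
        then show ?thesis using bump_zero[OF d ab, of "u + L * s"] by (simp add: b_def)
      qed
    qed
    ultimately have le0: "?mass t \<le> 0" by simp
    have nn: "0 \<le> bump 1 a b (u + L * t) * ?F (M u t)" for u
      by (simp add: bump_nonneg[OF d ab] F)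
    have i: "integrable lborel (\<lambda>u. bump 1 a b (u + L * t) * ?F (M u t))"
      by (rule slice_integrable(1)[OF d ab ent_measurable ent_bound[OF z01 \<beta>]])
    have "?mass t = 0" using le0 nn unfolding ent_mass_def by (intro antisym integral_nonneg) auto
    then have AE: "AE u in lborel. bump 1 a b (u + L * t) * ?F (M u t) = 0"
      unfolding ent_mass_def using integral_nonneg_eq_0_iff_AE[OF i] nn by simp
    \<comment> \<open>M need not be left continuous, so a point strictly between y and the edge of
      the bump is taken; the strict bound on y makes room for it.\<close>
    obtain u where u: "max y (x - L * (t - s) - 1) < u" "u < x - L * (t - s)"
       "bump 1 a b (u + L * t) * ?F (M u t) = 0"
      using AE_interval_witness[OF AE, of "max y (x - L * (t - s) - 1)" "x - L * (t - s)"] y by auto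
    have "bump 1 a b (u + L * t) > 0"
    proof -
      have "a + 1 \<le> u + L * t" "u + L * t < b + 1" using u by (auto simp: a_def b_def algebra_simps min_def)
      then show ?thesis by (simp add: bump_def smooth_step_1 smooth_step_less_1)
    qed
    then have "M u t \<le> \<beta>" using u(3) by (auto simp: F max_def split: if_splits)
    then show ?thesis using M_mono[of y u t] u(1) by (simp add: \<beta>_def)
  qed
  show ?thesis by (rule that[OF L right left])
qed

section \<open>Admissibility of jumps and clusters\<close>

lemma shock_admissible:
  assumes T: "0 < T" and p: "-1/2 \<le> p" and q: "q \<le> 1/2" and \<alpha>: "p < \<alpha>" "\<alpha> < q"
    and left: "\<And>x. x < c \<Longrightarrow> M x T \<le> p"
    and left_lim: "\<And>\<epsilon>. 0 < \<epsilon> \<Longrightarrow> \<exists>x<c. p - \<epsilon> \<le> M x T"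
    and right: "M c T = q"
  shows "(q - \<alpha>) * A p + (\<alpha> - p) * A q \<le> (q - p) * A \<alpha>"
proof (rule ccontr)
  assume not: "\<not> (q - \<alpha>) * A p + (\<alpha> - p) * A q \<le> (q - p) * A \<alpha>"
  define \<kappa> where "\<kappa> = (\<alpha> - p) / (q - p)"
  have \<kappa>': "1 - \<kappa> = (q - \<alpha>) / (q - p)" using \<alpha> by (simp add: \<kappa>_def field_simps)
  have \<kappa>: "0 \<le> \<kappa>" "\<kappa> \<le> 1" using \<alpha> by (auto simp: \<kappa>_def field_simps)
  have \<alpha>I: "\<alpha> \<in> {-1/2..1/2}" using p q \<alpha> by auto
  have bal: "\<kappa> * (q - \<alpha>) = (1 - \<kappa>) * (\<alpha> - p)" unfolding \<kappa>' by (simp add: \<kappa>_def)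
  \<comment> \<open>The height of the chord above A at \<alpha>, which is also the entropy flux at q
    minus the one at p.\<close>
  define H where "H = (1 - \<kappa>) * A p + \<kappa> * A q - A \<alpha>"
  have "(q - p) * H = (q - \<alpha>) * A p + (\<alpha> - p) * A q - (q - p) * A \<alpha>"
  proof -
    have k: "(q - p) * (1 - \<kappa>) = q - \<alpha>" "(q - p) * \<kappa> = \<alpha> - p"
      using \<alpha> by (simp_all add: \<kappa>') (simp add: \<kappa>_def)
    have "(q - p) * H = (q - p) * (1 - \<kappa>) * A p + (q - p) * \<kappa> * A q - (q - p) * A \<alpha>"
      unfolding H_def by (simp add: algebra_simps)
    then show ?thesis unfolding k .
  qed
  then have "0 < (q - p) * H" using not by simp
  then have H: "H > 0" using \<alpha> by (simp add: zero_less_mult_iff)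
  obtain L where L: "L \<ge> 0"
    "\<And>s t x. 0 \<le> s \<Longrightarrow> s \<le> t \<Longrightarrow> t \<le> T \<Longrightarrow> M x s \<le> M (x + L * (t - s)) t"
    "\<And>s t x y. 0 \<le> s \<Longrightarrow> s \<le> t \<Longrightarrow> t \<le> T \<Longrightarrow> y < x - L * (t - s) \<Longrightarrow> M y t \<le> M x s"
    using finite_speed[of T] by metis
  obtain R where R: "\<And>t m. t \<le> T \<Longrightarrow> \<bar>Y m t\<bar> \<le> R" using support_bound[of T] by metis
  obtain C where C: "C \<ge> 0" "\<And>x t. t \<le> T \<Longrightarrow> \<bar>x\<bar> \<le> R \<Longrightarrow> \<bar>V x t\<bar> \<le> C" using V_bound[of T R] by metis
  \<comment> \<open>Within a time h \<delta> the comparison shifts by at most \<delta> / 2; the + 1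
    covers L = 0.\<close>
  define h where "h = 1 / (2 * (L + 1))"
  have h: "h > 0" "L * h \<le> 1/2" using L(1) by (auto simp: h_def field_simps)
  \<comment> \<open>Collects the errors per \<epsilon>: 2 LA from the flux on the two flanks, 1 from
    the variation of V near c, and C from the levels within \<epsilon> of [p, q] but outside
    it.\<close>
  define Q where "Q = 2 * LA + 1 + C"
  have Q: "Q > 0" using LA_nonneg C(1) by (simp add: Q_def)
  \<comment> \<open>Makes the total error \<epsilon> (4 + h Q) equal to half of the loss H h; the 4
    comes from the width 4 \<delta> of the bump.\<close>
  define \<epsilon> where "\<epsilon> = H * h / (2 * (4 + h * Q))"
  have den: "0 < 4 + h * Q" using h Q by (simp add: add_pos_pos)
  have \<epsilon>: "\<epsilon> > 0" using H h den by (simp add: \<epsilon>_def)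
  obtain x1 where x1: "x1 < c" "p - \<epsilon> \<le> M x1 T" using left_lim[OF \<epsilon>] by blast
  have "eventually (\<lambda>x. M x T < q + \<epsilon>) (at_right c)"
    by (rule order_tendstoD(2)[OF M_right_cont]) (use right \<epsilon> in simp)
  then obtain y1 where y1: "c < y1" "\<And>x. c < x \<Longrightarrow> x < y1 \<Longrightarrow> M x T < q + \<epsilon>"
    by (auto simp: eventually_at_right_field)
  obtain \<delta>1 where \<delta>1: "\<delta>1 > 0" "\<And>x y t. t \<le> T \<Longrightarrow> \<bar>x\<bar> \<le> \<bar>c\<bar> + 1 \<Longrightarrow> \<bar>y\<bar> \<le> \<bar>c\<bar> + 1 \<Longrightarrow>
      \<bar>x - y\<bar> < \<delta>1 \<Longrightarrow> \<bar>V x t - V y t\<bar> \<le> \<epsilon>"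
    using V_equicontinuous[OF \<epsilon>, of T "\<bar>c\<bar> + 1"] by metis
  \<comment> \<open>The bounds keep c - 3 \<delta> right of x1 and c + 3 \<delta> left of y1, keep V
    within \<epsilon> of its value at c on the plateau of the bump and that plateau within distance
    1 of c, and make the initial time T - h \<delta> nonnegative.\<close>
  define \<delta> where "\<delta> = min (min ((c - x1) / 3) ((y1 - c) / 4)) (min (min (\<delta>1 / 2) 1) (T / h))"
  have \<delta>: "\<delta> > 0" using x1 y1 \<delta>1 T h by (simp add: \<delta>_def)
  have \<delta>le: "3 * \<delta> \<le> c - x1" "4 * \<delta> \<le> y1 - c" "2 * \<delta> \<le> \<delta>1" "\<delta> \<le> 1" "\<delta> \<le> T / h"
  proof -
    have "\<delta> \<le> (c - x1) / 3" "\<delta> \<le> (y1 - c) / 4" "\<delta> \<le> \<delta>1 / 2" "\<delta> \<le> 1" "\<delta> \<le> T / h"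
      unfolding \<delta>_def min_le_iff_disj by blast+
    then show "3 * \<delta> \<le> c - x1" "4 * \<delta> \<le> y1 - c" "2 * \<delta> \<le> \<delta>1" "\<delta> \<le> 1" "\<delta> \<le> T / h"
      by simp_all
  qed
  define s where "s = T - h * \<delta>"
  have s: "0 \<le> s" "s \<le> T" using \<delta>le(5) h \<delta> by (simp_all add: s_def field_simps)
  have travel: "L * (T - t) \<le> \<delta> / 2" if "s \<le> t" "t \<le> T" for t
  proof -
    have "L * (T - t) \<le> L * (h * \<delta>)" using that L(1) by (intro mult_left_mono) (auto simp: s_def)
    also have "\<dots> \<le> 1/2 * \<delta>" using mult_right_mono[OF h(2), of \<delta>] \<delta> by (simp add: mult.assoc)
    finally show ?thesis by simp
  qed
  \<comment> \<open>Comparison with time T costs a shift of at most \<delta> / 2. So during the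
    whole window M is at most p left of c - \<delta>, at least q right of c + \<delta>, and within
    \<epsilon> of [p, q] on all of [c - 2 \<delta>, c + 2 \<delta>].\<close>
  have Mleft: "M x t \<le> p" if "s \<le> t" "t \<le> T" "x \<le> c - \<delta>" for x t
    using L(2)[of t T x] left[of "x + L * (T - t)"] travel[OF that(1,2)] that s \<delta> by simp
  have Mright: "q \<le> M x t" if "s \<le> t" "t \<le> T" "c + \<delta> \<le> x" for x t
    using L(3)[of t T c x] travel[OF that(1,2)] that s \<delta> right by simp
  have Mlow: "p - \<epsilon> \<le> M x t" if "s \<le> t" "t \<le> T" "c - 2 * \<delta> \<le> x" for x t
  proof -
    have "p - \<epsilon> \<le> M (c - 3 * \<delta>) T" using x1(2) M_mono[of x1 "c - 3 * \<delta>" T] \<delta>le(1) by simp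
    also have "\<dots> \<le> M x t" using L(3)[of t T "c - 3 * \<delta>" x] travel[OF that(1,2)] that s \<delta> by simp
    finally show ?thesis .
  qed
  have Mup: "M x t \<le> q + \<epsilon>" if "s \<le> t" "t \<le> T" "x \<le> c + 2 * \<delta>" for x t
  proof -
    have "M x t \<le> M (x + L * (T - t)) T" using L(2)[of t T x] that s by simp
    also have "\<dots> \<le> M (c + 3 * \<delta>) T" using travel[OF that(1,2)] that \<delta> by (intro M_mono) simp
    also have "\<dots> \<le> q + \<epsilon>" using y1(2)[of "c + 3 * \<delta>"] \<delta> \<delta>le(2) by simp
    finally show ?thesis .
  qed
  \<comment> \<open>The flanks are [c - 2 \<delta>, c - \<delta>] and
    [c + \<delta>, c + 2 \<delta>]; the plateau between them holds every level of (p, q) throughout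
    the window.\<close>
  define a where "a = c - 2 * \<delta>"
  define b where "b = c + \<delta>"
  have ab: "a \<le> b" using \<delta> by (simp add: a_def b_def)
  let ?\<chi>Y = "\<lambda>m t. bump \<delta> a b (Y m t + 0 * t)"
  let ?E = "ent \<kappa> \<alpha>" and ?mass = "ent_mass \<delta> a b 0 (ent \<kappa> \<alpha>)"
  define E0 where "E0 = ?E p"
  have Ep: "?E z = (1 - \<kappa>) * (\<alpha> - z)" if "z \<le> \<alpha>" for z using that by (simp add: ent_def)
  have Eq: "?E z = \<kappa> * (z - \<alpha>)" if "\<alpha> \<le> z" for z using that by (simp add: ent_def)
  have E0: "E0 = (1 - \<kappa>) * (\<alpha> - p)" "E0 = \<kappa> * (q - \<alpha>)"
    using \<alpha> bal by (simp_all add: E0_def Ep)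
  \<comment> \<open>Each flank is a unit mass on which M is within \<epsilon> of p or of q, so the
    flow is the flux at p minus the flux at q, up to LA \<epsilon> for each.\<close>
  have rate: "ent_rate \<delta> a b 0 (\<lambda>z. 0 * ?E z + ent_flux \<kappa> \<alpha> z) t \<le> - H + 2 * LA * \<epsilon>"
    if t: "s < t" "t < T" for t
  proof -
    let ?h = "\<lambda>a x. hump ((x - a) / \<delta>) / \<delta>"
    note hb = has_bochner_integral_scaled_hump[OF \<delta>]
    have fp: "ent_flux \<kappa> \<alpha> z = (1 - \<kappa>) * (flux_ext \<alpha> - flux_ext z)" if "z < \<alpha>" for z
      using that by (simp add: ent_flux_def)
    have fq: "ent_flux \<kappa> \<alpha> z = \<kappa> * (flux_ext z - flux_ext \<alpha>)" if "\<alpha> \<le> z" for z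
      using that by (simp add: ent_flux_def)
    have "ent_rate \<delta> a b 0 (\<lambda>z. 0 * ?E z + ent_flux \<kappa> \<alpha> z) t \<le>
      (LINT x|lborel. (ent_flux \<kappa> \<alpha> p + LA * \<epsilon>) * ?h a x - (ent_flux \<kappa> \<alpha> q - LA * \<epsilon>) * ?h b x)"
      unfolding ent_rate_def
    proof (rule integral_mono)
      show "integrable lborel (\<lambda>x. bump_deriv \<delta> a b (x + 0 * t) * (0 * ?E (M x t) + ent_flux \<kappa> \<alpha> (M x t)))"
        by (rule slice_integrable(2)[OF \<delta> ab _ rate_bound[OF \<delta> ab \<kappa> \<alpha>I, of _ 0]]) measurable
      show "integrable lborel (\<lambda>x. (ent_flux \<kappa> \<alpha> p + LA * \<epsilon>) * ?h a x - (ent_flux \<kappa> \<alpha> q - LA * \<epsilon>) * ?h b x)"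
        using hb[of a] hb[of b] unfolding has_bochner_integral_iff
        by (intro Bochner_Integration.integrable_diff integrable_mult_right) simp_all
      fix x
      have 1: "?h a x * ent_flux \<kappa> \<alpha> (M x t) \<le> ?h a x * (ent_flux \<kappa> \<alpha> p + LA * \<epsilon>)"
      proof (cases "a < x \<and> x < a + \<delta>")
        case True
        have M: "p - \<epsilon> \<le> M x t" "M x t \<le> p"
          using True t by (auto intro!: Mlow Mleft simp: a_def)
        have "flux_ext p - flux_ext (M x t) \<le> LA * \<epsilon>"
          using flux_ext_lip[of p "M x t"] mult_left_mono[OF _ LA_nonneg, of "\<bar>p - M x t\<bar>" \<epsilon>] M by simp
        then have "(1 - \<kappa>) * (flux_ext p - flux_ext (M x t)) \<le> 1 * (LA * \<epsilon>)"
          using \<kappa> \<epsilon> LA_nonneg by (intro order_trans[OF mult_left_mono mult_right_mono]) auto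
        then have "ent_flux \<kappa> \<alpha> (M x t) \<le> ent_flux \<kappa> \<alpha> p + LA * \<epsilon>"
          using M \<alpha> by (simp add: fp algebra_simps)
        then show ?thesis using \<delta> by (intro mult_left_mono) auto
      next
        case False
        then have "hump ((x - a) / \<delta>) = 0" using \<delta> by (intro hump_zero) (auto simp: field_simps divide_nonpos_pos)
        then show ?thesis by simp
      qed
      have 2: "?h b x * (ent_flux \<kappa> \<alpha> q - LA * \<epsilon>) \<le> ?h b x * ent_flux \<kappa> \<alpha> (M x t)"
      proof (cases "b < x \<and> x < b + \<delta>")
        case True
        have M: "M x t \<le> q + \<epsilon>" "q \<le> M x t"
          using True t by (auto intro!: Mup Mright simp: b_def)
        have "flux_ext q - flux_ext (M x t) \<le> LA * \<epsilon>"
          using flux_ext_lip[of q "M x t"] mult_left_mono[OF _ LA_nonneg, of "\<bar>q - M x t\<bar>" \<epsilon>] M by simp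
        then have "\<kappa> * (flux_ext q - flux_ext (M x t)) \<le> 1 * (LA * \<epsilon>)"
          using \<kappa> \<epsilon> LA_nonneg by (intro order_trans[OF mult_left_mono mult_right_mono]) auto
        then have "ent_flux \<kappa> \<alpha> q - LA * \<epsilon> \<le> ent_flux \<kappa> \<alpha> (M x t)"
          using M \<alpha> by (simp add: fq algebra_simps)
        then show ?thesis using \<delta> by (intro mult_left_mono) auto
      next
        case False
        then have "hump ((x - b) / \<delta>) = 0" using \<delta> by (intro hump_zero) (auto simp: field_simps divide_nonpos_pos)
        then show ?thesis by simp
      qed
      have "bump_deriv \<delta> a b (x + 0 * t) * (0 * ?E (M x t) + ent_flux \<kappa> \<alpha> (M x t)) =
          ?h a x * ent_flux \<kappa> \<alpha> (M x t) - ?h b x * ent_flux \<kappa> \<alpha> (M x t)"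
        by (simp add: bump_deriv_def diff_divide_distrib left_diff_distrib)
      then show "bump_deriv \<delta> a b (x + 0 * t) * (0 * ?E (M x t) + ent_flux \<kappa> \<alpha> (M x t)) \<le>
          (ent_flux \<kappa> \<alpha> p + LA * \<epsilon>) * ?h a x - (ent_flux \<kappa> \<alpha> q - LA * \<epsilon>) * ?h b x"
        using 1 2 by (simp only: mult.commute[of _ "?h a x"] mult.commute[of _ "?h b x"])
    qed
    also have "\<dots> = (ent_flux \<kappa> \<alpha> p + LA * \<epsilon>) * 1 - (ent_flux \<kappa> \<alpha> q - LA * \<epsilon>) * 1"
      by (intro has_bochner_integral_integral_eq has_bochner_integral_diff has_bochner_integral_mult_right hb)
    also have "\<dots> = - H + 2 * LA * \<epsilon>"
      using \<alpha> p q by (simp add: fp fq flux_ext_eq H_def algebra_simps)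
    finally show ?thesis .
  qed
  have Vbd: "\<bar>V (Y m t) t * ?\<chi>Y m t\<bar> \<le> C" if "t \<le> T" for m t
  proof -
    have "\<bar>V (Y m t) t * ?\<chi>Y m t\<bar> \<le> C * 1"
      unfolding abs_mult by (intro mult_mono C R that bump_abs_le \<delta> ab) auto
    then show ?thesis by simp
  qed
  have core: "\<bar>V (Y m t) t - V c t\<bar> \<le> \<epsilon>" "?\<chi>Y m t = 1"
    if t: "s < t" "t < T" and m: "p < m" "m < q" for m t
  proof -
    have mI: "-1/2 < m" "m < 1/2" using m p q by auto
    have "Y m t \<le> c + \<delta>" using Y_le_iff[OF mI] Mright[of t "c + \<delta>"] t m by simp
    moreover have "\<not> Y m t \<le> c - \<delta>" using Y_le_iff[OF mI] Mleft[of t "c - \<delta>"] t m by fastforce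
    ultimately have Y: "c - \<delta> \<le> Y m t" "Y m t \<le> c + \<delta>" by auto
    then show "?\<chi>Y m t = 1"
      by (intro bump_one[OF \<delta> ab]) (auto simp: a_def b_def)
    have "\<bar>Y m t\<bar> \<le> \<bar>c\<bar> + 1" "\<bar>Y m t - c\<bar> < \<delta>1" using Y \<delta>le \<delta> by linarith+
    then show "\<bar>V (Y m t) t - V c t\<bar> \<le> \<epsilon>" using \<delta>1(2)[of t "Y m t" c] t by simp
  qed
  \<comment> \<open>Levels in (\<alpha>, q) move with nearly V c t, those in [q, q + \<epsilon>]
    contribute at most C each, and higher ones lie beyond the bump. The bound \<open>lower\<close>
    is its mirror image.\<close>
  have upper: "transported \<delta> a b 0 \<alpha> (1/2) t \<le> (V c t + \<epsilon>) * (q - \<alpha>) + C * \<epsilon>"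
    if t: "s < t" "t < T" for t
  proof -
    have sub: "{\<alpha><..<1/2} \<subseteq> {-1/2<..<1/2}" using \<alpha>I by auto
    have "transported \<delta> a b 0 \<alpha> (1/2) t \<le>
      (LINT m|lborel. (V c t + \<epsilon>) * indicator {\<alpha><..<q} m + C * indicator {q..q + \<epsilon>} m)"
      unfolding transported_def set_lebesgue_integral_def
    proof (rule integral_mono)
      show "integrable lborel (\<lambda>m. indicator {\<alpha><..<1/2} m *\<^sub>R (V (Y m t) t * ?\<chi>Y m t))"
        using transported_integrand_integrable[OF \<delta> ab sub, of t 0] by (simp add: set_integrable_def)
      show "integrable lborel (\<lambda>m. (V c t + \<epsilon>) * indicator {\<alpha><..<q} m + C * indicator {q..q + \<epsilon>} m)"
        using \<alpha> by (intro Bochner_Integration.integrable_add integrable_mult_right integrable_real_indicator)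
          (auto simp: emeasure_lborel_Icc_eq)
      fix m
      consider "m \<notin> {\<alpha><..<1/2}" | "m \<in> {\<alpha><..<1/2}" "m < q" | "m \<in> {\<alpha><..<1/2}" "q \<le> m" "m \<le> q + \<epsilon>"
        | "m \<in> {\<alpha><..<1/2}" "q + \<epsilon> < m" by fastforce
      then show "indicator {\<alpha><..<1/2} m *\<^sub>R (V (Y m t) t * ?\<chi>Y m t)
          \<le> (V c t + \<epsilon>) * indicator {\<alpha><..<q} m + C * indicator {q..q + \<epsilon>} m"
      proof cases
        case 1
        then have "m \<notin> {\<alpha><..<q}" using q by auto
        then show ?thesis using 1 C(1) by (auto simp: indicator_def)
      next
        case 2
        then show ?thesis using core[OF t, of m] \<alpha> by (simp add: indicator_def)
      next
        case 3
        then show ?thesis using Vbd[of t m] t by (simp add: indicator_def)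
      next
        case 4
        then have "\<not> Y m t \<le> c + 2 * \<delta>" using Y_le_iff[of m t "c + 2 * \<delta>"] Mup[of t "c + 2 * \<delta>"] t \<alpha>I by auto
        then have "?\<chi>Y m t = 0" by (intro bump_zero[OF \<delta> ab]) (auto simp: b_def)
        then show ?thesis using 4 \<epsilon> by (simp add: indicator_def)
      qed
    qed
    also have "\<dots> = (V c t + \<epsilon>) * (q - \<alpha>) + C * \<epsilon>"
      using \<alpha> \<epsilon> by (subst Bochner_Integration.integral_add)
        (auto intro!: integrable_mult_right integrable_real_indicator simp: emeasure_lborel_Icc_eq)
    finally show ?thesis .
  qed
  have lower: "(V c t - \<epsilon>) * (\<alpha> - p) - C * \<epsilon> \<le> transported \<delta> a b 0 (-1/2) \<alpha> t"
    if t: "s < t" "t < T" for t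
  proof -
    have sub: "{-1/2<..<\<alpha>} \<subseteq> {-1/2<..<1/2}" using \<alpha>I by auto
    have "(V c t - \<epsilon>) * (\<alpha> - p) - C * \<epsilon> =
      (LINT m|lborel. (V c t - \<epsilon>) * indicator {p<..<\<alpha>} m - C * indicator {p - \<epsilon>..p} m)"
      using \<alpha> \<epsilon> by (subst Bochner_Integration.integral_diff)
        (auto intro!: integrable_mult_right integrable_real_indicator simp: emeasure_lborel_Icc_eq)
    also have "\<dots> \<le> transported \<delta> a b 0 (-1/2) \<alpha> t"
      unfolding transported_def set_lebesgue_integral_def
    proof (rule integral_mono)
      show "integrable lborel (\<lambda>m. indicator {-1/2<..<\<alpha>} m *\<^sub>R (V (Y m t) t * ?\<chi>Y m t))"
        using transported_integrand_integrable[OF \<delta> ab sub, of t 0] by (simp add: set_integrable_def)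
      show "integrable lborel (\<lambda>m. (V c t - \<epsilon>) * indicator {p<..<\<alpha>} m - C * indicator {p - \<epsilon>..p} m)"
        using \<alpha> by (intro Bochner_Integration.integrable_diff integrable_mult_right integrable_real_indicator)
          (auto simp: emeasure_lborel_Icc_eq)
      fix m
      consider "m \<notin> {-1/2<..<\<alpha>}" | "m \<in> {-1/2<..<\<alpha>}" "p < m" | "m \<in> {-1/2<..<\<alpha>}" "m \<le> p" "p - \<epsilon> \<le> m"
        | "m \<in> {-1/2<..<\<alpha>}" "m < p - \<epsilon>" by fastforce
      then show "(V c t - \<epsilon>) * indicator {p<..<\<alpha>} m - C * indicator {p - \<epsilon>..p} m
          \<le> indicator {-1/2<..<\<alpha>} m *\<^sub>R (V (Y m t) t * ?\<chi>Y m t)"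
      proof cases
        case 1
        then have "m \<notin> {p<..<\<alpha>}" using p by auto
        then show ?thesis using 1 C(1) by (auto simp: indicator_def)
      next
        case 2
        then show ?thesis using core[OF t, of m] \<alpha> by (simp add: indicator_def)
      next
        case 3
        then show ?thesis using Vbd[of t m] t by (simp add: indicator_def)
      next
        case 4
        then have "Y m t \<le> c - 2 * \<delta>" using Y_le_iff[of m t "c - 2 * \<delta>"] Mlow[of t "c - 2 * \<delta>"] t \<alpha>I by auto
        then have "?\<chi>Y m t = 0" by (intro bump_zero[OF \<delta> ab]) (auto simp: a_def)
        then show ?thesis using 4 \<epsilon> by (simp add: indicator_def)
      qed
    qed
    finally show ?thesis .
  qed
  have prod: "production \<kappa> \<alpha> \<delta> a b 0 t \<le> - H + Q * \<epsilon>" if t: "s < t" "t < T" for t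
  proof -
    have "\<kappa> * transported \<delta> a b 0 \<alpha> (1/2) t \<le> \<kappa> * ((V c t + \<epsilon>) * (q - \<alpha>) + C * \<epsilon>)"
      by (rule mult_left_mono[OF upper[OF t] \<kappa>(1)])
    moreover have "(1 - \<kappa>) * ((V c t - \<epsilon>) * (\<alpha> - p) - C * \<epsilon>) \<le> (1 - \<kappa>) * transported \<delta> a b 0 (-1/2) \<alpha> t"
      by (rule mult_left_mono[OF lower[OF t]]) (use \<kappa> in simp)
    moreover have "\<kappa> * ((V c t + \<epsilon>) * (q - \<alpha>) + C * \<epsilon>) - (1 - \<kappa>) * ((V c t - \<epsilon>) * (\<alpha> - p) - C * \<epsilon>) =
        V c t * (\<kappa> * (q - \<alpha>) - (1 - \<kappa>) * (\<alpha> - p)) + \<epsilon> * (\<kappa> * (q - \<alpha>) + (1 - \<kappa>) * (\<alpha> - p)) + C * \<epsilon>"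
      by (simp add: algebra_simps)
    moreover have "\<epsilon> * (\<kappa> * (q - \<alpha>) + (1 - \<kappa>) * (\<alpha> - p)) \<le> \<epsilon> * (\<kappa> * 1 + (1 - \<kappa>) * 1)"
      using \<epsilon> \<kappa> p q \<alpha> by (intro mult_left_mono add_mono) auto
    moreover have "V c t * (\<kappa> * (q - \<alpha>) - (1 - \<kappa>) * (\<alpha> - p)) = 0" using bal by simp
    moreover have "\<epsilon> * (\<kappa> * 1 + (1 - \<kappa>) * 1) = \<epsilon>" by simp
    moreover have "Q * \<epsilon> = 2 * LA * \<epsilon> + \<epsilon> + C * \<epsilon>" by (simp add: Q_def algebra_simps)
    ultimately show ?thesis
      unfolding production_def using rate[OF t] by linarith
  qed
  have diff: "?mass T - ?mass s \<le> (- H + Q * \<epsilon>) * (T - s)"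
    by (rule ent_mass_le[OF \<delta> ab \<kappa> \<alpha>I s prod])
  have i: "integrable lborel (\<lambda>x. bump \<delta> a b (x + 0 * t) * ?E (M x t))" for t
    by (rule slice_integrable(1)[OF \<delta> ab ent_measurable ent_bound[OF \<kappa> \<alpha>I]])
  \<comment> \<open>M(., T) takes no value in the open interval (p, q), and off this interval the
    entropy is at least E0.\<close>
  have ET: "E0 \<le> ?E (M x T)" for x
  proof (cases "x < c")
    case True
    then have "M x T \<le> p" by (rule left)
    then show ?thesis using \<alpha> \<kappa> unfolding E0(1) by (simp add: Ep mult_left_mono)
  next
    case False
    then have "q \<le> M x T" using M_mono[of c x T] right by simp
    then show ?thesis using \<alpha> \<kappa> unfolding E0(2) by (simp add: Eq mult_left_mono)
  qed
  \<comment> \<open>At time s values between p and q may occur, but there the entropy is at most E0;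
    the excess \<epsilon> is due to values just outside [p, q].\<close>
  have Es: "?E (M x s) \<le> E0 + \<epsilon>" if "a \<le> x" "x \<le> b + \<delta>" for x
  proof (cases "M x s \<le> \<alpha>")
    case True
    have "p - \<epsilon> \<le> M x s" using that s by (intro Mlow) (auto simp: a_def)
    then have "(1 - \<kappa>) * (\<alpha> - M x s) \<le> (1 - \<kappa>) * ((\<alpha> - p) + \<epsilon>)"
      using \<kappa> by (intro mult_left_mono) auto
    moreover have "(1 - \<kappa>) * \<epsilon> \<le> 1 * \<epsilon>" using \<kappa> \<epsilon> by (intro mult_right_mono) auto
    ultimately have "(1 - \<kappa>) * (\<alpha> - M x s) \<le> (1 - \<kappa>) * (\<alpha> - p) + \<epsilon>"
      unfolding distrib_left by linarith
    then show ?thesis using True by (simp add: Ep E0(1))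
  next
    case False
    have "M x s \<le> q + \<epsilon>" using that s by (intro Mup) (auto simp: b_def)
    then have "\<kappa> * (M x s - \<alpha>) \<le> \<kappa> * ((q - \<alpha>) + \<epsilon>)"
      using \<kappa> by (intro mult_left_mono) auto
    moreover have "\<kappa> * \<epsilon> \<le> 1 * \<epsilon>" using \<kappa> \<epsilon> by (intro mult_right_mono) auto
    ultimately have "\<kappa> * (M x s - \<alpha>) \<le> \<kappa> * (q - \<alpha>) + \<epsilon>"
      unfolding distrib_left by linarith
    then show ?thesis using False by (simp add: Eq E0(2))
  qed
  have "?mass s - ?mass T = (LINT x|lborel. bump \<delta> a b (x + 0 * s) * ?E (M x s) - bump \<delta> a b (x + 0 * T) * ?E (M x T))"
    unfolding ent_mass_def by (rule Bochner_Integration.integral_diff[symmetric, OF i i])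
  also have "\<dots> \<le> (LINT x|lborel. \<epsilon> * indicator {a..b + \<delta>} x)"
  proof (rule integral_mono)
    show "integrable lborel (\<lambda>x. bump \<delta> a b (x + 0 * s) * ?E (M x s) - bump \<delta> a b (x + 0 * T) * ?E (M x T))"
      by (intro Bochner_Integration.integrable_diff i)
    show "integrable lborel (\<lambda>x. \<epsilon> * indicator {a..b + \<delta>} x)"
      by (intro integrable_mult_right integrable_real_indicator) (auto simp: emeasure_lborel_Icc_eq)
    fix x
    show "bump \<delta> a b (x + 0 * s) * ?E (M x s) - bump \<delta> a b (x + 0 * T) * ?E (M x T) \<le> \<epsilon> * indicator {a..b + \<delta>} x"
    proof (cases "a \<le> x \<and> x \<le> b + \<delta>")
      case True
      have "bump \<delta> a b x * (?E (M x s) - ?E (M x T)) \<le> bump \<delta> a b x * \<epsilon>"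
        using Es[of x] ET[of x] True bump_nonneg[OF \<delta> ab, of x] by (intro mult_left_mono) auto
      also have "\<dots> \<le> 1 * \<epsilon>" using bump_le_1[OF \<delta> ab, of x] \<epsilon> by (intro mult_right_mono) auto
      finally show ?thesis using True by (simp add: right_diff_distrib)
    next
      case False
      then have "bump \<delta> a b x = 0" using bump_zero[OF \<delta> ab, of x] by force
      then show ?thesis using \<epsilon> by (simp add: indicator_def)
    qed
  qed
  also have "\<dots> = \<epsilon> * (4 * \<delta>)" using \<delta> ab by (simp add: a_def b_def)
  \<comment> \<open>Loss over the time h \<delta> against gain over the width 4 \<delta>: the factor
    \<delta> cancels and the choice of \<epsilon> gives the contradiction.\<close>
  finally have "0 \<le> (- H + Q * \<epsilon>) * (h * \<delta>) + \<epsilon> * (4 * \<delta>)" using diff by (simp add: s_def)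
  also have "\<dots> = \<delta> * (\<epsilon> * (4 + h * Q) - H * h)" by (simp add: algebra_simps)
  finally have "H * h \<le> \<epsilon> * (4 + h * Q)" using \<delta> by (simp add: zero_le_mult_iff)
  moreover have "\<epsilon> * (4 + h * Q) = H * h / 2" using den by (simp add: \<epsilon>_def field_simps)
  ultimately show False using H h by (simp add: mult_pos_pos)
qed

text \<open>A maximal interval of constancy of the quantile function is a jump of M: its levels
  share the position c, and maximality at either end identifies p as the left limit and q as the
  value of M(., T) at c.\<close>

lemma cluster_admissible:
  assumes T: "0 < T" and cl: "is_cluster_at (\<lambda>n. gen_inverse (\<lambda>x. M x T) n) m0 p q" and \<alpha>: "p < \<alpha>" "\<alpha> < q"
  shows "(q - \<alpha>) * A p + (\<alpha> - p) * A q \<le> (q - p) * A \<alpha>"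
proof -
  let ?X = "\<lambda>n. gen_inverse (\<lambda>x. M x T) n"
  have m0: "m0 \<in> {p<..q}" and sub: "{p<..q} \<subseteq> {-1/2<..1/2}" and "?X constant_on {p<..q}"
    and maximal: "\<And>a b. m0 \<in> {a<..b} \<Longrightarrow> {a<..b} \<subseteq> {-1/2<..1/2} \<Longrightarrow> ?X constant_on {a<..b} \<Longrightarrow> {a<..b} \<subseteq> {p<..q}"
    using cl unfolding is_cluster_at_def by blast+
  then obtain c where c: "\<And>n. n \<in> {p<..q} \<Longrightarrow> ?X n = c" unfolding constant_on_def by blast
  have pq: "p < q" using m0 by auto
  have q: "q \<le> 1/2" using sub pq by auto
  have p: "-1/2 \<le> p"
  proof (rule ccontr)
    assume "\<not> -1/2 \<le> p"
    then have "min (-1/2) q \<in> {p<..q}" using pq by auto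
    from subsetD[OF sub this] show False by simp
  qed
  have X_le: "?X n \<le> x \<longleftrightarrow> n \<le> M x T" if "-1/2 < n" "n < 1/2" for n x
    using real_distribution.gen_inverse_le_iff[OF rho that] by (simp add: M_eq)
  have left: "M x T \<le> p" if "x < c" for x
  proof (rule ccontr)
    assume "\<not> M x T \<le> p"
    then obtain n where n: "p < n" "n < min (M x T) q" using dense[of p "min (M x T) q"] pq by auto
    then have "?X n \<le> x" using X_le[of n x] p q by simp
    then show False using c[of n] n that by simp
  qed
  \<comment> \<open>The Galois connection needs levels below 1/2, so q, which may equal 1/2, is
    approached from below.\<close>
  have "q \<le> M c T"
  proof (rule dense_le_bounded[OF pq])
    fix n assume n: "p < n" "n < q"
    then show "n \<le> M c T" using X_le[of n c] c[of n] p q by simp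
  qed
  moreover have "M c T \<le> q"
  proof (rule ccontr)
    assume "\<not> M c T \<le> q"
    \<comment> \<open>Levels between q and M c T would have the quantile c too, so the cluster could
      be enlarged up to b. The midpoint stays below 1/2.\<close>
    define b where "b = (q + M c T) / 2"
    have b: "q < b" "b < M c T" "b < 1/2" using \<open>\<not> M c T \<le> q\<close> M_range[of c T] by (auto simp: b_def)
    have "?X n = c" if n: "n \<in> {p<..b}" for n
    proof (cases "n \<le> q")
      case True
      then show ?thesis using c n by simp
    next
      case False
      then have nI: "-1/2 < n" "n < 1/2" "q < n" using n b p pq by auto
      have qI: "-1/2 < q" "q < 1/2" using nI p pq by auto
      have "n \<le> M (?X n) T" using X_le[OF nI(1,2), of "?X n"] by simp
      then have "c \<le> ?X n" using X_le[OF qI, of "?X n"] c[of q] nI pq by simp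
      moreover have "?X n \<le> c" using X_le[OF nI(1,2), of c] n b by simp
      ultimately show ?thesis by simp
    qed
    then have "?X constant_on {p<..b}" unfolding constant_on_def by blast
    then have "{p<..b} \<subseteq> {p<..q}" using m0 b p by (intro maximal) auto
    then show False using b pq by (auto dest: subsetD[of _ _ b])
  qed
  ultimately have right: "M c T = q" by simp
  have left_lim: "\<exists>x<c. p - \<epsilon> \<le> M x T" if "\<epsilon> > 0" for \<epsilon>
  proof (rule ccontr)
    assume "\<not> (\<exists>x<c. p - \<epsilon> \<le> M x T)"
    \<comment> \<open>If M(., T) stayed below p - \<epsilon> left of c, the levels in (p -
      \<epsilon>, p] would also sit at c and enlarge the cluster.\<close>
    then have lt: "M x T < p - \<epsilon>" if "x < c" for x using that by force
    have pe: "-1/2 < p - \<epsilon>" using lt[of "c - 1"] M_range[of "c - 1" T] by simp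
    have "?X n = c" if n: "n \<in> {p - \<epsilon><..q}" for n
    proof (cases "p < n")
      case True
      then show ?thesis using c n by simp
    next
      case False
      then have nI: "-1/2 < n" "n < 1/2" using n pe pq q by auto
      have "\<not> ?X n < c" using lt[of "?X n"] X_le[OF nI, of "?X n"] n by auto
      moreover have "?X n \<le> c" using X_le[OF nI, of c] right n by simp
      ultimately show ?thesis by simp
    qed
    then have "?X constant_on {p - \<epsilon><..q}" unfolding constant_on_def by blast
    then have "{p - \<epsilon><..q} \<subseteq> {p<..q}" using m0 that pe q by (intro maximal) auto
    then have "p \<in> {p<..q}" using that pq by (auto dest: subsetD[of _ _ p])
    then show False by simp
  qed
  show ?thesis by (rule shock_admissible[OF T p q \<alpha> left left_lim right])
qed

end

section \<open>The flux\<close>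

text \<open>The kernel may be unbounded at 0, so continuity rests on local integrability: near x the
  primitive is, up to a constant, an indefinite integral with the fixed base point -N.\<close>

lemma primitive_continuous:
  assumes "interaction_kernel \<phi>"
  shows "continuous_on UNIV (primitive \<phi>)"
proof -
  have int: "set_integrable lborel {a..b} \<phi>" for a b
    using assms by (auto simp: interaction_kernel_def)
  have ii: "interval_lebesgue_integrable lborel (ereal a) (ereal b) \<phi>" if "a \<le> b" for a b
  proof -
    have "set_integrable lborel {a<..<b} \<phi>" by (rule set_integrable_subset[OF int[of a b]]) auto
    then show ?thesis using that by (simp add: interval_lebesgue_integrable_def)
  qed
  have "isCont (primitive \<phi>) x" for x
  proof -
    define N where "N = \<bar>x\<bar> + 1"
    have eq: "primitive \<phi> y = integral {-N..y} \<phi> - integral {-N..0} \<phi>" if "y \<in> {-N..N}" for y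
    proof -
      have "interval_lebesgue_integrable lborel (min (ereal (-N)) (min 0 (ereal y))) (max (ereal (-N)) (max 0 (ereal y))) \<phi>"
      proof -
        have "interval_lebesgue_integrable lborel (ereal (-N)) (ereal (max 0 y)) \<phi>"
          by (rule ii) (simp add: N_def)
        moreover have "min (ereal (-N)) (min 0 (ereal y)) = ereal (-N)" "max (ereal (-N)) (max 0 (ereal y)) = ereal (max 0 y)"
          using that by (auto simp: N_def min_def max_def zero_ereal_def)
        ultimately show ?thesis by simp
      qed
      from interval_integral_sum[OF this]
      have "(LBINT r=-N..0. \<phi> r) + primitive \<phi> y = (LBINT r=-N..y. \<phi> r)"
        by (simp add: primitive_def)
      moreover have "(LBINT r=-N..0. \<phi> r) = integral {-N..0} \<phi>"
        using interval_integral_eq_integral[of "-N" 0 \<phi>] int by (simp add: N_def zero_ereal_def)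
      moreover have "(LBINT r=-N..y. \<phi> r) = integral {-N..y} \<phi>"
        using that int by (intro interval_integral_eq_integral) auto
      ultimately show ?thesis by simp
    qed
    have "\<phi> integrable_on {-N..N}" using set_borel_integral_eq_integral(1)[OF int] .
    then have "continuous_on {-N..N} (\<lambda>y. integral {-N..y} \<phi> - integral {-N..0} \<phi>)"
      by (intro continuous_intros indefinite_integral_continuous_1)
    then have "continuous_on {-N..N} (primitive \<phi>)"
      by (rule continuous_on_eq) (simp add: eq)
    then show ?thesis
      by (rule continuous_on_interior) (simp add: N_def interior_atLeastAtMost_real, arith)
  qed
  then show ?thesis by (simp add: continuous_on_eq_continuous_at)
qed

context
  fixes \<phi> u0 :: "real \<Rightarrow> real" and \<rho>0 :: "real measure"
  assumes \<phi>: "interaction_kernel \<phi>" and \<rho>0: "real_distribution \<rho>0"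
    and cs: "compactly_supported \<rho>0" and u0: "L_infinity \<rho>0 u0"
begin

interpretation real_distribution \<rho>0 by (rule \<rho>0)

abbreviation "\<psi>X n \<equiv> initial_psi \<phi> \<rho>0 u0 (gen_inverse (shifted_cdf \<rho>0) n)"

lemma u0_measurable [measurable]: "u0 \<in> borel_measurable borel"
  using u0 by (simp add: L_infinity_def measurable_cong_sets[OF events_eq_borel refl])

lemma initial_psi_measurable [measurable]: "initial_psi \<phi> \<rho>0 u0 \<in> borel_measurable borel"
proof -
  have [measurable]: "primitive \<phi> \<in> borel_measurable borel"
    by (rule borel_measurable_continuous_onI[OF primitive_continuous[OF \<phi>]])
  have "(\<lambda>x. \<integral>y. primitive \<phi> (x - y) \<partial>\<rho>0) \<in> borel_measurable borel"
    by measurable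
  then show ?thesis unfolding initial_psi_def[abs_def] conv_measure_def by measurable
qed

lemma gen_inverse_measurable_lborel [measurable]:
  "gen_inverse (shifted_cdf \<rho>0) \<in> measurable (restrict_space lborel {-1/2<..<1/2}) borel"
  using gen_inverse_measurable[OF order_refl]
  by (simp add: measurable_cong_sets[OF sets_restrict_space_cong[OF sets_lborel] refl])

lemma initial_support: obtains R where "R > 0" "emeasure \<rho>0 (- {-R..R}) = 0"
proof -
  obtain K where K: "compact K" "emeasure \<rho>0 (- K) = 0"
    using cs by (auto simp: compactly_supported_def)
  obtain R where R: "R > 0" "\<And>x. x \<in> K \<Longrightarrow> norm x \<le> R"
    using compact_imp_bounded[OF K(1)] unfolding bounded_pos by blast
  have "emeasure \<rho>0 (- {-R..R}) \<le> emeasure \<rho>0 (- K)"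
    using R K(1) by (intro emeasure_mono) (auto simp: abs_le_iff compact_imp_closed intro!: borel_closed dest!: R(2))
  then show ?thesis using K R that by auto
qed

text \<open>u0 is bounded only almost everywhere in \<rho>0, and the quantile transform carries this
  to almost every level. The convolution involves only differences of points of [-R, R], hence the
  primitive on [-2 R, 2 R].\<close>

lemma psi_gen_inverse_bounded:
  obtains C where "C \<ge> 0"
    "AE n in lborel. n \<in> {-1/2<..<1/2} \<longrightarrow> \<bar>\<psi>X n\<bar> \<le> C"
proof -
  let ?X = "gen_inverse (shifted_cdf \<rho>0)"
  obtain Cu where Cu: "AE x in \<rho>0. \<bar>u0 x\<bar> \<le> Cu" using u0 by (auto simp: L_infinity_def)
  have distr: "\<rho>0 = distr (restrict_space lborel {-1/2<..<1/2}) borel ?X"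
  proof (rule distr_gen_inverse)
    show "cdf \<rho>0 x = max (min (shifted_cdf \<rho>0 x) (1/2) - (-1/2)) 0" for x
      using shifted_cdf_range[of x] shifted_cdf_eq[of x] by linarith
  qed (use finite_borel_measure_M in auto)
  have "AE n in restrict_space lborel {-1/2<..<1/2}. \<bar>u0 (?X n)\<bar> \<le> Cu"
    using Cu by (subst (asm) distr, subst (asm) AE_distr_iff[OF gen_inverse_measurable_lborel]) auto
  then have AEu: "AE n in lborel. n \<in> {-1/2<..<1/2} \<longrightarrow> \<bar>u0 (?X n)\<bar> \<le> Cu"
    by (simp add: AE_restrict_space_iff)
  obtain R where R: "R > 0" "emeasure \<rho>0 (- {-R..R}) = 0" by (rule initial_support)
  have cont: "continuous_on {-(2*R)..2*R} (primitive \<phi>)"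
    using primitive_continuous[OF \<phi>] continuous_on_subset by blast
  obtain B where B: "B \<ge> 0" "\<And>x. x \<in> {-(2*R)..2*R} \<Longrightarrow> \<bar>primitive \<phi> x\<bar> \<le> B"
    using continuous_on_Icc_bounded[OF cont] by metis
  have AER: "AE y in \<rho>0. y \<in> {-R..R}"
    by (rule AE_I[of _ _ "- {-R..R}"]) (use R in auto)
  have conv: "\<bar>conv_measure (primitive \<phi>) \<rho>0 x\<bar> \<le> B" if "x \<in> {-R..R}" for x
  proof -
    have "\<bar>conv_measure (primitive \<phi>) \<rho>0 x\<bar> \<le> (\<integral>y. B \<partial>\<rho>0)"
      unfolding conv_measure_def real_norm_def[symmetric]
    proof (rule order_trans[OF integral_norm_bound], rule integral_mono_AE')
      show "AE y in \<rho>0. norm (primitive \<phi> (x - y)) \<le> B"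
        using AER by eventually_elim (use that B in auto)
    qed (use B in auto)
    then show ?thesis using prob_space by simp
  qed
  show ?thesis
  proof
    show "0 \<le> max 0 Cu + B" using B by simp
    show "AE n in lborel. n \<in> {-1/2<..<1/2} \<longrightarrow> \<bar>initial_psi \<phi> \<rho>0 u0 (?X n)\<bar> \<le> max 0 Cu + B"
      using AEu
    proof eventually_elim
      case (elim n)
      show ?case
      proof
        assume n: "n \<in> {-1/2<..<1/2}"
        then have "?X n \<in> {-R..R}" using gen_inverse_support[OF R(2)] by simp
        from conv[OF this] elim n show "\<bar>initial_psi \<phi> \<rho>0 u0 (?X n)\<bar> \<le> max 0 Cu + B"
          unfolding initial_psi_def by linarith
      qed
    qed
  qed
qed

lemma psi_set_integrable:
  assumes "{x<..<y} \<subseteq> {-1/2<..<1/2}"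
  shows "set_integrable lborel {x<..<y} (\<lambda>n. \<psi>X n)"
proof -
  let ?G = "\<psi>X"
  obtain C where C: "C \<ge> 0" "AE n in lborel. n \<in> {-1/2<..<1/2} \<longrightarrow> \<bar>?G n\<bar> \<le> C"
    using psi_gen_inverse_bounded by metis
  have "?G \<in> borel_measurable (restrict_space lborel {-1/2<..<1/2})" by measurable
  then have meas: "(\<lambda>n. indicator {-1/2<..<1/2} n *\<^sub>R ?G n) \<in> borel_measurable lborel"
    by (subst (asm) borel_measurable_restrict_space_iff) auto
  have "set_integrable lborel {-1/2<..<1/2} ?G"
    unfolding set_integrable_def
    by (rule integrableI_bounded_set[where A="{-1/2<..<1/2}" and B=C])
       (use C(2) meas in \<open>auto elim!: eventually_mono\<close>)
  then show ?thesis by (rule set_integrable_subset) (use assms in auto)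
qed

lemma flux_diff:
  assumes "-1/2 \<le> x" "x \<le> y" "y \<le> 1/2"
  shows "flux \<phi> \<rho>0 u0 y - flux \<phi> \<rho>0 u0 x =
    (LINT n:{x<..<y}|lborel. \<psi>X n)"
proof -
  let ?G = "\<psi>X"
  have "interval_lebesgue_integrable lborel (min (ereal (-1/2)) (min (ereal x) (ereal y))) (max (ereal (-1/2)) (max (ereal x) (ereal y))) ?G"
  proof -
    have "interval_lebesgue_integrable lborel (ereal (-1/2)) (ereal y) ?G"
    proof -
      have "{-1/2<..<y} \<subseteq> {-1/2<..<1/2}" using assms by auto
      from psi_set_integrable[OF this] show ?thesis
        using assms by (simp add: interval_lebesgue_integrable_def)
    qed
    moreover have "min (ereal (-1/2)) (min (ereal x) (ereal y)) = ereal (-1/2)" "max (ereal (-1/2)) (max (ereal x) (ereal y)) = ereal y"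
      using assms by (auto simp: min_def max_def)
    ultimately show ?thesis by simp
  qed
  from interval_integral_sum[OF this]
  have "flux \<phi> \<rho>0 u0 x + (LBINT n=x..y. ?G n) = flux \<phi> \<rho>0 u0 y" by (simp add: flux_def)
  moreover have "(LBINT n=x..y. ?G n) = (LINT n:{x<..<y}|lborel. ?G n)"
    using assms by (simp add: interval_lebesgue_integral_def)
  ultimately show ?thesis by simp
qed

lemma flux_lipschitz:
  obtains LA where "LA \<ge> 0"
    "\<And>x y. x \<in> {-1/2..1/2} \<Longrightarrow> y \<in> {-1/2..1/2} \<Longrightarrow>
       \<bar>flux \<phi> \<rho>0 u0 x - flux \<phi> \<rho>0 u0 y\<bar> \<le> LA * \<bar>x - y\<bar>"
proof -
  let ?G = "\<psi>X"
  obtain C where C: "C \<ge> 0" "AE n in lborel. n \<in> {-1/2<..<1/2} \<longrightarrow> \<bar>?G n\<bar> \<le> C"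
    using psi_gen_inverse_bounded by metis
  have le: "\<bar>flux \<phi> \<rho>0 u0 y - flux \<phi> \<rho>0 u0 x\<bar> \<le> C * (y - x)" if "-1/2 \<le> x" "x \<le> y" "y \<le> 1/2" for x y
  proof -
    have "\<bar>LINT n|lborel. indicator {x<..<y} n *\<^sub>R ?G n\<bar> \<le> (LINT n|lborel. indicator {x<..<y} n *\<^sub>R C)"
      unfolding real_norm_def[symmetric]
    proof (rule order_trans[OF integral_norm_bound], rule integral_mono_AE')
      show "AE n in lborel. norm (indicator {x<..<y} n *\<^sub>R ?G n) \<le> indicator {x<..<y} n *\<^sub>R C"
        using C(2) by eventually_elim (use that in \<open>auto simp: indicator_def\<close>)
    qed (use C that in auto)
    then show ?thesis using that flux_diff[OF that] by (simp add: set_lebesgue_integral_def mult.commute)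
  qed
  show ?thesis
  proof
    show "C \<ge> 0" by fact
    show "\<bar>flux \<phi> \<rho>0 u0 x - flux \<phi> \<rho>0 u0 y\<bar> \<le> C * \<bar>x - y\<bar>" if "x \<in> {-1/2..1/2}" "y \<in> {-1/2..1/2}" for x y
      using le[of x y] le[of y x] that by (cases "x \<le> y") (auto simp: abs_minus_commute)
  qed
qed

text \<open>All these levels share the initial position c, so the integrand that defines the flux is
  constant on them.\<close>

lemma flux_affine_on_initial_cluster:
  assumes "-1/2 \<le> p" "q \<le> 1/2" and const: "\<And>n. n \<in> {p<..q} \<Longrightarrow> gen_inverse (shifted_cdf \<rho>0) n = c"
    and "p \<le> x" "x \<le> y" "y \<le> q"
  shows "flux \<phi> \<rho>0 u0 y - flux \<phi> \<rho>0 u0 x = initial_psi \<phi> \<rho>0 u0 c * (y - x)"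
proof -
  have "flux \<phi> \<rho>0 u0 y - flux \<phi> \<rho>0 u0 x =
     (LINT n:{x<..<y}|lborel. \<psi>X n)"
    using assms by (intro flux_diff) auto
  also have "\<dots> = (LINT n:{x<..<y}|lborel. initial_psi \<phi> \<rho>0 u0 c)"
    by (rule set_lebesgue_integral_cong) (use assms in auto)
  also have "\<dots> = initial_psi \<phi> \<rho>0 u0 c * (y - x)"
    using assms by (simp add: set_lebesgue_integral_def)
  finally show ?thesis .
qed

end

section \<open>Extension of an entropy solution to negative times\<close>

lemma entropy_solution_flow:
  assumes \<Phi>: "continuous_on UNIV \<Phi>" and LA: "LA \<ge> 0"
    "\<And>x y. x \<in> {-1/2..1/2} \<Longrightarrow> y \<in> {-1/2..1/2} \<Longrightarrow> \<bar>A x - A y\<bar> \<le> LA * \<bar>x - y\<bar>"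
    and sol: "entropy_solution \<Phi> A M0 M"
  obtains \<rho> where "entropy_flow \<Phi> A \<rho> (\<lambda>x t. M x (max 0 t)) LA"
proof -
  obtain \<rho> where 1: "\<forall>t\<ge>0. real_distribution (\<rho> t) \<and> (\<forall>x. M x t = shifted_cdf (\<rho> t) x)"
    and 2: "\<forall>S. \<exists>R. \<forall>t\<in>{0..S}. emeasure (\<rho> t) (- {-R..R}) = 0"
    and 3: "\<forall>t\<ge>0. integrable lborel (\<lambda>x. M x t - M0 x)"
    and 4: "\<forall>s\<ge>0. ((\<lambda>t. LINT x|lborel. \<bar>(M x t - M0 x) - (M x s - M0 x)\<bar>) \<longlongrightarrow> 0) (at s within {0..})"
    and 5: "\<forall>\<alpha>\<in>{-1/2..1/2}. entropy_inequality \<Phi> A \<rho> M \<alpha>"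
    using sol unfolding entropy_solution_def by (elim exE conjE) (rule that)
  note \<rho> = conjunct1[OF 1[rule_format]] conjunct2[OF 1[rule_format], rule_format]
  note supp = 2[rule_format] and int = 3[rule_format] and cont = 4[rule_format] and ent = 5[rule_format]
  \<comment> \<open>Clamping the time at 0 turns the one-sided continuity at 0 into a two-sided one
    and leaves positive times, the only ones that the entropy inequality sees, unchanged.\<close>
  let ?M = "\<lambda>x t. M x (max 0 t)" and ?\<rho> = "\<lambda>t. \<rho> (max 0 t)"
  have "entropy_flow \<Phi> A ?\<rho> ?M LA"
  proof (rule entropy_flow.intro)
    show "real_distribution (?\<rho> t)" for t by (rule \<rho>(1)) simp
    show "?M x t = shifted_cdf (?\<rho> t) x" for x t by (rule \<rho>(2)) simp
    show "\<exists>R. \<forall>t\<le>S. emeasure (?\<rho> t) (- {-R..R}) = 0" for S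
      using supp[of "max 0 S"] by fastforce
    show "integrable lborel (\<lambda>x. ?M x t - ?M x s)" for t s
      using Bochner_Integration.integrable_diff[OF int[of "max 0 t"] int[of "max 0 s"]] by simp
    show "((\<lambda>t. LINT x|lborel. \<bar>?M x t - ?M x s\<bar>) \<longlongrightarrow> 0) (at s)" for s
    proof -
      define D where "D = (\<lambda>u. LINT x|lborel. \<bar>M x u - M x (max 0 s)\<bar>)"
      have "(D \<longlongrightarrow> 0) (at (max 0 s) within {0..})" using cont[of "max 0 s"] by (simp add: D_def)
      then have "((\<lambda>t. D (max 0 t)) \<longlongrightarrow> 0) (at s)"
        unfolding tendsto_iff eventually_at
      proof (intro allI impI)
        fix \<epsilon> :: real
        assume "\<epsilon> > 0" and D: "\<forall>e>0. \<exists>d>0. \<forall>x\<in>{0..}. x \<noteq> max 0 s \<and> dist x (max 0 s) < d \<longrightarrow> dist (D x) 0 < e"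
        then obtain d where d: "d > 0" "\<And>x. x \<ge> 0 \<Longrightarrow> x \<noteq> max 0 s \<Longrightarrow> dist x (max 0 s) < d \<Longrightarrow> dist (D x) 0 < \<epsilon>"
          by (metis atLeast_iff)
        have "dist (D (max 0 t)) 0 < \<epsilon>" if "dist t s < d" for t
        \<comment> \<open>If clamping identifies t and s, the punctured limit says nothing, but then
          the distance is 0.\<close>
        proof (cases "max 0 t = max 0 s")
          case True
          then show ?thesis using \<open>\<epsilon> > 0\<close> by (simp add: D_def)
        next
          case False
          have "dist (max 0 t) (max 0 s) < d" using that by (auto simp: dist_real_def max_def)
          then show ?thesis using d(2)[of "max 0 t"] False by simp
        qed
        then show "\<exists>d>0. \<forall>x\<in>UNIV. x \<noteq> s \<and> dist x s < d \<longrightarrow> dist (D (max 0 x)) 0 < \<epsilon>"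
          using d(1) by blast
      qed
      then show ?thesis by (simp add: D_def)
    qed
    show "entropy_inequality \<Phi> A ?\<rho> ?M \<alpha>" if "\<alpha> \<in> {-1/2..1/2}" for \<alpha>
      unfolding entropy_inequality_def
    proof (intro allI impI)
      fix \<eta> assume "nonneg_test_function \<eta>"
      moreover have "(LINT (x, t) : UNIV \<times> {0<..} | lborel. \<bar>?M x t - \<alpha>\<bar> * partial_t \<eta> (x, t)
             + sgn (?M x t - \<alpha>) * (A (?M x t) - A \<alpha>) * partial_x \<eta> (x, t)) =
          (LINT (x, t) : UNIV \<times> {0<..} | lborel. \<bar>M x t - \<alpha>\<bar> * partial_t \<eta> (x, t)
             + sgn (M x t - \<alpha>) * (A (M x t) - A \<alpha>) * partial_x \<eta> (x, t))"
        unfolding set_lebesgue_integral_def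
        by (intro Bochner_Integration.integral_cong refl) (auto simp: indicator_def)
      moreover have "(LINT t : {0<..} | lborel.
             integral_deriv_abs (\<lambda>x. ?M x t) \<alpha> (\<lambda>x. conv_measure \<Phi> (?\<rho> t) x * \<eta> (x, t))) =
          (LINT t : {0<..} | lborel.
             integral_deriv_abs (\<lambda>x. M x t) \<alpha> (\<lambda>x. conv_measure \<Phi> (\<rho> t) x * \<eta> (x, t)))"
        unfolding set_lebesgue_integral_def
        by (intro Bochner_Integration.integral_cong refl) (auto simp: indicator_def)
      ultimately show "- (LINT (x, t) : UNIV \<times> {0<..} | lborel. \<bar>?M x t - \<alpha>\<bar> * partial_t \<eta> (x, t)
             + sgn (?M x t - \<alpha>) * (A (?M x t) - A \<alpha>) * partial_x \<eta> (x, t))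
        \<le> (LINT t : {0<..} | lborel.
             integral_deriv_abs (\<lambda>x. ?M x t) \<alpha> (\<lambda>x. conv_measure \<Phi> (?\<rho> t) x * \<eta> (x, t)))"
        using ent[OF that] unfolding entropy_inequality_def by simp
    qed
  qed (use \<Phi> LA in auto)
  then show ?thesis by (rule that)
qed

section \<open>The convex envelope and the theorem\<close>

lemma convex_on_three_points:
  fixes f :: "real \<Rightarrow> real"
  assumes "convex_on S f" "p \<in> S" "q \<in> S" "p < x" "x < q"
  shows "(q - p) * f x \<le> (q - x) * f p + (x - p) * f q"
proof -
  define u where "u = (q - x) / (q - p)"
  define v where "v = (x - p) / (q - p)"
  have uv: "0 \<le> u" "0 \<le> v" "u + v = 1"
    using assms by (simp_all add: u_def v_def add_divide_distrib[symmetric])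
  have uq: "(q - p) * u = q - x" "(q - p) * v = x - p" using assms by (simp_all add: u_def v_def)
  have "(q - p) * (u * p + v * q) = (q - p) * x"
    using uq by (simp add: distrib_left mult.assoc[symmetric]) (simp add: algebra_simps)
  then have "u * p + v * q = x" using assms by simp
  then have "f x \<le> u * f p + v * f q"
    using assms(1-3) uv unfolding convex_on_def by (metis real_scaleR_def)
  then have "(q - p) * f x \<le> (q - p) * (u * f p + v * f q)" using assms by (intro mult_left_mono) auto
  also have "\<dots> = (q - x) * f p + (x - p) * f q" by (simp add: distrib_left mult.assoc[symmetric] uq)
  finally show ?thesis .
qed

text \<open>Each convex minorant satisfies the chord inequality, its end values lie below those of
  the envelope, and the supremum over all minorants preserves this. The lower bound B supplies a
  constant minorant, so that the supremum is over a nonempty set.\<close>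

lemma lower_convex_envelope_three_points:
  fixes f :: "real \<Rightarrow> real"
  assumes bdd: "\<And>y. y \<in> S \<Longrightarrow> B \<le> f y" and S: "convex S" "p \<in> S" "q \<in> S" "p < x" "x < q"
  shows "(q - p) * lower_convex_envelope S f x \<le>
      (q - x) * lower_convex_envelope S f p + (x - p) * lower_convex_envelope S f q"
    and "lower_convex_envelope S f p \<le> f p"
    and "lower_convex_envelope S f q \<le> f q"
proof -
  let ?E = "lower_convex_envelope S f"
  let ?G = "\<lambda>x. {g x | g. convex_on S g \<and> (\<forall>y\<in>S. g y \<le> f y)}"
  have ne: "?G y \<noteq> {}" for y using bdd S(1) by (auto intro!: exI[of _ "\<lambda>_. B"] simp: convex_on_def distrib_right[symmetric])
  have upper: "g y \<le> ?E y" if "convex_on S g" "\<forall>y\<in>S. g y \<le> f y" "y \<in> S" for g y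
    unfolding lower_convex_envelope_def by (rule cSup_upper) (use that in \<open>auto intro!: bdd_aboveI[of _ "f y"]\<close>)
  show "?E p \<le> f p" "?E q \<le> f q"
    unfolding lower_convex_envelope_def by (rule cSup_least[OF ne]; use S in auto)+
  have "?E x \<le>
     ((q - x) * ?E p + (x - p) * ?E q) / (q - p)"
    unfolding lower_convex_envelope_def[of S f x]
  proof (rule cSup_least[OF ne])
    fix z assume "z \<in> ?G x"
    then obtain g where g: "z = g x" "convex_on S g" "\<forall>y\<in>S. g y \<le> f y" by blast
    have "(q - p) * g x \<le> (q - x) * g p + (x - p) * g q"
      by (rule convex_on_three_points[OF g(2) S(2-5)])
    also have "\<dots> \<le> (q - x) * ?E p + (x - p) * ?E q"
      using upper[OF g(2,3)] S by (intro add_mono mult_left_mono) auto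
    finally show "z \<le> ((q - x) * ?E p + (x - p) * ?E q) / (q - p)"
      using S by (simp add: g(1) pos_le_divide_eq mult.commute)
  qed
  then show "(q - p) * ?E x \<le>
      (q - x) * ?E p + (x - p) * ?E q"
    using S by (simp add: pos_le_divide_eq mult.commute)
qed

theorem theorem4p4:
  fixes \<phi> u0 A :: "real \<Rightarrow> real" and \<rho>0 :: "real measure"
    and M X :: "real \<Rightarrow> real \<Rightarrow> real" and T m m' m'' ml mr :: real
  assumes "interaction_kernel \<phi>"
    and "real_distribution \<rho>0" and "compactly_supported \<rho>0"
    and "L_infinity \<rho>0 u0"
    and A: "A = flux \<phi> \<rho>0 u0"
    and "entropy_solution (primitive \<phi>) A (shifted_cdf \<rho>0) M"
    and X: "X = (\<lambda>n t. gen_inverse (\<lambda>x. M x t) n)"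
    and "convex_near_frontier A"
    and "T \<ge> 0"
    and "is_cluster (\<lambda>n. X n T) m' m''"
    and "m \<in> {m'<..m''}" and "m \<in> Sigma_minus A"
    and "connected_component_set (Sigma_minus A) m = {ml<..<mr}"
    and "\<not> {m'<..m''} \<subseteq> {ml<..mr}"
  shows "{ml<..mr} \<subseteq> {m'<..m''}"
proof -
  let ?I = "{-1/2..1/2::real}" and ?E = "lower_convex_envelope {-1/2..1/2} A"
  obtain LA where LA: "LA \<ge> 0" "\<And>x y. x \<in> ?I \<Longrightarrow> y \<in> ?I \<Longrightarrow> \<bar>A x - A y\<bar> \<le> LA * \<bar>x - y\<bar>"
    using flux_lipschitz[OF assms(1-4)] unfolding A by metis
  obtain \<rho> where "entropy_flow (primitive \<phi>) A \<rho> (\<lambda>x t. M x (max 0 t)) LA"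
    using entropy_solution_flow[OF primitive_continuous[OF assms(1)] LA assms(6)] by metis
  then interpret entropy_flow "primitive \<phi>" A \<rho> "\<lambda>x t. M x (max 0 t)" LA .
  obtain m0 where cl: "is_cluster_at (\<lambda>n. X n T) m0 m' m''"
    using assms(10) by (auto simp: is_cluster_def)
  then have sub: "{m'<..m''} \<subseteq> {-1/2<..1/2}" and "(\<lambda>n. X n T) constant_on {m'<..m''}"
    unfolding is_cluster_at_def by blast+
  then obtain c where c: "\<And>n. n \<in> {m'<..m''} \<Longrightarrow> X n T = c" unfolding constant_on_def by blast
  have lt: "m' < m''" using assms(11) by auto
  have m'': "m'' \<le> 1/2" using sub lt by auto
  have m': "-1/2 \<le> m'"
  proof (rule ccontr)
    assume "\<not> -1/2 \<le> m'"
    then have "min (-1/2) m'' \<in> {m'<..m''}" using lt by auto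
    from subsetD[OF sub this] show False by simp
  qed
  have chord: "(m'' - \<alpha>) * A m' + (\<alpha> - m') * A m'' \<le> (m'' - m') * A \<alpha>" if \<alpha>: "m' < \<alpha>" "\<alpha> < m''" for \<alpha>
  proof (cases "T = 0")
    case True
    have M0: "(\<lambda>x. M x 0) = shifted_cdf \<rho>0"
      using assms(6) by (auto simp: entropy_solution_def)
    have X0: "gen_inverse (shifted_cdf \<rho>0) n = c" if "n \<in> {m'<..m''}" for n
      using c[OF that] by (simp add: X True M0)
    let ?k = "initial_psi \<phi> \<rho>0 u0 c"
    note affine = flux_affine_on_initial_cluster[OF assms(1-4) m' m'' X0, folded A]
    have eq: "A \<alpha> = A m' + ?k * (\<alpha> - m')" "A m'' = A m' + ?k * (m'' - m')"
      using affine[of m' \<alpha>] affine[of m' m''] \<alpha> by (simp_all add: algebra_simps)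
    show ?thesis unfolding eq by (simp add: algebra_simps)
  next
    case False
    then have "0 < T" using assms(9) by simp
    moreover have "is_cluster_at (\<lambda>n. gen_inverse (\<lambda>x. M x (max 0 T)) n) m0 m' m''"
      using cl assms(9) by (simp add: X max_absorb2)
    ultimately show ?thesis using cluster_admissible \<alpha> by blast
  qed
  have bdd: "A 0 - LA \<le> A y" if "y \<in> ?I" for y
  proof -
    have "LA * \<bar>0 - y\<bar> \<le> LA * 1" using that LA(1) by (intro mult_left_mono) auto
    then show ?thesis using LA(2)[of 0 y] that by auto
  qed
  \<comment> \<open>If A meets its envelope at \<alpha> inside the cluster, but lies strictly above
    it at an end, then the chord of the envelope at \<alpha> is strictly below the chord of A, which
    is at most A(\<alpha>) and so at most the envelope. This contradicts the convexity of the
    envelope.\<close>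
  have touch: False if \<alpha>: "m' < \<alpha>" "\<alpha> < m''" "A \<alpha> \<le> ?E \<alpha>" and strict: "?E m' < A m' \<or> ?E m'' < A m''" for \<alpha>
  proof -
    have I: "m' \<in> ?I" "m'' \<in> ?I" using m' m'' lt by auto
    note E = lower_convex_envelope_three_points[where f=A and S="?I" and B="A 0 - LA", OF bdd convex_real_interval(5) I \<alpha>(1,2)]
    have "(m'' - \<alpha>) * ?E m' + (\<alpha> - m') * ?E m'' < (m'' - \<alpha>) * A m' + (\<alpha> - m') * A m''"
      using strict
    proof
      assume "?E m' < A m'"
      then show ?thesis using E(3) \<alpha> by (intro add_less_le_mono mult_strict_left_mono mult_left_mono) auto
    next
      assume "?E m'' < A m''"
      then show ?thesis using E(2) \<alpha> by (intro add_le_less_mono mult_strict_left_mono mult_left_mono) auto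
    qed
    also have "\<dots> \<le> (m'' - m') * A \<alpha>" using chord \<alpha> by blast
    also have "\<dots> \<le> (m'' - m') * ?E \<alpha>" using \<alpha> by (intro mult_left_mono) auto
    finally show False using E(1) by simp
  qed
  have Sig: "?E x < A x" if "x \<in> Sigma_minus A" for x using that by (simp add: Sigma_minus_def)
  have notSig: "A x \<le> ?E x" if "x \<notin> Sigma_minus A" "-1/2 < x" "x < 1/2" for x
    using that by (auto simp: Sigma_minus_def)
  have mm: "ml < m" "m < mr"
    using assms(12,13) connected_component_refl_eq[of "Sigma_minus A" m] by auto
  have comp: "{ml<..<mr} \<subseteq> Sigma_minus A"
    using assms(13) connected_component_subset[of "Sigma_minus A" m] by simp
  \<comment> \<open>An end point inside the open set could be adjoined to the component and give a
    larger connected subset.\<close>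
  have ml: "ml \<notin> Sigma_minus A"
  proof
    assume "ml \<in> Sigma_minus A"
    then have "{ml..<mr} \<subseteq> Sigma_minus A" using comp by (auto simp: subset_iff less_le)
    then have "{ml..<mr} \<subseteq> {ml<..<mr}"
      using connected_component_maximal[of m "{ml..<mr}" "Sigma_minus A"] mm assms(13) by (auto simp: is_interval_connected_1[symmetric] is_interval_co)
    then show False using mm by force
  qed
  have mr: "mr \<notin> Sigma_minus A"
  proof
    assume "mr \<in> Sigma_minus A"
    then have "{ml<..mr} \<subseteq> Sigma_minus A" using comp by (auto simp: subset_iff less_le)
    then have "{ml<..mr} \<subseteq> {ml<..<mr}"
      using connected_component_maximal[of m "{ml<..mr}" "Sigma_minus A"] mm assms(13) by (auto simp: is_interval_connected_1[symmetric] is_interval_oc)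
    from subsetD[OF this, of mr] show False using mm by simp
  qed
  have m_in: "-1/2 < m" "m < 1/2" using assms(12) by (simp_all add: Sigma_minus_def)
  \<comment> \<open>Otherwise m'' lies in the component, where A is above its envelope, while A
    meets the envelope at ml inside the cluster.\<close>
  have 1: "mr \<le> m''" if "m' < ml"
  proof (rule ccontr)
    assume "\<not> mr \<le> m''"
    then have "m'' \<in> Sigma_minus A" using comp mm assms(11) by auto
    then show False
      using touch[of ml] Sig notSig[OF ml] that mm assms(11) m' m_in by auto
  qed
  have 2: "m' \<le> ml" if "mr < m''"
  proof (rule ccontr)
    assume "\<not> m' \<le> ml"
    then have "m' \<in> Sigma_minus A" using comp mm assms(11) by auto
    then show False
      using touch[of mr] Sig notSig[OF mr] that mm assms(11) m'' m_in by auto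
  qed
  \<comment> \<open>The cluster sticks out of the component on one side, and either side forces it
    to cover the other end as well.\<close>
  have "m' < ml \<or> mr < m''"
  proof (rule ccontr)
    assume "\<not> (m' < ml \<or> mr < m'')"
    then have "{m'<..m''} \<subseteq> {ml<..mr}" by auto
    with assms(14) show False by blast
  qed
  then have "m' \<le> ml" "mr \<le> m''" using 1 2 by auto
  then show ?thesis by auto
qed

end
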